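(* On a pqc manifold of dimension $4n+3>7$ with fixed $g\in[g]$, canonical pqc connection and fundamental four-form $\Omega=-\omega_1\wedge\omega_1-\omega_2\wedge\omega_2+\omega_3\wedge\omega_3$, the torsion tensors satisfy, for all horizontal $X,Y$ (the first identity holding for every cyclic permutation $(i,j,k)$ of $(1,2,3)$): $$\mu(X,Y)=-\frac1{32n}\Big[d\Omega(\xi_i,X,I_kY,e_a,I_je_a)-\epsilon_kd\Omega(\xi_i,I_iX,I_jY,e_a,I_je_a)\Big],$$ $$\tau(X,Y)=\frac1{16(1-n)}\sum_{(ijk)}\Big[d\Omega(\xi_i,X,I_kY,e_a,I_je_a)+\epsilon_kd\Omega(\xi_i,I_iX,I_jY,e_a,I_je_a)\Big],$$ where $\sum_{(ijk)}$ is the sum over the cyclic permutations of $(1,2,3)$.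
   Context: Put $\epsilon_1=\epsilon_2=1$, $\epsilon_3=-1$; $(i,j,k)$ denotes any cyclic permutation of $(1,2,3)$, $s,t\in\{1,2,3\}$; $X,Y,\dots$ denote horizontal vectors. $d\eta(A,B)=A\eta(B)-B\eta(A)-\eta([A,B])$, and wedge products are normalized so that $(\alpha\wedge\beta)(A,B)=\alpha(A)\beta(B)-\alpha(B)\beta(A)$ for 1-forms. A pqc manifold $(M,[g],\mathbb{PQ})$ is a smooth $(4n+3)$-dimensional manifold $M$ with a codimension-three distribution $H$, a conformal class $[g]$ of metrics of signature $(2n,2n)$ on $H$, and a rank-three bundle $\mathbb{PQ}\subset\mathrm{End}(H)$ locally spanned by $I_1,I_2,I_3$ with $I_s^2=\epsilon_s\,\mathrm{id}_H$, $I_iI_j=-I_jI_i=-\epsilon_kI_k$, $g(I_s\cdot,I_s\cdot)=-\epsilon_s g$, and such that locally $H=\bigcap_s\ker\eta_s$ for 1-forms $\eta_s$ with $d\eta_s(X,Y)=-2\epsilon_s g(I_sX,Y)$ on $H$. With $g$ fixed, $(\eta_s,I_s)$ denotes such compatible local data; $\omega_s(X,Y)=g(I_sX,Y)$ on $H$, extended by zero on $V$. Reeb vector fields: the unique local $\xi_1,\xi_2,\xi_3$ with $\eta_s(\xi_t)=\delta_{st}$, $(\xi_s\lrcorner d\eta_s)_{|H}=0$, $(\xi_j\lrcorner d\eta_i)_{|H}=\epsilon_k(\xi_i\lrcorner d\eta_j)_{|H}$. $V=\mathrm{span}\{\xi_s\}$, $TM=H\oplus V$; $g$ is extended to $M$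 by $g=g_{|H}-\sum_s\epsilon_s\eta_s\otimes\eta_s$, $H\perp V$. The canonical pqc connection is the unique linear connection $\nabla$ preserving $H\oplus V$, $g$ and $\mathbb{PQ}$, with torsion $T(A,B)=\nabla_AB-\nabla_BA-[A,B]$ satisfying $T(X,Y)=-[X,Y]_{|V}$ for $X,Y\in H$, with $X\mapsto T(\xi,X)_{|H}$ in $(sp(n,\mathbb R)\oplus sp(1,\mathbb R))^\perp\subset\mathrm{End}(H)$ for $\xi\in V$, and with the map $V\to\mathbb{PQ}$, $\xi_s\mapsto I_s$, parallel. Here $sp(1,\mathbb R)=\mathrm{span}\{I_s\}$, $sp(n,\mathbb R)$ is the space of $g$-skew endomorphisms of $H$ commuting with all $I_s$, and $\langle A,B\rangle=\sum_ag(e_a,e_a)g(Ae_a,Be_a)$. Torsion tensors: with $T(\xi,X,Y)=g(T(\xi,X),Y)=T^{sym}+T^a$ (symmetric and skew parts in $X,Y\in H$), $\tau(X,Y)=-\sum_s\epsilon_sT^{sym}(\xi_s,I_sX,Y)$ and $\mu(X,Y)=\epsilon_sT^a(\xi_s,I_sX,Y)$ (independent of $s$). Repeated $e_a$ means the $g$-trace over a $g$-orthonormal basis of $H$: $P(e_a,e_a)=\sum_ag(e_a,e_a)P(e_a,e_a)$. *)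

theory Defs
  imports "HOL-Analysis.Analysis" "HOL-Library.Function_Algebras"
begin

section \<open>Smooth manifolds, vector fields and differential forms\<close>

(* A k-fold continuously differentiable map on an open set, by iterated partial derivatives. *)
primrec Ck_on :: "nat \<Rightarrow> 'a::euclidean_space set \<Rightarrow> ('a \<Rightarrow> 'b::real_normed_vector) \<Rightarrow> bool" where
  "Ck_on 0 S f \<longleftrightarrow> continuous_on S f"
| "Ck_on (Suc k) S f \<longleftrightarrow> f differentiable_on S \<and>
     (\<forall>b\<in>Basis. Ck_on k S (\<lambda>x. frechet_derivative f (at x) b))"

definition smooth_on :: "'a::euclidean_space set \<Rightarrow> ('a \<Rightarrow> 'b::real_normed_vector) \<Rightarrow> bool" where
  "smooth_on S f \<longleftrightarrow> (\<forall>k. Ck_on k S f)"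

type_synonym ('m, 'e) chart = "'m set \<times> ('m \<Rightarrow> 'e)"

definition smooth_manifold ::
    "('m::{t2_space, second_countable_topology}, 'e::euclidean_space) chart set \<Rightarrow> bool" where
  "smooth_manifold \<A> \<longleftrightarrow>
     (\<forall>(U, \<phi>)\<in>\<A>. open U \<and> open (\<phi> ` U) \<and> homeomorphism U (\<phi> ` U) \<phi> (inv_into U \<phi>)) \<and>
     (\<Union>(U, \<phi>)\<in>\<A>. U) = UNIV \<and>
     (\<forall>(U, \<phi>)\<in>\<A>. \<forall>(V, \<psi>)\<in>\<A>. smooth_on (\<phi> ` (U \<inter> V)) (\<psi> \<circ> inv_into U \<phi>))"

definition smooth_fun ::
    "('m::topological_space, 'e::euclidean_space) chart set \<Rightarrow> 'm set \<Rightarrow> ('m \<Rightarrow> real) \<Rightarrow> bool" where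
  "smooth_fun \<A> W f \<longleftrightarrow>
     open W \<and> (\<forall>(U, \<phi>)\<in>\<A>. smooth_on (\<phi> ` (U \<inter> W)) (f \<circ> inv_into U \<phi>))"

definition smooth_near ::
    "('m::topological_space, 'e::euclidean_space) chart set \<Rightarrow> 'm \<Rightarrow> ('m \<Rightarrow> real) \<Rightarrow> bool" where
  "smooth_near \<A> p f \<longleftrightarrow> (\<exists>W. p \<in> W \<and> smooth_fun \<A> W f)"

(* Tangent vectors are derivations; the pointwise vector space structure on functions makes
   each tangent space a subspace of the following type. *)
type_synonym 'm tvec = "('m \<Rightarrow> real) \<Rightarrow> real"

instantiation "fun" :: (type, real_vector) real_vector
begin

definition scaleR_fun :: "real \<Rightarrow> ('a \<Rightarrow> 'b) \<Rightarrow> 'a \<Rightarrow> 'b" where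
  "scaleR_fun c f = (\<lambda>x. c *\<^sub>R f x)"

instance
  by standard (simp_all add: scaleR_fun_def plus_fun_def fun_eq_iff scaleR_add_right scaleR_add_left)

end

(* Derivations at p of the functions smooth near p; the value 0 is prescribed on all other
   functions, so that a derivation is determined by its values on functions smooth near p.
   Locality (equal values on functions that agree near p) follows from the Leibniz rule. *)
definition tangent_space ::
    "('m::topological_space, 'e::euclidean_space) chart set \<Rightarrow> 'm \<Rightarrow> 'm tvec set" where
  "tangent_space \<A> p = {v.
     (\<forall>f h. smooth_near \<A> p f \<and> smooth_near \<A> p h \<longrightarrow>
        v (\<lambda>q. f q + h q) = v f + v h \<and>
        v (\<lambda>q. f q * h q) = f p * v h + h p * v f) \<and>
     (\<forall>f c. smooth_near \<A> p f \<longrightarrow> v (\<lambda>q. c * f q) = c * v f) \<and>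
     (\<forall>f. \<not> smooth_near \<A> p f \<longrightarrow> v f = 0)}"

type_synonym 'm vfield = "'m \<Rightarrow> 'm tvec"

definition smooth_field ::
    "('m::topological_space, 'e::euclidean_space) chart set \<Rightarrow> 'm set \<Rightarrow> 'm vfield \<Rightarrow> bool" where
  "smooth_field \<A> W A \<longleftrightarrow> open W \<and> (\<forall>p\<in>W. A p \<in> tangent_space \<A> p) \<and>
     (\<forall>W' f. W' \<subseteq> W \<and> smooth_fun \<A> W' f \<longrightarrow> smooth_fun \<A> W' (\<lambda>p. A p f))"

definition lie_bracket ::
    "('m::topological_space, 'e::euclidean_space) chart set \<Rightarrow> 'm vfield \<Rightarrow> 'm vfield \<Rightarrow> 'm vfield" where
  "lie_bracket \<A> A B p =
     (\<lambda>f. if smooth_near \<A> p f then A p (\<lambda>q. B q f) - B p (\<lambda>q. A q f) else 0)"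

(* A vector field, smooth near p, with prescribed value at p.  It is only used to evaluate
   tensors (exterior derivative, torsion), whose values do not depend on the choice. *)
definition extend ::
    "('m::topological_space, 'e::euclidean_space) chart set \<Rightarrow> 'm \<Rightarrow> 'm tvec \<Rightarrow> 'm vfield" where
  "extend \<A> p v = (SOME A. A p = v \<and> (\<exists>W. p \<in> W \<and> smooth_field \<A> W A))"

(* A k-form is evaluated on lists of k tangent vectors. *)
type_synonym 'm form = "'m \<Rightarrow> 'm tvec list \<Rightarrow> real"

definition drop_nth :: "nat \<Rightarrow> 'a list \<Rightarrow> 'a list" where
  "drop_nth i xs = take i xs @ drop (Suc i) xs"

(* d\<omega>(A_0,...,A_k) = \<Sum>_i (-1)^i A_i(\<omega>(..., omit A_i, ...))
     + \<Sum>_(i<j) (-1)^(i+j) \<omega>([A_i,A_j], ..., omit A_i, A_j, ...) *)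
definition ext_deriv ::
    "('m::topological_space, 'e::euclidean_space) chart set \<Rightarrow> 'm form \<Rightarrow> 'm form" where
  "ext_deriv \<A> \<omega> p vs =
     (let As = map (extend \<A> p) vs; m = length vs in
       (\<Sum>i<m. (-1) ^ i * (vs ! i) (\<lambda>q. \<omega> q (map (\<lambda>A. A q) (drop_nth i As)))) +
       (\<Sum>j<m. \<Sum>i<j. (-1) ^ (i + j) *
          \<omega> p (lie_bracket \<A> (As ! i) (As ! j) p # drop_nth i (drop_nth j vs))))"

(* The factor 1/(k! l!) gives (\<alpha> \<and> \<beta>)(A,B) = \<alpha>(A)\<beta>(B) - \<alpha>(B)\<beta>(A) for 1-forms. *)
definition wedge :: "nat \<Rightarrow> nat \<Rightarrow> 'm form \<Rightarrow> 'm form \<Rightarrow> 'm form" where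
  "wedge k l \<alpha> \<beta> p vs =
     (\<Sum>\<sigma> | \<sigma> permutes {..<k + l}. of_int (sign \<sigma>) *
        \<alpha> p (map (\<lambda>a. vs ! \<sigma> a) [0..<k]) * \<beta> p (map (\<lambda>a. vs ! \<sigma> a) [k..<k + l]))
     / (fact k * fact l)"

lemma wedge_one_forms:
  "wedge 1 1 \<alpha> \<beta> p [A, B] = \<alpha> p [A] * \<beta> p [B] - \<alpha> p [B] * \<beta> p [A]"
proof -
  have "{..<1 + 1} = {0::nat, 1}" by auto
  then show ?thesis
    by (simp add: wedge_def sum_over_permutations_insert sign_swap_id)
qed

definition linear_on :: "'a::real_vector set \<Rightarrow> ('a \<Rightarrow> 'b::real_vector) \<Rightarrow> bool" where
  "linear_on S f \<longleftrightarrow>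
     (\<forall>x\<in>S. \<forall>y\<in>S. f (x + y) = f x + f y) \<and> (\<forall>x\<in>S. \<forall>c. f (c *\<^sub>R x) = c *\<^sub>R f x)"

definition smooth_one_form ::
    "('m::topological_space, 'e::euclidean_space) chart set \<Rightarrow> 'm set \<Rightarrow> ('m \<Rightarrow> 'm tvec \<Rightarrow> real) \<Rightarrow> bool" where
  "smooth_one_form \<A> U \<alpha> \<longleftrightarrow> (\<forall>p\<in>U. linear_on (tangent_space \<A> p) (\<alpha> p)) \<and>
     (\<forall>W A. W \<subseteq> U \<and> smooth_field \<A> W A \<longrightarrow> smooth_fun \<A> W (\<lambda>p. \<alpha> p (A p)))"

definition d_one :: "('m::topological_space, 'e::euclidean_space) chart set \<Rightarrow>
    ('m \<Rightarrow> 'm tvec \<Rightarrow> real) \<Rightarrow> 'm \<Rightarrow> 'm tvec \<Rightarrow> 'm tvec \<Rightarrow> real" where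
  "d_one \<A> \<alpha> p v w = ext_deriv \<A> (\<lambda>q vs. \<alpha> q (hd vs)) p [v, w]"

lemma d_one_eq:
  "d_one \<A> \<alpha> p v w =
     v (\<lambda>q. \<alpha> q (extend \<A> p w q)) - w (\<lambda>q. \<alpha> q (extend \<A> p v q))
     - \<alpha> p (lie_bracket \<A> (extend \<A> p v) (extend \<A> p w) p)"
  by (simp add: d_one_def ext_deriv_def drop_nth_def numeral_2_eq_2)

(* nab p v B is the covariant derivative of the local vector field B in the direction v at p.
   Like every differential operator it acts on fields defined on arbitrary open sets. *)
type_synonym 'm connection = "'m \<Rightarrow> 'm tvec \<Rightarrow> 'm vfield \<Rightarrow> 'm tvec"

definition linear_connection ::
    "('m::topological_space, 'e::euclidean_space) chart set \<Rightarrow> 'm connection \<Rightarrow> bool" where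
  "linear_connection \<A> nab \<longleftrightarrow> (\<forall>W A B. smooth_field \<A> W A \<and> smooth_field \<A> W B \<longrightarrow>
     smooth_field \<A> W (\<lambda>p. nab p (A p) B) \<and>
     (\<forall>p\<in>W. linear_on (tangent_space \<A> p) (\<lambda>v. nab p v B) \<and>
       (\<forall>v\<in>tangent_space \<A> p.
         nab p v B \<in> tangent_space \<A> p \<and>
         nab p v (\<lambda>q. A q + B q) = nab p v A + nab p v B \<and>
         (\<forall>f. smooth_fun \<A> W f \<longrightarrow> nab p v (\<lambda>q. f q *\<^sub>R B q) = v f *\<^sub>R B p + f p *\<^sub>R nab p v B) \<and>
         ((\<forall>q\<in>W. A q = B q) \<longrightarrow> nab p v A = nab p v B))))"

definition torsion :: "('m::topological_space, 'e::euclidean_space) chart set \<Rightarrow> 'm connection \<Rightarrow>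
    'm \<Rightarrow> 'm tvec \<Rightarrow> 'm tvec \<Rightarrow> 'm tvec" where
  "torsion \<A> nab p v w =
     nab p v (extend \<A> p w) - nab p w (extend \<A> p v)
     - lie_bracket \<A> (extend \<A> p v) (extend \<A> p w) p"


section \<open>Paraquaternionic contact structures\<close>

(* The indices 1, 2, 3 are the elements of the three-element type 3. *)
definition eps :: "3 \<Rightarrow> real" where
  "eps s = (if s = 3 then - 1 else 1)"

definition cyclic_perms :: "(3 \<times> 3 \<times> 3) set" where
  "cyclic_perms = {(1, 2, 3), (2, 3, 1), (3, 1, 2)}"

type_synonym 'm dist = "'m \<Rightarrow> 'm tvec set"
type_synonym 'm hmetric = "'m \<Rightarrow> 'm tvec \<Rightarrow> 'm tvec \<Rightarrow> real"
type_synonym 'm endo = "'m \<Rightarrow> 'm tvec \<Rightarrow> 'm tvec"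

definition distribution ::
    "('m::topological_space, 'e::euclidean_space) chart set \<Rightarrow> nat \<Rightarrow> 'm dist \<Rightarrow> bool" where
  "distribution \<A> r H \<longleftrightarrow>
     (\<forall>p. subspace (H p) \<and> H p \<subseteq> tangent_space \<A> p \<and> dim (H p) = r) \<and>
     (\<forall>p. \<exists>U E. p \<in> U \<and> (\<forall>a<r. smooth_field \<A> U (E a)) \<and>
        (\<forall>q\<in>U. H q = span ((\<lambda>a. E a q) ` {..<r})))"

definition orthonormal_basis ::
    "'a::real_vector set \<Rightarrow> ('a \<Rightarrow> 'a \<Rightarrow> real) \<Rightarrow> nat \<Rightarrow> (nat \<Rightarrow> 'a) \<Rightarrow> bool" where
  "orthonormal_basis S b r e \<longleftrightarrow>
     (\<forall>a<r. e a \<in> S) \<and> inj_on e {..<r} \<and> independent (e ` {..<r}) \<and> span (e ` {..<r}) = S \<and>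
     (\<forall>a<r. b (e a) (e a) = 1 \<or> b (e a) (e a) = - 1) \<and>
     (\<forall>a<r. \<forall>c<r. a \<noteq> c \<longrightarrow> b (e a) (e c) = 0)"

definition g_trace ::
    "('a \<Rightarrow> 'a \<Rightarrow> real) \<Rightarrow> nat \<Rightarrow> (nat \<Rightarrow> 'a) \<Rightarrow> ('a \<Rightarrow> 'a \<Rightarrow> real) \<Rightarrow> real" where
  "g_trace b r e P = (\<Sum>a<r. b (e a) (e a) * P (e a) (e a))"

definition horizontal_field ::
    "('m::topological_space, 'e::euclidean_space) chart set \<Rightarrow> 'm dist \<Rightarrow> 'm set \<Rightarrow> 'm vfield \<Rightarrow> bool" where
  "horizontal_field \<A> H W X \<longleftrightarrow> smooth_field \<A> W X \<and> (\<forall>p\<in>W. X p \<in> H p)"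

(* Metrics of signature (2n,2n) on H; their values outside H carry no meaning. *)
definition neutral_metric ::
    "('m::topological_space, 'e::euclidean_space) chart set \<Rightarrow> nat \<Rightarrow> 'm dist \<Rightarrow> 'm hmetric \<Rightarrow> bool" where
  "neutral_metric \<A> n H g \<longleftrightarrow>
     (\<forall>p. (\<forall>x\<in>H p. linear_on (H p) (g p x)) \<and> (\<forall>x\<in>H p. \<forall>y\<in>H p. g p x y = g p y x) \<and>
        (\<exists>e. orthonormal_basis (H p) (g p) (4 * n) e \<and>
           card {a. a < 4 * n \<and> g p (e a) (e a) = 1} = 2 * n \<and>
           card {a. a < 4 * n \<and> g p (e a) (e a) = - 1} = 2 * n)) \<and>
     (\<forall>W X Y. horizontal_field \<A> H W X \<and> horizontal_field \<A> H W Y \<longrightarrow>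
        smooth_fun \<A> W (\<lambda>p. g p (X p) (Y p)))"

definition conformal_class ::
    "('m::topological_space, 'e::euclidean_space) chart set \<Rightarrow> nat \<Rightarrow> 'm dist \<Rightarrow> 'm hmetric set \<Rightarrow> bool" where
  "conformal_class \<A> n H C \<longleftrightarrow> (\<exists>g0. neutral_metric \<A> n H g0 \<and>
     C = {g. neutral_metric \<A> n H g \<and> (\<exists>f. smooth_fun \<A> UNIV f \<and> (\<forall>p. f p > 0) \<and>
           (\<forall>p. \<forall>x\<in>H p. \<forall>y\<in>H p. g p x y = f p * g0 p x y))})"

definition smooth_endo ::
    "('m::topological_space, 'e::euclidean_space) chart set \<Rightarrow> 'm dist \<Rightarrow> 'm set \<Rightarrow> 'm endo \<Rightarrow> bool" where
  "smooth_endo \<A> H U B \<longleftrightarrow> (\<forall>p\<in>U. linear_on (H p) (B p) \<and> B p ` H p \<subseteq> H p) \<and>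
     (\<forall>W X. W \<subseteq> U \<and> horizontal_field \<A> H W X \<longrightarrow> smooth_field \<A> W (\<lambda>p. B p (X p)))"

(* Elements of the fibres PQ p are maps whose restriction to H p lies in the span of the
   restrictions of I 1, I 2, I 3; endomorphisms of H p are only considered on H p. *)
definition compatible_data ::
    "('m::topological_space, 'e::euclidean_space) chart set \<Rightarrow> 'm dist \<Rightarrow> 'm hmetric \<Rightarrow>
     ('m \<Rightarrow> ('m tvec \<Rightarrow> 'm tvec) set) \<Rightarrow>
     'm set \<Rightarrow> (3 \<Rightarrow> 'm \<Rightarrow> 'm tvec \<Rightarrow> real) \<Rightarrow> (3 \<Rightarrow> 'm endo) \<Rightarrow> bool" where
  "compatible_data \<A> H g PQ U \<eta> I \<longleftrightarrow> open U \<and>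
     (\<forall>s. smooth_one_form \<A> U (\<eta> s) \<and> smooth_endo \<A> H U (I s)) \<and>
     (\<forall>p\<in>U.
        PQ p = {B. \<exists>c :: 3 \<Rightarrow> real. \<forall>x\<in>H p. B x = (\<Sum>s\<in>UNIV. c s *\<^sub>R I s p x)} \<and>
        H p = {v \<in> tangent_space \<A> p. \<forall>s. \<eta> s p v = 0} \<and>
        (\<forall>x\<in>H p.
           (\<forall>s. I s p (I s p x) = eps s *\<^sub>R x) \<and>
           (\<forall>(i, j, k)\<in>cyclic_perms. I i p (I j p x) = - (eps k *\<^sub>R I k p x) \<and>
                                    I j p (I i p x) = eps k *\<^sub>R I k p x) \<and>
           (\<forall>y\<in>H p. \<forall>s. g p (I s p x) (I s p y) = - eps s * g p x y \<and>
                        d_one \<A> (\<eta> s) p x y = - 2 * eps s * g p (I s p x) y)))"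

definition pqc_manifold ::
    "('m::{t2_space, second_countable_topology}, 'e::euclidean_space) chart set \<Rightarrow> nat \<Rightarrow> 'm dist \<Rightarrow>
     'm hmetric set \<Rightarrow> ('m \<Rightarrow> ('m tvec \<Rightarrow> 'm tvec) set) \<Rightarrow> bool" where
  "pqc_manifold \<A> n H C PQ \<longleftrightarrow>
     smooth_manifold \<A> \<and> DIM('e) = 4 * n + 3 \<and> distribution \<A> (4 * n) H \<and>
     conformal_class \<A> n H C \<and>
     (\<forall>g\<in>C. \<forall>p. \<exists>U \<eta> I. p \<in> U \<and> compatible_data \<A> H g PQ U \<eta> I)"

definition reeb_fields ::
    "('m::topological_space, 'e::euclidean_space) chart set \<Rightarrow> 'm dist \<Rightarrow> 'm set \<Rightarrow>
     (3 \<Rightarrow> 'm \<Rightarrow> 'm tvec \<Rightarrow> real) \<Rightarrow> (3 \<Rightarrow> 'm vfield) \<Rightarrow> bool" where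
  "reeb_fields \<A> H U \<eta> \<xi> \<longleftrightarrow> (\<forall>s. smooth_field \<A> U (\<xi> s)) \<and>
     (\<forall>p\<in>U. (\<forall>s t. \<eta> s p (\<xi> t p) = (if s = t then 1 else 0)) \<and>
        (\<forall>x\<in>H p. (\<forall>s. d_one \<A> (\<eta> s) p (\<xi> s p) x = 0) \<and>
           (\<forall>(i, j, k)\<in>cyclic_perms.
              d_one \<A> (\<eta> i) p (\<xi> j p) x = eps k * d_one \<A> (\<eta> j) p (\<xi> i p) x)))"

definition vertical :: "(3 \<Rightarrow> 'm vfield) \<Rightarrow> 'm dist" where
  "vertical \<xi> p = span (range (\<lambda>s. \<xi> s p))"

definition vproj :: "(3 \<Rightarrow> 'm \<Rightarrow> 'm tvec \<Rightarrow> real) \<Rightarrow> (3 \<Rightarrow> 'm vfield) \<Rightarrow> 'm endo" where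
  "vproj \<eta> \<xi> p v = (\<Sum>s\<in>UNIV. \<eta> s p v *\<^sub>R \<xi> s p)"

definition hproj :: "(3 \<Rightarrow> 'm \<Rightarrow> 'm tvec \<Rightarrow> real) \<Rightarrow> (3 \<Rightarrow> 'm vfield) \<Rightarrow> 'm endo" where
  "hproj \<eta> \<xi> p v = v - vproj \<eta> \<xi> p v"

definition ext_metric :: "'m hmetric \<Rightarrow> (3 \<Rightarrow> 'm \<Rightarrow> 'm tvec \<Rightarrow> real) \<Rightarrow> (3 \<Rightarrow> 'm vfield) \<Rightarrow> 'm hmetric" where
  "ext_metric g \<eta> \<xi> p v w =
     g p (hproj \<eta> \<xi> p v) (hproj \<eta> \<xi> p w) - (\<Sum>s\<in>UNIV. eps s * \<eta> s p v * \<eta> s p w)"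

definition sp_n :: "'m dist \<Rightarrow> 'm hmetric \<Rightarrow> (3 \<Rightarrow> 'm endo) \<Rightarrow> 'm \<Rightarrow> ('m tvec \<Rightarrow> 'm tvec) set" where
  "sp_n H g I p = {B. linear_on (H p) B \<and> B ` H p \<subseteq> H p \<and>
     (\<forall>x\<in>H p. \<forall>y\<in>H p. g p (B x) y = - g p x (B y)) \<and>
     (\<forall>s. \<forall>x\<in>H p. B (I s p x) = I s p (B x))}"

definition sp_1 :: "(3 \<Rightarrow> 'm endo) \<Rightarrow> 'm \<Rightarrow> ('m tvec \<Rightarrow> 'm tvec) set" where
  "sp_1 I p = span (range (\<lambda>s. I s p))"

definition in_sp_perp ::
    "nat \<Rightarrow> 'm dist \<Rightarrow> 'm hmetric \<Rightarrow> (3 \<Rightarrow> 'm endo) \<Rightarrow> 'm \<Rightarrow> ('m tvec \<Rightarrow> 'm tvec) \<Rightarrow> bool" where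
  "in_sp_perp n H g I p A \<longleftrightarrow>
     linear_on (H p) A \<and> A ` H p \<subseteq> H p \<and>
     (\<forall>B\<in>sp_n H g I p. \<forall>B'\<in>sp_1 I p. \<forall>e. orthonormal_basis (H p) (g p) (4 * n) e \<longrightarrow>
        g_trace (g p) (4 * n) e (\<lambda>x y. g p (A x) (B y + B' y)) = 0)"

(* The conditions are imposed for all compatible local data; they do not depend on that choice.
   For a local section B of PQ, (\<nabla>_v B) X = \<nabla>_v (B X) - B (\<nabla>_v X). *)
definition canonical_pqc_connection ::
    "('m::topological_space, 'e::euclidean_space) chart set \<Rightarrow> nat \<Rightarrow> 'm dist \<Rightarrow> 'm hmetric \<Rightarrow>
     ('m \<Rightarrow> ('m tvec \<Rightarrow> 'm tvec) set) \<Rightarrow> 'm connection \<Rightarrow> bool" where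
  "canonical_pqc_connection \<A> n H g PQ nab \<longleftrightarrow> linear_connection \<A> nab \<and>
     (\<forall>U \<eta> I \<xi>. compatible_data \<A> H g PQ U \<eta> I \<and> reeb_fields \<A> H U \<eta> \<xi> \<longrightarrow>
       (\<forall>W p v. W \<subseteq> U \<and> p \<in> W \<and> v \<in> tangent_space \<A> p \<longrightarrow>
         (\<forall>X. horizontal_field \<A> H W X \<longrightarrow> nab p v X \<in> H p) \<and>
         (\<forall>Z. smooth_field \<A> W Z \<and> (\<forall>q\<in>W. Z q \<in> vertical \<xi> q) \<longrightarrow> nab p v Z \<in> vertical \<xi> p) \<and>
         (\<forall>A B. smooth_field \<A> W A \<and> smooth_field \<A> W B \<longrightarrow>
            v (\<lambda>q. ext_metric g \<eta> \<xi> q (A q) (B q)) =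
              ext_metric g \<eta> \<xi> p (nab p v A) (B p) + ext_metric g \<eta> \<xi> p (A p) (nab p v B)) \<and>
         (\<forall>B. open W \<and> smooth_endo \<A> H W B \<and> (\<forall>q\<in>W. B q \<in> PQ q) \<longrightarrow>
            (\<exists>B'\<in>PQ p. \<forall>W' X. W' \<subseteq> W \<and> p \<in> W' \<and> horizontal_field \<A> H W' X \<longrightarrow>
               nab p v (\<lambda>q. B q (X q)) - B p (nab p v X) = B' (X p))) \<and>
         (\<forall>s X. horizontal_field \<A> H W X \<longrightarrow>
            nab p v (\<lambda>q. I s q (X q)) - I s p (nab p v X) =
              (\<Sum>t\<in>UNIV. \<eta> t p (nab p v (\<xi> s)) *\<^sub>R I t p (X p))) \<and>
         (\<forall>X Y. horizontal_field \<A> H W X \<and> horizontal_field \<A> H W Y \<longrightarrow>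
            torsion \<A> nab p (X p) (Y p) = - vproj \<eta> \<xi> p (lie_bracket \<A> X Y p))) \<and>
       (\<forall>p\<in>U. \<forall>z\<in>vertical \<xi> p.
          in_sp_perp n H g I p (\<lambda>x. hproj \<eta> \<xi> p (torsion \<A> nab p z x))))"


section \<open>Torsion tensors and the fundamental four-form\<close>

definition tors3 :: "('m::topological_space, 'e::euclidean_space) chart set \<Rightarrow> 'm hmetric \<Rightarrow>
    'm connection \<Rightarrow> (3 \<Rightarrow> 'm \<Rightarrow> 'm tvec \<Rightarrow> real) \<Rightarrow> (3 \<Rightarrow> 'm vfield) \<Rightarrow>
    'm \<Rightarrow> 'm tvec \<Rightarrow> 'm tvec \<Rightarrow> 'm tvec \<Rightarrow> real" where
  "tors3 \<A> g nab \<eta> \<xi> p z x y = ext_metric g \<eta> \<xi> p (torsion \<A> nab p z x) y"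

definition tors_sym :: "('m::topological_space, 'e::euclidean_space) chart set \<Rightarrow> 'm hmetric \<Rightarrow>
    'm connection \<Rightarrow> (3 \<Rightarrow> 'm \<Rightarrow> 'm tvec \<Rightarrow> real) \<Rightarrow> (3 \<Rightarrow> 'm vfield) \<Rightarrow>
    'm \<Rightarrow> 'm tvec \<Rightarrow> 'm tvec \<Rightarrow> 'm tvec \<Rightarrow> real" where
  "tors_sym \<A> g nab \<eta> \<xi> p z x y =
     (tors3 \<A> g nab \<eta> \<xi> p z x y + tors3 \<A> g nab \<eta> \<xi> p z y x) / 2"

definition tors_skew :: "('m::topological_space, 'e::euclidean_space) chart set \<Rightarrow> 'm hmetric \<Rightarrow>
    'm connection \<Rightarrow> (3 \<Rightarrow> 'm \<Rightarrow> 'm tvec \<Rightarrow> real) \<Rightarrow> (3 \<Rightarrow> 'm vfield) \<Rightarrow>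
    'm \<Rightarrow> 'm tvec \<Rightarrow> 'm tvec \<Rightarrow> 'm tvec \<Rightarrow> real" where
  "tors_skew \<A> g nab \<eta> \<xi> p z x y =
     (tors3 \<A> g nab \<eta> \<xi> p z x y - tors3 \<A> g nab \<eta> \<xi> p z y x) / 2"

definition tau_tensor :: "('m::topological_space, 'e::euclidean_space) chart set \<Rightarrow> 'm hmetric \<Rightarrow>
    'm connection \<Rightarrow> (3 \<Rightarrow> 'm \<Rightarrow> 'm tvec \<Rightarrow> real) \<Rightarrow> (3 \<Rightarrow> 'm endo) \<Rightarrow> (3 \<Rightarrow> 'm vfield) \<Rightarrow>
    'm \<Rightarrow> 'm tvec \<Rightarrow> 'm tvec \<Rightarrow> real" where
  "tau_tensor \<A> g nab \<eta> I \<xi> p x y =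
     - (\<Sum>s\<in>UNIV. eps s * tors_sym \<A> g nab \<eta> \<xi> p (\<xi> s p) (I s p x) y)"

(* On a pqc manifold of dimension greater than 7 this does not depend on s. *)
definition mu_tensor :: "('m::topological_space, 'e::euclidean_space) chart set \<Rightarrow> 'm hmetric \<Rightarrow>
    'm connection \<Rightarrow> (3 \<Rightarrow> 'm \<Rightarrow> 'm tvec \<Rightarrow> real) \<Rightarrow> (3 \<Rightarrow> 'm endo) \<Rightarrow> (3 \<Rightarrow> 'm vfield) \<Rightarrow>
    3 \<Rightarrow> 'm \<Rightarrow> 'm tvec \<Rightarrow> 'm tvec \<Rightarrow> real" where
  "mu_tensor \<A> g nab \<eta> I \<xi> s p x y =
     eps s * tors_skew \<A> g nab \<eta> \<xi> p (\<xi> s p) (I s p x) y"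

definition omega :: "'m hmetric \<Rightarrow> (3 \<Rightarrow> 'm \<Rightarrow> 'm tvec \<Rightarrow> real) \<Rightarrow> (3 \<Rightarrow> 'm endo) \<Rightarrow>
    (3 \<Rightarrow> 'm vfield) \<Rightarrow> 3 \<Rightarrow> 'm form" where
  "omega g \<eta> I \<xi> s p vs =
     g p (I s p (hproj \<eta> \<xi> p (vs ! 0))) (hproj \<eta> \<xi> p (vs ! 1))"

definition fundamental_form :: "'m hmetric \<Rightarrow> (3 \<Rightarrow> 'm \<Rightarrow> 'm tvec \<Rightarrow> real) \<Rightarrow> (3 \<Rightarrow> 'm endo) \<Rightarrow>
    (3 \<Rightarrow> 'm vfield) \<Rightarrow> 'm form" where
  "fundamental_form g \<eta> I \<xi> p vs =
     - wedge 2 2 (omega g \<eta> I \<xi> 1) (omega g \<eta> I \<xi> 1) p vs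
     - wedge 2 2 (omega g \<eta> I \<xi> 2) (omega g \<eta> I \<xi> 2) p vs
     + wedge 2 2 (omega g \<eta> I \<xi> 3) (omega g \<eta> I \<xi> 3) p vs"

end

theory Submission
  imports Defs
begin

text \<open>
  Write \<open>T\<^sub>i = T(\<xi>\<^sub>i, \<cdot>)\<close> for the horizontal torsion endomorphism, and let it act on forms as a derivation.
  Since \<open>\<nabla>\<Omega> = 0\<close> and \<open>\<Omega>\<close> is horizontal, the horizontal part of \<open>\<xi>\<^sub>i \<lrcorner> d\<Omega>\<close> is \<open>T\<^sub>i\<Omega>\<close>, a combination of the
  \<open>\<theta>\<^sub>i\<^sub>s \<and> \<omega>\<^sub>s\<close> with \<open>\<theta>\<^sub>i\<^sub>s = T\<^sub>i\<omega>\<^sub>s\<close>; its trace against \<open>I\<^sub>j\<close> is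
  \<open>8(n-1)\<theta>\<^sub>i\<^sub>j - 4\<epsilon>\<^sub>j(\<theta>\<^sub>i\<^sub>k(I\<^sub>i\<cdot>,\<cdot>) + \<theta>\<^sub>i\<^sub>k(\<cdot>,I\<^sub>i\<cdot>))\<close>. The closedness of \<open>d\<eta>\<^sub>s\<close> and the Reeb conditions give
  \<open>\<theta>\<^sub>i\<^sub>s + \<theta>\<^sub>s\<^sub>i \<in> span{\<omega>\<^sub>t}\<close>, and orthogonality of \<open>T\<^sub>i\<close> to \<open>sp(1)\<close> improves this to \<open>\<theta>\<^sub>i\<^sub>s = - \<theta>\<^sub>s\<^sub>i\<close>. Together
  with orthogonality to \<open>sp(n)\<close> these are linear relations between the values of the \<open>T\<^sub>i\<close> from which
  \<open>\<mu>\<close> and \<open>\<tau>\<close> can be read off.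
\<close>

section \<open>Smooth functions\<close>

text \<open>\<open>d_one\<close>, \<open>torsion\<close> and \<open>ext_deriv\<close> are evaluated
  on chosen extensions of tangent vectors. For the first two, independence of that choice is proved
  through a tensoriality criterion; for \<open>ext_deriv\<close> of the four-form the chosen
  extensions are kept, and the terms that depend on them cancel. The delicate point of the algebra
  is the trace of \<open>T\<^sub>i\<close>, which orthogonality to \<open>sp(1)\<close> does not
  control, the identity not being in \<open>sp(1)\<close>. Up to a nonzero factor it is the
  \<open>\<omega>\<^sub>i\<close>-coefficient of \<open>\<theta>\<^sub>i\<^sub>i\<close>. That
  coefficient vanishes because \<open>[\<xi>\<^sub>i, \<xi>\<^sub>i] = 0\<close> and because a
  metric connection has no diagonal connection form in the Reeb frame. Only after this do all traces
  of \<open>\<theta>\<^sub>i\<^sub>s\<close> against \<open>I\<^sub>j\<close> vanish, which gives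
  antisymmetry in \<open>i\<close> and \<open>s\<close> and removes these traces from the
  contraction of \<open>T\<^sub>i\<Omega>\<close>. The two denominators differ because the
  correction term in \<open>\<theta>\<^sub>i\<^sub>k\<close> is a multiple of \<mu> in the
  difference of the two traces and cancels in their sum.\<close>

lemma Ck_on_cong:
  assumes "open S" "\<And>x. x \<in> S \<Longrightarrow> f x = h x"
  shows "Ck_on k S f \<longleftrightarrow> Ck_on k S h"
  using assms(2)
proof (induction k arbitrary: f h)
  case 0
  then show ?case by (simp cong: continuous_on_cong)
next
  case (Suc k)
  have fd: "(f has_derivative F) (at x) \<longleftrightarrow> (h has_derivative F) (at x)" if "x \<in> S" for x F
    using has_derivative_transform_within_open[OF _ assms(1) that, of f F UNIV h]
      has_derivative_transform_within_open[OF _ assms(1) that, of h F UNIV f] Suc.prems by auto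
  have "frechet_derivative f (at x) = frechet_derivative h (at x)" if "x \<in> S" for x
    using fd[OF that] by (simp add: frechet_derivative_def)
  then have "Ck_on k S (\<lambda>x. frechet_derivative f (at x) b) \<longleftrightarrow>
      Ck_on k S (\<lambda>x. frechet_derivative h (at x) b)" for b
    by (intro Suc.IH) simp
  moreover have "f differentiable (at x within S) \<longleftrightarrow> h differentiable (at x within S)" if "x \<in> S" for x
    unfolding at_within_open[OF that assms(1)] differentiable_def using fd[OF that] by simp
  ultimately show ?case by (simp add: differentiable_on_def)
qed

lemma Ck_on_Suc_imp: "Ck_on (Suc k) S f \<Longrightarrow> Ck_on k S f"
proof (induction k arbitrary: f)
  case 0
  then show ?case by (simp add: differentiable_imp_continuous_on)
next
  case (Suc k)
  then show ?case by auto
qed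

lemma Ck_on_subset: "Ck_on k S f \<Longrightarrow> S' \<subseteq> S \<Longrightarrow> Ck_on k S' f"
  by (induction k arbitrary: f)
     (auto intro: continuous_on_subset differentiable_on_subset)

lemma Ck_on_const: "Ck_on k S (\<lambda>x. c)"
  by (induction k arbitrary: c) (auto simp: frechet_derivative_const)

lemma Ck_on_add:
  assumes "open S"
  shows "Ck_on k S f \<Longrightarrow> Ck_on k S h \<Longrightarrow> Ck_on k S (\<lambda>x. f x + h x)"
proof (induction k arbitrary: f h)
  case 0
  then show ?case by (simp add: continuous_on_add)
next
  case (Suc k)
  have d: "f differentiable (at x)" "h differentiable (at x)" if "x \<in> S" for x
    using Suc.prems(1,2)[unfolded Ck_on.simps(2) differentiable_on_def, THEN conjunct1, rule_format, OF that]
    unfolding at_within_open[OF that assms] by simp_all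
  have fd: "frechet_derivative (\<lambda>x. f x + h x) (at x)
      = (\<lambda>b. frechet_derivative f (at x) b + frechet_derivative h (at x) b)" if "x \<in> S" for x
    using d[OF that] by (intro frechet_derivative_at[symmetric] has_derivative_add)
      (simp_all add: frechet_derivative_works)
  have "Ck_on k S (\<lambda>x. frechet_derivative (\<lambda>x. f x + h x) (at x) b)" if "b \<in> Basis" for b
  proof -
    have "Ck_on k S (\<lambda>x. frechet_derivative f (at x) b + frechet_derivative h (at x) b)"
      using Suc.prems(1,2)[unfolded Ck_on.simps(2), THEN conjunct2] that
      by (intro Suc.IH) (erule (1) bspec)+
    then show ?thesis
      by (rule Ck_on_cong[OF assms, THEN iffD1, rotated]) (simp add: fd)
  qed
  then show ?case
    using Suc.prems(1,2)[unfolded Ck_on.simps(2), THEN conjunct1] by (simp add: differentiable_on_add)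
qed

lemma Ck_on_mult:
  fixes f h :: "'a::euclidean_space \<Rightarrow> real"
  assumes "open S"
  shows "Ck_on k S f \<Longrightarrow> Ck_on k S h \<Longrightarrow> Ck_on k S (\<lambda>x. f x * h x)"
proof (induction k arbitrary: f h)
  case 0
  then show ?case by (simp add: continuous_on_mult)
next
  case (Suc k)
  have d: "f differentiable (at x)" "h differentiable (at x)" if "x \<in> S" for x
    using Suc.prems(1,2)[unfolded Ck_on.simps(2) differentiable_on_def, THEN conjunct1, rule_format, OF that]
    unfolding at_within_open[OF that assms] by simp_all
  have "Ck_on k S (\<lambda>x. frechet_derivative (\<lambda>x. f x * h x) (at x) b)" if b: "b \<in> Basis" for b
  proof -
    have "Ck_on k S (\<lambda>x. f x * frechet_derivative h (at x) b)"
      using Suc.prems(2)[unfolded Ck_on.simps(2), THEN conjunct2] b Ck_on_Suc_imp[OF Suc.prems(1)]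
      by (intro Suc.IH) (erule (1) bspec | assumption)+
    moreover have "Ck_on k S (\<lambda>x. frechet_derivative f (at x) b * h x)"
      using Suc.prems(1)[unfolded Ck_on.simps(2), THEN conjunct2] b Ck_on_Suc_imp[OF Suc.prems(2)]
      by (intro Suc.IH) (erule (1) bspec | assumption)+
    ultimately have *: "Ck_on k S (\<lambda>x. f x * frechet_derivative h (at x) b + frechet_derivative f (at x) b * h x)"
      by (rule Ck_on_add[OF assms])
    have fd: "frechet_derivative (\<lambda>x. f x * h x) (at x) b
        = f x * frechet_derivative h (at x) b + frechet_derivative f (at x) b * h x" if "x \<in> S" for x
    proof -
      have "((\<lambda>x. f x * h x) has_derivative (\<lambda>b. f x * frechet_derivative h (at x) b
          + frechet_derivative f (at x) b * h x)) (at x)"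
        using d[OF that] by (auto intro!: has_derivative_mult simp: frechet_derivative_works)
      from frechet_derivative_at[OF this] show ?thesis by metis
    qed
    from * show ?thesis
      by (rule Ck_on_cong[OF assms, THEN iffD1, rotated]) (simp add: fd)
  qed
  then show ?case
    using Suc.prems(1,2)[unfolded Ck_on.simps(2), THEN conjunct1] by (simp add: differentiable_on_mult)
qed

section \<open>Smooth functions and their germs on a manifold given by an atlas\<close>

locale smooth_atlas =
  fixes \<A> :: "('m::{t2_space, second_countable_topology}, 'e::euclidean_space) chart set"
  assumes atlas: "smooth_manifold \<A>"
begin

lemma open_chart_image:
  assumes "(U, \<phi>) \<in> \<A>" "open W"
  shows "open (\<phi> ` (U \<inter> W))"
proof -
  have c: "open U" "open (\<phi> ` U)" "homeomorphism U (\<phi> ` U) \<phi> (inv_into U \<phi>)"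
    using atlas assms(1) unfolding smooth_manifold_def by auto
  have "\<phi> ` (U \<inter> W) = (\<phi> ` U) \<inter> inv_into U \<phi> -` (U \<inter> W)"
    using c(3) unfolding homeomorphism_def by auto
  moreover have "open (\<phi> ` U \<inter> inv_into U \<phi> -` (U \<inter> W))"
    using c assms(2) unfolding homeomorphism_def
    by (intro continuous_open_preimage) auto
  ultimately show ?thesis by simp
qed

lemma smooth_fun_iff:
  "smooth_fun \<A> W f \<longleftrightarrow> open W \<and>
     (\<forall>U \<phi> k. (U, \<phi>) \<in> \<A> \<longrightarrow> Ck_on k (\<phi> ` (U \<inter> W)) (\<lambda>x. f (inv_into U \<phi> x)))"
  by (auto simp: smooth_fun_def smooth_on_def comp_def)

lemma smooth_fun_open: "smooth_fun \<A> W f \<Longrightarrow> open W"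
  by (simp add: smooth_fun_def)

lemma smooth_fun_subset:
  assumes "smooth_fun \<A> W f" "W' \<subseteq> W" "open W'"
  shows "smooth_fun \<A> W' f"
proof -
  have "\<phi> ` (U \<inter> W') \<subseteq> \<phi> ` (U \<inter> W)" for U and \<phi> :: "'m \<Rightarrow> 'e" using assms(2) by auto
  then show ?thesis
    using assms unfolding smooth_fun_iff by (metis Ck_on_subset)
qed

lemma smooth_fun_cong:
  assumes "\<And>q. q \<in> W \<Longrightarrow> f q = h q"
  shows "smooth_fun \<A> W f \<longleftrightarrow> smooth_fun \<A> W h"
proof -
  have "Ck_on k (\<phi> ` (U \<inter> W)) (\<lambda>x. f (inv_into U \<phi> x)) \<longleftrightarrow> Ck_on k (\<phi> ` (U \<inter> W)) (\<lambda>x. h (inv_into U \<phi> x))"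
    if "(U, \<phi>) \<in> \<A>" "open W" for U \<phi> k
  proof (rule Ck_on_cong[OF open_chart_image[OF that]])
    have "inv_into U \<phi> (\<phi> x) = x" if "x \<in> U" for x
      using atlas \<open>(U, \<phi>) \<in> \<A>\<close> that unfolding smooth_manifold_def homeomorphism_def by auto
    then show "f (inv_into U \<phi> x) = h (inv_into U \<phi> x)" if "x \<in> \<phi> ` (U \<inter> W)" for x
      using that assms by auto
  qed
  then show ?thesis unfolding smooth_fun_iff by blast
qed

lemma smooth_fun_const: "open W \<Longrightarrow> smooth_fun \<A> W (\<lambda>q. c)"
  by (auto simp: smooth_fun_def smooth_on_def comp_def Ck_on_const)

lemma smooth_fun_add:
  "smooth_fun \<A> W f \<Longrightarrow> smooth_fun \<A> W h \<Longrightarrow> smooth_fun \<A> W (\<lambda>q. f q + h q)"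
  unfolding smooth_fun_iff by (safe, rule Ck_on_add[OF open_chart_image]) auto

lemma smooth_fun_mult:
  "smooth_fun \<A> W f \<Longrightarrow> smooth_fun \<A> W h \<Longrightarrow> smooth_fun \<A> W (\<lambda>q. f q * h q)"
  unfolding smooth_fun_iff by (safe, rule Ck_on_mult[OF open_chart_image]) auto

lemma smooth_near_cong:
  assumes "eventually (\<lambda>q. f q = h q) (nhds p)"
  shows "smooth_near \<A> p f \<longleftrightarrow> smooth_near \<A> p h"
proof -
  obtain S where S: "open S" "p \<in> S" "\<And>q. q \<in> S \<Longrightarrow> f q = h q"
    using assms by (auto simp: eventually_nhds)
  have *: "smooth_near \<A> p h'" if sf: "smooth_near \<A> p f'" and that: "\<And>q. q \<in> S \<Longrightarrow> f' q = h' q" for f' h'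
  proof -
    obtain W where W: "p \<in> W" "smooth_fun \<A> W f'" using sf unfolding smooth_near_def by (elim exE conjE)
    then have "smooth_fun \<A> (W \<inter> S) f'"
      using S(1) smooth_fun_open[OF W(2)] smooth_fun_subset[OF W(2), of "W \<inter> S"] by auto
    then have "smooth_fun \<A> (W \<inter> S) h'"
      using smooth_fun_cong[of "W \<inter> S" f' h'] that by auto
    then show ?thesis using W(1) S(2) unfolding smooth_near_def by (intro exI[of _ "W \<inter> S"]) simp
  qed
  show ?thesis using *[of f h] *[of h f] S(3) by auto
qed

lemma smooth_near_eventually:
  "smooth_near \<A> p f \<Longrightarrow> eventually (\<lambda>q. smooth_near \<A> q f) (nhds p)"
  unfolding smooth_near_def eventually_nhds using smooth_fun_open by metis

lemma smooth_near2:
  assumes "smooth_near \<A> p f" "smooth_near \<A> p h"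
  obtains W where "p \<in> W" "smooth_fun \<A> W f" "smooth_fun \<A> W h"
proof -
  obtain W where W: "p \<in> W" "smooth_fun \<A> W f"
    using assms(1) unfolding smooth_near_def by (elim exE conjE)
  obtain W' where W': "p \<in> W'" "smooth_fun \<A> W' h"
    using assms(2) unfolding smooth_near_def by (elim exE conjE)
  have "open (W \<inter> W')" using smooth_fun_open[OF W(2)] smooth_fun_open[OF W'(2)] by (rule open_Int)
  then show ?thesis
    using that[of "W \<inter> W'"] W W' smooth_fun_subset[OF W(2), of "W \<inter> W'"]
      smooth_fun_subset[OF W'(2), of "W \<inter> W'"] by simp
qed

lemma smooth_near_const [simp]: "smooth_near \<A> p (\<lambda>q. c)"
  unfolding smooth_near_def using smooth_fun_const[of UNIV] by auto

lemma smooth_near_add [intro]: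
  "smooth_near \<A> p f \<Longrightarrow> smooth_near \<A> p h \<Longrightarrow> smooth_near \<A> p (\<lambda>q. f q + h q)"
  by (erule (1) smooth_near2) (auto simp: smooth_near_def dest: smooth_fun_add)

lemma smooth_near_mult [intro]:
  "smooth_near \<A> p f \<Longrightarrow> smooth_near \<A> p h \<Longrightarrow> smooth_near \<A> p (\<lambda>q. f q * h q)"
  by (erule (1) smooth_near2) (auto simp: smooth_near_def dest: smooth_fun_mult)

lemma smooth_near_minus [intro]:
  "smooth_near \<A> p f \<Longrightarrow> smooth_near \<A> p (\<lambda>q. - f q)"
  using smooth_near_mult[of p "\<lambda>q. - 1" f] by simp

lemma smooth_near_diff [intro]:
  "smooth_near \<A> p f \<Longrightarrow> smooth_near \<A> p h \<Longrightarrow> smooth_near \<A> p (\<lambda>q. f q - h q)"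
  using smooth_near_add[of p f "\<lambda>q. - h q"] smooth_near_minus[of p h] by simp

lemma smooth_near_sum [intro]:
  "(\<And>a. a \<in> F \<Longrightarrow> smooth_near \<A> p (f a)) \<Longrightarrow> smooth_near \<A> p (\<lambda>q. \<Sum>a\<in>F. f a q)"
  by (induction F rule: infinite_finite_induct) auto

end

section \<open>Vector fields near a point\<close>

lemma fun_scaleR_apply [simp]: "(c *\<^sub>R f) x = c *\<^sub>R f x"
  by (simp add: scaleR_fun_def)

context smooth_atlas
begin

lemma tangentI:
  assumes "\<And>f h. smooth_near \<A> p f \<Longrightarrow> smooth_near \<A> p h \<Longrightarrow> v (\<lambda>q. f q + h q) = v f + v h"
    and "\<And>f h. smooth_near \<A> p f \<Longrightarrow> smooth_near \<A> p h \<Longrightarrow> v (\<lambda>q. f q * h q) = f p * v h + h p * v f"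
    and "\<And>f c. smooth_near \<A> p f \<Longrightarrow> v (\<lambda>q. c * f q) = c * v f"
    and "\<And>f. \<not> smooth_near \<A> p f \<Longrightarrow> v f = 0"
  shows "v \<in> tangent_space \<A> p"
  using assms by (auto simp: tangent_space_def)

lemma
  assumes "v \<in> tangent_space \<A> p"
  shows tangent_add: "smooth_near \<A> p f \<Longrightarrow> smooth_near \<A> p h \<Longrightarrow> v (\<lambda>q. f q + h q) = v f + v h"
    and tangent_mult: "smooth_near \<A> p f \<Longrightarrow> smooth_near \<A> p h \<Longrightarrow> v (\<lambda>q. f q * h q) = f p * v h + h p * v f"
    and tangent_cmult: "smooth_near \<A> p f \<Longrightarrow> v (\<lambda>q. c * f q) = c * v f"
    and tangent_nonsmooth: "\<not> smooth_near \<A> p f \<Longrightarrow> v f = 0"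
  using assms unfolding tangent_space_def by blast+

lemma tangent_minus:
  "v \<in> tangent_space \<A> p \<Longrightarrow> smooth_near \<A> p f \<Longrightarrow> v (\<lambda>q. - f q) = - v f"
  using tangent_cmult[of v p f "- 1"] by simp

lemma tangent_diff:
  "v \<in> tangent_space \<A> p \<Longrightarrow> smooth_near \<A> p f \<Longrightarrow> smooth_near \<A> p h \<Longrightarrow> v (\<lambda>q. f q - h q) = v f - v h"
  using tangent_add[of v p f "\<lambda>q. - h q"] tangent_minus[of v p h] smooth_near_minus[of p h] by simp

lemma tangent_const:
  assumes "v \<in> tangent_space \<A> p"
  shows "v (\<lambda>q. c) = 0"
proof -
  have "v (\<lambda>q. 1) = 0"
    using tangent_mult[OF assms, of "\<lambda>q. 1" "\<lambda>q. 1"] by simp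
  then show ?thesis using tangent_cmult[OF assms, of "\<lambda>q. 1" c] by simp
qed

lemma tangent_sum:
  assumes "v \<in> tangent_space \<A> p" "finite F"
  shows "(\<And>a. a \<in> F \<Longrightarrow> smooth_near \<A> p (f a)) \<Longrightarrow> v (\<lambda>q. \<Sum>a\<in>F. f a q) = (\<Sum>a\<in>F. v (f a))"
  using assms(2)
proof (induction F rule: finite_induct)
  case empty
  then show ?case by (simp add: tangent_const[OF assms(1)])
next
  case (insert a F)
  have "v (\<lambda>q. f a q + (\<Sum>a\<in>F. f a q)) = v (f a) + v (\<lambda>q. \<Sum>a\<in>F. f a q)"
    using insert.prems by (intro tangent_add[OF assms(1)] smooth_near_sum) auto
  then show ?case using insert by simp
qed

text \<open>No bump function is needed for locality: the indicator of a neighbourhood is smooth near the point.\<close>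

lemma tangent_cong:
  assumes v: "v \<in> tangent_space \<A> p" and ev: "eventually (\<lambda>q. f q = h q) (nhds p)"
  shows "v f = v h"
proof (cases "smooth_near \<A> p f")
  case True
  then have h: "smooth_near \<A> p h" using smooth_near_cong[OF ev] by simp
  obtain S where S: "open S" "p \<in> S" "\<And>q. q \<in> S \<Longrightarrow> f q = h q"
    using ev by (auto simp: eventually_nhds)
  define u where "u q = (if q \<in> S then 1 else 0 :: real)" for q
  have "eventually (\<lambda>q. u q = 1) (nhds p)"
    using S by (auto simp: eventually_nhds u_def)
  then have u: "smooth_near \<A> p u" using smooth_near_cong[of u "\<lambda>q. 1" p] by simp
  have up: "u p = 1" using S by (simp add: u_def)
  \<comment> \<open>Idempotence of \<open>u\<close> and \<open>u p = 1\<close> turn the Leibniz rule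
    into \<open>v u = 2 * v u\<close>.\<close>
  have "(\<lambda>q. u q * u q) = u" by (auto simp: u_def)
  with tangent_mult[OF v u u] up have "v u = 0" by simp
  then have "v (\<lambda>q. u q * f q) = v f" "v (\<lambda>q. u q * h q) = v h"
    using tangent_mult[OF v u True] tangent_mult[OF v u h] up by auto
  moreover have "(\<lambda>q. u q * f q) = (\<lambda>q. u q * h q)" using S by (auto simp: u_def)
  ultimately show ?thesis by simp
next
  case False
  then show ?thesis using smooth_near_cong[OF ev] tangent_nonsmooth[OF v] by simp
qed

lemma subspace_tangent: "subspace (tangent_space \<A> p)"
  unfolding subspace_def
proof (intro conjI ballI allI)
  show "0 \<in> tangent_space \<A> p" by (rule tangentI) auto
  fix x y assume x: "x \<in> tangent_space \<A> p" and y: "y \<in> tangent_space \<A> p"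
  show "x + y \<in> tangent_space \<A> p"
    by (rule tangentI)
      (auto simp: tangent_add[OF x] tangent_add[OF y] tangent_mult[OF x] tangent_mult[OF y]
        tangent_const[OF x] tangent_const[OF y] tangent_nonsmooth[OF x] tangent_nonsmooth[OF y] algebra_simps)
next
  fix x c assume x: "x \<in> tangent_space \<A> p"
  show "c *\<^sub>R x \<in> tangent_space \<A> p"
    by (rule tangentI)
      (auto simp: tangent_add[OF x] tangent_mult[OF x] tangent_const[OF x] tangent_nonsmooth[OF x] algebra_simps)
qed

lemma smooth_field_subset:
  "smooth_field \<A> W A \<Longrightarrow> W' \<subseteq> W \<Longrightarrow> open W' \<Longrightarrow> smooth_field \<A> W' A"
  unfolding smooth_field_def by (meson subset_iff order_trans)

lemma smooth_field_add:
  assumes "smooth_field \<A> W A" "smooth_field \<A> W B"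
  shows "smooth_field \<A> W (\<lambda>q. A q + B q)"
  using assms smooth_fun_add subspace_add[OF subspace_tangent]
  unfolding smooth_field_def by simp

lemma smooth_field_scale:
  assumes "smooth_fun \<A> W f" "smooth_field \<A> W A"
  shows "smooth_field \<A> W (\<lambda>q. f q *\<^sub>R A q)"
  unfolding smooth_field_def
proof (intro conjI allI impI ballI)
  show "open W" using assms(1) by (rule smooth_fun_open)
  fix q assume "q \<in> W"
  then show "f q *\<^sub>R A q \<in> tangent_space \<A> q"
    using assms(2) subspace_scale[OF subspace_tangent] by (simp add: smooth_field_def)
next
  fix W' h assume h: "W' \<subseteq> W \<and> smooth_fun \<A> W' h"
  then have "smooth_fun \<A> W' f" using smooth_fun_subset[OF assms(1)] smooth_fun_open[of W' h] by simp
  then show "smooth_fun \<A> W' (\<lambda>q. (f q *\<^sub>R A q) h)"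
    using h assms(2) smooth_fun_mult unfolding smooth_field_def by simp
qed

text \<open>Working with germs spares the choice of a common domain each time fields are added,
  scaled, bracketed or projected.\<close>

definition field_near :: "'m \<Rightarrow> 'm vfield \<Rightarrow> bool" where
  "field_near p A \<longleftrightarrow> (\<exists>W. p \<in> W \<and> smooth_field \<A> W A)"

lemma field_nearE:
  assumes "field_near p A"
  obtains W where "p \<in> W" "open W" "smooth_field \<A> W A"
  using assms unfolding field_near_def smooth_field_def by blast

lemma field_near2E:
  assumes "field_near p A" "field_near p B"
  obtains W where "p \<in> W" "open W" "smooth_field \<A> W A" "smooth_field \<A> W B"
proof -
  obtain W where W: "p \<in> W" "open W" "smooth_field \<A> W A" using assms(1) by (rule field_nearE)
  obtain W' where W': "p \<in> W'" "open W'" "smooth_field \<A> W' B" using assms(2) by (rule field_nearE)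
  show ?thesis
    using that[of "W \<inter> W'"] W W' smooth_field_subset[OF W(3), of "W \<inter> W'"]
      smooth_field_subset[OF W'(3), of "W \<inter> W'"] by auto
qed

lemma field_near_tangent: "field_near p A \<Longrightarrow> A p \<in> tangent_space \<A> p"
  unfolding field_near_def smooth_field_def by blast

lemma field_near_eventually: "field_near p A \<Longrightarrow> eventually (\<lambda>q. field_near q A) (nhds p)"
  by (erule field_nearE) (auto simp: field_near_def eventually_nhds)

lemma field_near_add [intro]:
  "field_near p A \<Longrightarrow> field_near p B \<Longrightarrow> field_near p (\<lambda>q. A q + B q)"
  by (erule (1) field_near2E) (auto simp: field_near_def dest: smooth_field_add)

lemma field_near_scale [intro]:
  assumes "smooth_near \<A> p f" "field_near p A"
  shows "field_near p (\<lambda>q. f q *\<^sub>R A q)"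
proof -
  obtain W where W: "p \<in> W" "open W" "smooth_field \<A> W A" using assms(2) by (rule field_nearE)
  obtain W' where W': "p \<in> W'" "smooth_fun \<A> W' f" using assms(1) unfolding smooth_near_def by blast
  have o: "open (W \<inter> W')" using W(2) smooth_fun_open[OF W'(2)] by (rule open_Int)
  have "smooth_field \<A> (W \<inter> W') (\<lambda>q. f q *\<^sub>R A q)"
    using smooth_field_subset[OF W(3) _ o] smooth_fun_subset[OF W'(2) _ o] by (intro smooth_field_scale) auto
  then show ?thesis using W(1) W'(1) unfolding field_near_def by blast
qed

lemma field_near_minus [intro]: "field_near p A \<Longrightarrow> field_near p (\<lambda>q. - A q)"
  using field_near_scale[of p "\<lambda>q. - 1" A] by simp

lemma field_near_diff [intro]:
  "field_near p A \<Longrightarrow> field_near p B \<Longrightarrow> field_near p (\<lambda>q. A q - B q)"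
  using field_near_add[of p A "\<lambda>q. - B q"] field_near_minus[of p B] by simp

lemma field_near_zero [simp]: "field_near p (\<lambda>q. 0)"
proof -
  have "smooth_field \<A> UNIV (\<lambda>q. 0)"
    using subspace_0[OF subspace_tangent] smooth_fun_const smooth_fun_open by (auto simp: smooth_field_def)
  then show ?thesis unfolding field_near_def by auto
qed

lemma field_near_sum [intro]:
  "(\<And>a. a \<in> F \<Longrightarrow> field_near p (A a)) \<Longrightarrow> field_near p (\<lambda>q. \<Sum>a\<in>F. A a q)"
  by (induction F rule: infinite_finite_induct) auto

lemma smooth_near_apply [intro]:
  assumes "field_near p A" "smooth_near \<A> p f"
  shows "smooth_near \<A> p (\<lambda>q. A q f)"
proof -
  obtain W where W: "p \<in> W" "open W" "smooth_field \<A> W A" using assms(1) by (rule field_nearE)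
  obtain W' where W': "p \<in> W'" "smooth_fun \<A> W' f" using assms(2) unfolding smooth_near_def by blast
  have o: "open (W \<inter> W')" using W(2) smooth_fun_open[OF W'(2)] by (rule open_Int)
  have "smooth_fun \<A> (W \<inter> W') (\<lambda>q. A q f)"
    using W(3) smooth_fun_subset[OF W'(2) _ o] unfolding smooth_field_def by simp
  then show ?thesis using W(1) W'(1) unfolding smooth_near_def by blast
qed

lemma lie_bracket_apply:
  "smooth_near \<A> p f \<Longrightarrow> lie_bracket \<A> A B p f = A p (\<lambda>q. B q f) - B p (\<lambda>q. A q f)"
  by (simp add: lie_bracket_def)

lemma lie_bracket_nonsmooth: "\<not> smooth_near \<A> p f \<Longrightarrow> lie_bracket \<A> A B p f = 0"
  by (simp add: lie_bracket_def)

lemma eventually_field_apply: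
  assumes "field_near p A" "smooth_near \<A> p f" "smooth_near \<A> p h"
  shows "eventually (\<lambda>q. A q (\<lambda>r. f r + h r) = A q f + A q h) (nhds p)"
    and "eventually (\<lambda>q. A q (\<lambda>r. f r * h r) = f q * A q h + h q * A q f) (nhds p)"
    and "eventually (\<lambda>q. A q (\<lambda>r. c * f r) = c * A q f) (nhds p)"
proof -
  have ev: "eventually (\<lambda>q. A q \<in> tangent_space \<A> q \<and> smooth_near \<A> q f \<and> smooth_near \<A> q h) (nhds p)"
    using field_near_eventually[OF assms(1)] smooth_near_eventually[OF assms(2)]
      smooth_near_eventually[OF assms(3)]
    by eventually_elim (simp add: field_near_tangent)
  show "eventually (\<lambda>q. A q (\<lambda>r. f r + h r) = A q f + A q h) (nhds p)"
    using ev by eventually_elim (blast intro: tangent_add)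
  show "eventually (\<lambda>q. A q (\<lambda>r. f r * h r) = f q * A q h + h q * A q f) (nhds p)"
    using ev by eventually_elim (blast intro: tangent_mult)
  show "eventually (\<lambda>q. A q (\<lambda>r. c * f r) = c * A q f) (nhds p)"
    using ev by eventually_elim (blast intro: tangent_cmult)
qed

lemma tangent_lie_bracket:
  assumes A: "field_near p A" and B: "field_near p B"
  shows "lie_bracket \<A> A B p \<in> tangent_space \<A> p"
proof -
  note [intro] = field_near_tangent[OF A] field_near_tangent[OF B]
  note Ap = field_near_tangent[OF A] and Bp = field_near_tangent[OF B]
  show ?thesis
  proof (rule tangentI)
    fix f h assume f: "smooth_near \<A> p f" and h: "smooth_near \<A> p h"
    have s: "smooth_near \<A> p (\<lambda>q. A q f)" "smooth_near \<A> p (\<lambda>q. A q h)"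
      "smooth_near \<A> p (\<lambda>q. B q f)" "smooth_near \<A> p (\<lambda>q. B q h)"
      using A B f h by (auto intro: smooth_near_apply)
    show "lie_bracket \<A> A B p (\<lambda>q. f q + h q) = lie_bracket \<A> A B p f + lie_bracket \<A> A B p h"
      using tangent_cong[OF Ap eventually_field_apply(1)[OF B f h]]
        tangent_cong[OF Bp eventually_field_apply(1)[OF A f h]] tangent_add[OF Ap s(3,4)] tangent_add[OF Bp s(1,2)]
      by (simp add: lie_bracket_apply f h smooth_near_add)
    show "lie_bracket \<A> A B p (\<lambda>q. f q * h q) = f p * lie_bracket \<A> A B p h + h p * lie_bracket \<A> A B p f"
      using tangent_cong[OF Ap eventually_field_apply(2)[OF B f h]]
        tangent_cong[OF Bp eventually_field_apply(2)[OF A f h]] s f h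
      by (simp add: lie_bracket_apply smooth_near_mult tangent_add[OF Ap] tangent_add[OF Bp]
          tangent_mult[OF Ap] tangent_mult[OF Bp] algebra_simps)
  next
    fix f c assume f: "smooth_near \<A> p f"
    show "lie_bracket \<A> A B p (\<lambda>q. c * f q) = c * lie_bracket \<A> A B p f"
      using tangent_cong[OF Ap eventually_field_apply(3)[OF B f f, of c]]
        tangent_cong[OF Bp eventually_field_apply(3)[OF A f f, of c]]
        smooth_near_apply[OF A f] smooth_near_apply[OF B f] f
      by (simp add: lie_bracket_apply smooth_near_mult tangent_cmult[OF Ap] tangent_cmult[OF Bp] algebra_simps)
  qed (simp add: lie_bracket_nonsmooth)
qed

lemma field_near_lie_bracket [intro]:
  assumes "field_near p A" "field_near p B"
  shows "field_near p (lie_bracket \<A> A B)"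
proof -
  obtain W where W: "p \<in> W" "open W" "smooth_field \<A> W A" "smooth_field \<A> W B"
    using assms by (rule field_near2E)
  have "smooth_field \<A> W (lie_bracket \<A> A B)"
    unfolding smooth_field_def
  proof (intro conjI allI impI ballI)
    fix q assume "q \<in> W"
    then show "lie_bracket \<A> A B q \<in> tangent_space \<A> q"
      using W by (intro tangent_lie_bracket) (auto simp: field_near_def)
  next
    fix W' f assume f: "W' \<subseteq> W \<and> smooth_fun \<A> W' f"
    then have W': "open W'" using smooth_fun_open by blast
    have AB: "smooth_fun \<A> W' (\<lambda>q. A q h)" "smooth_fun \<A> W' (\<lambda>q. B q h)" if "smooth_fun \<A> W' h" for h
      using W f that unfolding smooth_field_def by auto
    have "smooth_fun \<A> W' (\<lambda>q. A q (\<lambda>q. B q f) + (- 1) * B q (\<lambda>q. A q f))"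
      using f by (intro smooth_fun_add smooth_fun_mult smooth_fun_const[OF W'] AB) simp_all
    then show "smooth_fun \<A> W' (\<lambda>q. lie_bracket \<A> A B q f)"
    proof (rule smooth_fun_cong[THEN iffD1, rotated])
      fix q assume "q \<in> W'"
      then have "smooth_near \<A> q f" using f by (auto simp: smooth_near_def)
      then show "A q (\<lambda>q. B q f) + (- 1) * B q (\<lambda>q. A q f) = lie_bracket \<A> A B q f"
        by (simp add: lie_bracket_apply)
    qed
  qed (rule W(2))
  then show ?thesis using W(1) unfolding field_near_def by blast
qed

lemma lie_bracket_antisym: "lie_bracket \<A> A B p = - lie_bracket \<A> B A p"
  by (rule ext) (simp add: lie_bracket_def)

lemma lie_bracket_self [simp]: "lie_bracket \<A> A A p = 0"
  by (rule ext) (simp add: lie_bracket_def)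

lemma lie_bracket_cong:
  assumes "field_near p A" "field_near p B"
    and "eventually (\<lambda>q. A q = A' q) (nhds p)" "eventually (\<lambda>q. B q = B' q) (nhds p)"
  shows "lie_bracket \<A> A B p = lie_bracket \<A> A' B' p"
proof
  fix f
  have e: "A p = A' p" "B p = B' p" using assms(3,4) by (auto dest: eventually_nhds_x_imp_x)
  have "A p (\<lambda>q. B q f) = A p (\<lambda>q. B' q f)"
    using assms(4) by (intro tangent_cong[OF field_near_tangent[OF assms(1)]]) (auto elim: eventually_mono)
  moreover have "B p (\<lambda>q. A q f) = B p (\<lambda>q. A' q f)"
    using assms(3) by (intro tangent_cong[OF field_near_tangent[OF assms(2)]]) (auto elim: eventually_mono)
  ultimately show "lie_bracket \<A> A B p f = lie_bracket \<A> A' B' p f"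
    using e by (simp add: lie_bracket_def)
qed

lemma lie_bracket_add_right:
  assumes "field_near p A" "field_near p B" "field_near p B'"
  shows "lie_bracket \<A> A (\<lambda>q. B q + B' q) p = lie_bracket \<A> A B p + lie_bracket \<A> A B' p"
proof
  fix f
  show "lie_bracket \<A> A (\<lambda>q. B q + B' q) p f = (lie_bracket \<A> A B p + lie_bracket \<A> A B' p) f"
    using assms
    by (cases "smooth_near \<A> p f")
      (auto simp: lie_bracket_apply lie_bracket_nonsmooth tangent_add[OF field_near_tangent[OF assms(1)]]
        smooth_near_apply)
qed

lemma lie_bracket_scale_right:
  assumes "field_near p A" "smooth_near \<A> p u" "field_near p B"
  shows "lie_bracket \<A> A (\<lambda>q. u q *\<^sub>R B q) p = u p *\<^sub>R lie_bracket \<A> A B p + (A p u) *\<^sub>R B p"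
proof
  fix f
  show "lie_bracket \<A> A (\<lambda>q. u q *\<^sub>R B q) p f = (u p *\<^sub>R lie_bracket \<A> A B p + (A p u) *\<^sub>R B p) f"
    using assms
    by (cases "smooth_near \<A> p f")
      (auto simp: lie_bracket_apply lie_bracket_nonsmooth tangent_mult[OF field_near_tangent[OF assms(1)]]
        tangent_nonsmooth[OF field_near_tangent[OF assms(3)]] smooth_near_apply algebra_simps)
qed

lemma lie_bracket_zero_right: "field_near p A \<Longrightarrow> lie_bracket \<A> A (\<lambda>q. 0) p = 0"
  using lie_bracket_scale_right[of p A "\<lambda>q. 0" "\<lambda>q. 0"] by (simp add: tangent_const[OF field_near_tangent])

lemma lie_bracket_sum_right:
  assumes "field_near p A" "\<And>a. a \<in> F \<Longrightarrow> field_near p (B a)"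
  shows "lie_bracket \<A> A (\<lambda>q. \<Sum>a\<in>F. B a q) p = (\<Sum>a\<in>F. lie_bracket \<A> A (B a) p)"
  using assms(2)
proof (induction F rule: infinite_finite_induct)
  case (insert a F)
  have "(\<lambda>q. \<Sum>a\<in>insert a F. B a q) = (\<lambda>q. B a q + (\<Sum>a\<in>F. B a q))"
    using insert.hyps by (intro ext sum.insert)
  moreover have "field_near p (B a)" "field_near p (\<lambda>q. \<Sum>a\<in>F. B a q)"
    using insert.prems by (auto intro: field_near_sum)
  note lie_bracket_add_right[OF assms(1) this]
  moreover have "lie_bracket \<A> A (\<lambda>q. \<Sum>a\<in>F. B a q) p = (\<Sum>a\<in>F. lie_bracket \<A> A (B a) p)"
    using insert.prems by (intro insert.IH) simp
  ultimately show ?case using insert.hyps by (simp only: sum.insert simp_thms)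
qed (simp_all add: lie_bracket_zero_right[OF assms(1)])

lemma jacobi:
  assumes A: "field_near p A" and B: "field_near p B" and C: "field_near p C"
  shows "lie_bracket \<A> A (lie_bracket \<A> B C) p =
    lie_bracket \<A> (lie_bracket \<A> A B) C p + lie_bracket \<A> B (lie_bracket \<A> A C) p"
proof
  fix f
  show "lie_bracket \<A> A (lie_bracket \<A> B C) p f =
    (lie_bracket \<A> (lie_bracket \<A> A B) C p + lie_bracket \<A> B (lie_bracket \<A> A C) p) f"
  proof (cases "smooth_near \<A> p f")
    case f: True
    \<comment> \<open>The pointwise formula for the bracket holds only where \<open>f\<close> is
      smooth, that is near \<open>p\<close>; locality of \<open>Z p\<close> allows it under the
      outer derivation. After this only third-order derivatives of \<open>f\<close> remain, and they
      cancel in pairs.\<close>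
    have *: "Z p (\<lambda>q. lie_bracket \<A> X Y q f) = Z p (\<lambda>q. X q (\<lambda>r. Y r f)) - Z p (\<lambda>q. Y q (\<lambda>r. X r f))"
      if X: "field_near p X" and Y: "field_near p Y" and Z: "field_near p Z" for X Y Z
    proof -
      have "Z p (\<lambda>q. lie_bracket \<A> X Y q f) = Z p (\<lambda>q. X q (\<lambda>r. Y r f) - Y q (\<lambda>r. X r f))"
        using smooth_near_eventually[OF f]
        by (intro tangent_cong[OF field_near_tangent[OF Z]]) (auto elim!: eventually_mono simp: lie_bracket_apply)
      then show ?thesis
        using X Y f by (simp add: tangent_diff[OF field_near_tangent[OF Z]] smooth_near_apply)
    qed
    show ?thesis
      using A B C f by (simp add: lie_bracket_apply * smooth_near_apply)
  qed (simp add: lie_bracket_nonsmooth)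
qed

text \<open>Fraction-free Gaussian elimination in the frame \<open>E\<close>, with respect to a fibrewise bilinear form \<open>b\<close>
  and fields \<open>Z\<close> dual to \<open>E\<close> at \<open>p\<close>; it avoids dividing smooth functions.\<close>

lemma tensorial_vanish_aux:
  fixes L :: "'m vfield \<Rightarrow> 'b::real_vector" and b :: "'m \<Rightarrow> 'm tvec \<Rightarrow> 'm tvec \<Rightarrow> real"
  assumes loc: "\<And>B B'. field_near p B \<Longrightarrow> eventually (\<lambda>q. B q = B' q) (nhds p) \<Longrightarrow> L B = L B'"
    and add: "\<And>B B'. field_near p B \<Longrightarrow> field_near p B' \<Longrightarrow> L (\<lambda>q. B q + B' q) = L B + L B'"
    and scale: "\<And>f B. smooth_near \<A> p f \<Longrightarrow> field_near p B \<Longrightarrow> L (\<lambda>q. f q *\<^sub>R B q) = f p *\<^sub>R L B"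
    and H: "\<And>q. subspace (H q)"
    and blin: "\<And>q z. z \<in> H q \<Longrightarrow> linear_on (H q) (\<lambda>x. b q x z)"
    and bsm: "\<And>A B. field_near p A \<Longrightarrow> field_near p B \<Longrightarrow> eventually (\<lambda>q. A q \<in> H q) (nhds p) \<Longrightarrow>
        eventually (\<lambda>q. B q \<in> H q) (nhds p) \<Longrightarrow> smooth_near \<A> p (\<lambda>q. b q (A q) (B q))"
  shows "\<lbrakk>\<And>a. a < (r::nat) \<Longrightarrow> field_near p (E a) \<and> eventually (\<lambda>q. E a q \<in> H q) (nhds p);
      \<And>a. a < r \<Longrightarrow> field_near p (Z a) \<and> eventually (\<lambda>q. Z a q \<in> H q) (nhds p);
      \<And>a c. a < r \<Longrightarrow> c < r \<Longrightarrow> b p (E a p) (Z c p) = (if a = c then 1 else 0);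
      field_near p W; eventually (\<lambda>q. W q \<in> span ((\<lambda>a. E a q) ` {..<r})) (nhds p); W p = 0\<rbrakk>
    \<Longrightarrow> L W = 0"
proof (induction r arbitrary: E W)
  case 0
  then have "eventually (\<lambda>q. W q = 0 *\<^sub>R W q) (nhds p)" by (auto elim: eventually_mono)
  then have "L W = L (\<lambda>q. 0 *\<^sub>R W q)" using 0 by (intro loc)
  then show ?case using scale[of "\<lambda>q. 0" W] 0 by simp
next
  case (Suc r)
  have E: "field_near p (E a)" "eventually (\<lambda>q. E a q \<in> H q) (nhds p)" if "a \<le> r" for a
    using Suc.prems(1)[of a] that by auto
  have Z: "field_near p (Z r)" "eventually (\<lambda>q. Z r q \<in> H q) (nhds p)"
    using Suc.prems(2)[of r] by auto
  define f where "f q = b q (E r q) (Z r q)" for q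
  \<comment> \<open>Subtracting a multiple of \<open>E r\<close> makes the pairing with
    \<open>Z r\<close> vanish near \<open>p\<close>, and the factor \<open>f\<close> replaces a
    division. At \<open>p\<close> nothing changes for \<open>a < r\<close>: there
    \<open>f p = 1\<close> and \<open>E a\<close> is already orthogonal to \<open>Z r\<close>, so
    the duality with the remaining \<open>Z c\<close> survives.\<close>
  define E' where "E' a q = f q *\<^sub>R E a q + (- b q (E a q) (Z r q)) *\<^sub>R E r q" for a q
  define W' where "W' q = f q *\<^sub>R W q + (- b q (W q) (Z r q)) *\<^sub>R E r q" for q
  have Eall: "eventually (\<lambda>q. \<forall>a\<in>{..r}. E a q \<in> H q) (nhds p)"
    using E(2) by (intro eventually_ball_finite) auto
  have Wspan: "eventually (\<lambda>q. W q \<in> span ((\<lambda>a. E a q) ` {..r})) (nhds p)"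
    using Suc.prems(5) by (simp add: lessThan_Suc_atMost)
  have WH: "eventually (\<lambda>q. W q \<in> H q) (nhds p)"
    using Eall Wspan
  proof eventually_elim
    case (elim q)
    have "span ((\<lambda>a. E a q) ` {..r}) \<subseteq> H q" using elim(1) H by (intro span_minimal) auto
    then show ?case using elim(2) by auto
  qed
  have f: "smooth_near \<A> p f" unfolding f_def using E Z by (intro bsm) auto
  have fp: "f p = 1" using Suc.prems(3)[of r r] by (simp add: f_def)
  have mE: "smooth_near \<A> p (\<lambda>q. - b q (E a q) (Z r q))" if "a \<le> r" for a
    using E[OF that] Z by (intro smooth_near_minus bsm) auto
  have mW: "smooth_near \<A> p (\<lambda>q. - b q (W q) (Z r q))"
    using Z WH Suc.prems(4) by (intro smooth_near_minus bsm) auto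
  have E'n: "field_near p (E' a)" if "a \<le> r" for a
    unfolding E'_def using E(1)[OF that] E(1)[of r] f mE[OF that] by (intro field_near_add field_near_scale) auto
  have W'n: "field_near p W'"
    unfolding W'_def using Suc.prems(4) E(1)[of r] f mW by (intro field_near_add field_near_scale) auto
  have Ep: "E a p \<in> H p" if "a \<le> r" for a using eventually_nhds_x_imp_x[OF E(2)[OF that]] .
  have Zp: "Z a p \<in> H p" if "a \<le> r" for a using Suc.prems(2)[of a] that eventually_nhds_x_imp_x by auto
  have "b p (W p) (Z r p) = 0"
    using blin[OF Zp[of r]] Suc.prems(6) subspace_0[OF H]
    unfolding linear_on_def by (metis eventually_True order_refl real_vector.scale_zero_left)
  have "L W' = 0"
  proof (rule Suc.IH[of E'])
    fix a assume a: "a < r"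
    have "eventually (\<lambda>q. E' a q \<in> H q) (nhds p)"
      using Eall
    proof eventually_elim
      case (elim q)
      then show ?case unfolding E'_def using a by (intro subspace_add[OF H] subspace_scale[OF H]) auto
    qed
    then show "field_near p (E' a) \<and> eventually (\<lambda>q. E' a q \<in> H q) (nhds p)" using E'n a by auto
    show "field_near p (Z a) \<and> eventually (\<lambda>q. Z a q \<in> H q) (nhds p)" using Suc.prems(2)[of a] a by auto
  next
    fix a c assume ac: "a < r" "c < r"
    have "E' a p = E a p" using Suc.prems(3)[of a r] ac by (simp add: E'_def fp)
    then show "b p (E' a p) (Z c p) = (if a = c then 1 else 0)" using Suc.prems(3)[of a c] ac by simp
  next
    show "field_near p W'" by (rule W'n)
    show "W' p = 0" using \<open>b p (W p) (Z r p) = 0\<close> Suc.prems(6)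
      by (simp only: W'_def minus_zero scaleR_zero_left scaleR_zero_right add_0_right)
    show "eventually (\<lambda>q. W' q \<in> span ((\<lambda>a. E' a q) ` {..<r})) (nhds p)"
      using Eall Wspan WH Z(2)
    proof eventually_elim
      case (elim q)
      have lin: "linear_on (H q) (\<lambda>x. b q x (Z r q))" using elim by (intro blin) auto
      \<comment> \<open>\<open>P\<close> is linear on \<open>H q\<close>, kills \<open>E r q\<close>
        and maps \<open>E a q\<close> to \<open>E' a q\<close>; hence it carries the span of the
        first frame into the span of the shortened one.\<close>
      define P where "P x = f q *\<^sub>R x + (- b q x (Z r q)) *\<^sub>R E r q" for x
      have sub: "subspace {x \<in> H q. P x \<in> span ((\<lambda>a. E' a q) ` {..<r})}" (is "subspace ?S")
        unfolding subspace_def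
      proof (intro conjI ballI allI)
        have "b q 0 (Z r q) = 0" using lin subspace_0[OF H] unfolding linear_on_def
          by (metis real_vector.scale_zero_left)
        then show "0 \<in> ?S" using subspace_0[OF H] by (simp add: P_def span_zero)
        fix x y assume xy: "x \<in> ?S" "y \<in> ?S"
        then have "P (x + y) = P x + P y"
          using lin unfolding linear_on_def P_def by (simp add: scaleR_add_right algebra_simps)
        then show "x + y \<in> ?S" using xy subspace_add[OF H] by (simp add: span_add)
      next
        fix x c assume x: "x \<in> ?S"
        then have "P (c *\<^sub>R x) = c *\<^sub>R P x"
          using lin unfolding linear_on_def P_def by (simp add: scaleR_add_right algebra_simps)
        then show "c *\<^sub>R x \<in> ?S" using x subspace_scale[OF H] by (simp add: span_scale)
      qed
      have "E a q \<in> ?S" if "a \<le> r" for a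
      proof (cases "a = r")
        case True
        then show ?thesis using elim(1) by (simp add: P_def f_def span_zero)
      next
        case False
        then have "P (E a q) \<in> (\<lambda>a. E' a q) ` {..<r}" using that by (auto simp: P_def E'_def)
        then show ?thesis using elim(1) that by (auto intro: span_base)
      qed
      then have "span ((\<lambda>a. E a q) ` {..r}) \<subseteq> ?S" using sub by (intro span_minimal) auto
      then show ?case using elim(2) by (auto simp: W'_def P_def)
    qed
  qed
  moreover have "L W' = f p *\<^sub>R L W + (- b p (W p) (Z r p)) *\<^sub>R L (E r)"
    unfolding W'_def using Suc.prems(4) E(1)[of r] f mW
    by (simp add: add scale field_near_scale del: scaleR_minus_left)
  ultimately show ?case using fp \<open>b p (W p) (Z r p) = 0\<close> by simp
qed

end

section \<open>Local frames and tensoriality\<close>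

lemma
  assumes "linear_on S f"
  shows linear_on_add: "x \<in> S \<Longrightarrow> y \<in> S \<Longrightarrow> f (x + y) = f x + f y"
    and linear_on_scale: "x \<in> S \<Longrightarrow> f (c *\<^sub>R x) = c *\<^sub>R f x"
    and linear_on_uminus: "x \<in> S \<Longrightarrow> f (- x) = - f x"
proof -
  show add: "f (x + y) = f x + f y" if "x \<in> S" "y \<in> S" for x y
    using assms that unfolding linear_on_def by blast
  show sc: "f (c *\<^sub>R x) = c *\<^sub>R f x" if "x \<in> S" for x c
    using assms that unfolding linear_on_def by blast
  show "f (- x) = - f x" if "x \<in> S" using sc[OF that, of "- 1"] by (metis scaleR_minus1_left)
qed

lemma
  assumes "linear_on S f" "subspace S"
  shows linear_on_zero: "f 0 = 0"
    and linear_on_diff: "x \<in> S \<Longrightarrow> y \<in> S \<Longrightarrow> f (x - y) = f x - f y"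
    and linear_on_sum: "(\<And>a. a \<in> F \<Longrightarrow> u a \<in> S) \<Longrightarrow> f (\<Sum>a\<in>F. u a) = (\<Sum>a\<in>F. f (u a))"
proof -
  show z: "f 0 = 0"
    using linear_on_scale[OF assms(1) subspace_0[OF assms(2)], of 0] by (metis scaleR_zero_left)
  show "f (x - y) = f x - f y" if "x \<in> S" "y \<in> S"
    using linear_on_add[OF assms(1) that(1) subspace_neg[OF assms(2) that(2)]]
      linear_on_uminus[OF assms(1) that(2)] by (metis diff_conv_add_uminus)
  show "(\<And>a. a \<in> F \<Longrightarrow> u a \<in> S) \<Longrightarrow> f (\<Sum>a\<in>F. u a) = (\<Sum>a\<in>F. f (u a))"
  proof (induction F rule: infinite_finite_induct)
    case (insert a F)
    have "f (u a + (\<Sum>a\<in>F. u a)) = f (u a) + f (\<Sum>a\<in>F. u a)"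
      using insert.prems by (intro linear_on_add[OF assms(1)] subspace_sum[OF assms(2)]) auto
    moreover have "f (\<Sum>a\<in>F. u a) = (\<Sum>a\<in>F. f (u a))" using insert.prems by (intro insert.IH) auto
    ultimately show ?case using insert.hyps by (metis sum.insert)
  qed (simp_all only: sum.infinite sum.empty z simp_thms)
qed

text \<open>The form is indefinite, so each coefficient carries the sign
  \<open>b (e a) (e a)\<close>. The fixed vectors of the expansion form a subspace that contains the
  basis.\<close>

lemma orthonormal_expansion:
  assumes e: "orthonormal_basis S b r e" and lin: "\<And>z. z \<in> S \<Longrightarrow> linear_on S (\<lambda>x. b x z)" and x: "x \<in> S"
  shows "x = (\<Sum>a<r. (b (e a) (e a) * b x (e a)) *\<^sub>R e a)"
proof -
  have eS: "e a \<in> S" if "a < r" for a using e that unfolding orthonormal_basis_def by blast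
  have sp: "span (e ` {..<r}) = S" using e unfolding orthonormal_basis_def by blast
  have subS: "subspace S" using sp subspace_span by metis
  define P where "P x = (\<Sum>a<r. (b (e a) (e a) * b x (e a)) *\<^sub>R e a)" for x
  have "subspace {x \<in> S. P x = x}"
    unfolding subspace_def
  proof (intro conjI ballI allI)
    have "P 0 = 0" unfolding P_def
      by (rule sum.neutral) (metis eS lin lessThan_iff linear_on_zero mult_zero_right scaleR_zero_left subS)
    then show "0 \<in> {x \<in> S. P x = x}" using subspace_0[OF subS] by blast
  next
    fix x y assume xy: "x \<in> {x \<in> S. P x = x}" "y \<in> {x \<in> S. P x = x}"
    have "P (x + y) = P x + P y"
      unfolding P_def sum.distrib[symmetric]
    proof (rule sum.cong)
      fix a assume "a \<in> {..<r}"
      then have "b (x + y) (e a) = b x (e a) + b y (e a)"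
        using xy by (intro linear_on_add[OF lin[OF eS]]) auto
      then show "(b (e a) (e a) * b (x + y) (e a)) *\<^sub>R e a
          = (b (e a) (e a) * b x (e a)) *\<^sub>R e a + (b (e a) (e a) * b y (e a)) *\<^sub>R e a"
        by (simp only: distrib_left scaleR_add_left)
    qed simp
    then show "x + y \<in> {x \<in> S. P x = x}" using xy subspace_add[OF subS] by simp
  next
    fix x c assume xy: "x \<in> {x \<in> S. P x = x}"
    have "P (c *\<^sub>R x) = c *\<^sub>R P x"
      unfolding P_def scaleR_sum_right
    proof (rule sum.cong)
      fix a assume "a \<in> {..<r}"
      then have "b (c *\<^sub>R x) (e a) = c * b x (e a)"
        using xy linear_on_scale[OF lin[OF eS], of a x c] by simp
      then show "(b (e a) (e a) * b (c *\<^sub>R x) (e a)) *\<^sub>R e a = c *\<^sub>R (b (e a) (e a) * b x (e a)) *\<^sub>R e a"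
        by (simp only: scaleR_scaleR mult.left_commute)
    qed simp
    then show "c *\<^sub>R x \<in> {x \<in> S. P x = x}" using xy subspace_scale[OF subS] by simp
  qed
  moreover have "e c \<in> {x \<in> S. P x = x}" if c: "c < r" for c
  proof -
    have bc: "b (e c) (e c) * b (e c) (e c) = 1"
      using e c unfolding orthonormal_basis_def by auto
    have "P (e c) = (\<Sum>a<r. if a = c then e c else 0)"
      unfolding P_def
    proof (rule sum.cong)
      fix a assume a: "a \<in> {..<r}"
      show "(b (e a) (e a) * b (e c) (e a)) *\<^sub>R e a = (if a = c then e c else 0)"
      proof (cases "a = c")
        case True
        then show ?thesis using bc by (simp only: scaleR_one if_True refl)
      next
        case False
        then have "b (e c) (e a) = 0" using e a c unfolding orthonormal_basis_def by auto
        then show ?thesis using False by (simp only: mult_zero_right scaleR_zero_left if_False)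
      qed
    qed simp
    also have "\<dots> = e c" using c by (simp add: sum.delta)
    finally show ?thesis using eS[OF c] by simp
  qed
  then have "e ` {..<r} \<subseteq> {x \<in> S. P x = x}" by blast
  ultimately have "span (e ` {..<r}) \<subseteq> {x \<in> S. P x = x}" by (intro span_minimal)
  then show ?thesis using x sp unfolding P_def by auto
qed

text \<open>A spanning family of \<open>r\<close> vectors in dimension \<open>r\<close> can have
  neither repetitions nor relations. This is what makes a basis out of the local sections of a
  distribution, which are only required to span.\<close>

lemma dim_spanning_family:
  fixes E :: "nat \<Rightarrow> 'a::real_vector"
  assumes "dim (span (E ` {..<r})) = r"
  shows "inj_on E {..<r}" "independent (E ` {..<r})"
proof -
  have le: "r \<le> card (E ` {..<r})"
    using dim_le_card[of "span (E ` {..<r})" "E ` {..<r}"] assms by simp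
  then have card: "card (E ` {..<r}) = r"
    using card_image_le[of "{..<r}" E] by simp
  then show "inj_on E {..<r}" by (intro eq_card_imp_inj_on) auto
  show "independent (E ` {..<r})"
  proof
    assume "dependent (E ` {..<r})"
    then obtain a where a: "a \<in> E ` {..<r}" "a \<in> span (E ` {..<r} - {a})" by (auto simp: dependent_def)
    then have "span (E ` {..<r} - {a}) = span (E ` {..<r})"
      using span_redundant[OF a(2)] by (simp add: insert_absorb)
    then have "r \<le> card (E ` {..<r} - {a})"
      using dim_le_card[of "span (E ` {..<r})" "E ` {..<r} - {a}"] assms by simp
    moreover have "card (E ` {..<r} - {a}) < r" using a(1) card by (metis card_Diff1_less finite_imageI finite_lessThan)
    ultimately show False by simp
  qed
qed

section \<open>Compatible local data of a pqc structure and horizontal germs\<close>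

locale pqc_data = smooth_atlas \<A>
  for \<A> :: "('m::{t2_space, second_countable_topology}, 'e::euclidean_space) chart set" +
  fixes n :: nat and H :: "'m dist" and g :: "'m hmetric"
    and PQ :: "'m \<Rightarrow> ('m tvec \<Rightarrow> 'm tvec) set" and nab :: "'m connection"
    and U :: "'m set" and \<eta> :: "3 \<Rightarrow> 'm \<Rightarrow> 'm tvec \<Rightarrow> real"
    and I :: "3 \<Rightarrow> 'm endo" and \<xi> :: "3 \<Rightarrow> 'm vfield"
  assumes dist: "distribution \<A> (4 * n) H"
    and metric: "neutral_metric \<A> n H g"
    and conn: "canonical_pqc_connection \<A> n H g PQ nab"
    and data: "compatible_data \<A> H g PQ U \<eta> I"
    and reeb: "reeb_fields \<A> H U \<eta> \<xi>"
begin

lemma open_U: "open U" using data by (simp add: compatible_data_def)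

lemma eventually_U: "p \<in> U \<Longrightarrow> eventually (\<lambda>q. q \<in> U) (nhds p)"
  using open_U by (auto simp: eventually_nhds)

lemma subspace_H: "subspace (H p)" using dist by (simp add: distribution_def)

lemma dim_H: "dim (H p) = 4 * n" using dist by (simp add: distribution_def)

lemma H_tangent: "x \<in> H p \<Longrightarrow> x \<in> tangent_space \<A> p" using dist by (auto simp: distribution_def)

lemma H_iff: "p \<in> U \<Longrightarrow> v \<in> H p \<longleftrightarrow> v \<in> tangent_space \<A> p \<and> (\<forall>s. \<eta> s p v = 0)"
  using data unfolding compatible_data_def by auto

lemma linear_eta: "p \<in> U \<Longrightarrow> linear_on (tangent_space \<A> p) (\<eta> s p)"
  using data unfolding compatible_data_def smooth_one_form_def by blast

lemma linear_g: "x \<in> H p \<Longrightarrow> linear_on (H p) (g p x)"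
  and g_sym: "x \<in> H p \<Longrightarrow> y \<in> H p \<Longrightarrow> g p x y = g p y x"
  using metric unfolding neutral_metric_def by blast+

lemma linear_g_left: "y \<in> H p \<Longrightarrow> linear_on (H p) (\<lambda>x. g p x y)"
  using linear_g[of y p] g_sym[of _ p y] subspace_add[OF subspace_H] subspace_scale[OF subspace_H]
  unfolding linear_on_def by simp

lemma linear_I: "p \<in> U \<Longrightarrow> linear_on (H p) (I s p)"
  and I_H: "p \<in> U \<Longrightarrow> x \<in> H p \<Longrightarrow> I s p x \<in> H p"
  using data unfolding compatible_data_def smooth_endo_def by blast+

lemma I_I: "p \<in> U \<Longrightarrow> x \<in> H p \<Longrightarrow> I s p (I s p x) = eps s *\<^sub>R x"
  and I_cyclic: "p \<in> U \<Longrightarrow> x \<in> H p \<Longrightarrow> (i, j, k) \<in> cyclic_perms \<Longrightarrow>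
      I i p (I j p x) = - (eps k *\<^sub>R I k p x) \<and> I j p (I i p x) = eps k *\<^sub>R I k p x"
  and g_I_I: "p \<in> U \<Longrightarrow> x \<in> H p \<Longrightarrow> y \<in> H p \<Longrightarrow> g p (I s p x) (I s p y) = - eps s * g p x y"
  and d_eta_H: "p \<in> U \<Longrightarrow> x \<in> H p \<Longrightarrow> y \<in> H p \<Longrightarrow> d_one \<A> (\<eta> s) p x y = - 2 * eps s * g p (I s p x) y"
  using data unfolding compatible_data_def by blast+

lemma eta_xi: "p \<in> U \<Longrightarrow> \<eta> s p (\<xi> t p) = (if s = t then 1 else 0)"
  and d_eta_xi_self: "p \<in> U \<Longrightarrow> x \<in> H p \<Longrightarrow> d_one \<A> (\<eta> s) p (\<xi> s p) x = 0"
  and d_eta_xi_cyclic: "p \<in> U \<Longrightarrow> x \<in> H p \<Longrightarrow> (i, j, k) \<in> cyclic_perms \<Longrightarrow>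
      d_one \<A> (\<eta> i) p (\<xi> j p) x = eps k * d_one \<A> (\<eta> j) p (\<xi> i p) x"
  using reeb unfolding reeb_fields_def by blast+

lemma field_near_xi [intro]: "p \<in> U \<Longrightarrow> field_near p (\<xi> s)"
  using reeb unfolding reeb_fields_def field_near_def by blast

lemma xi_tangent: "p \<in> U \<Longrightarrow> \<xi> s p \<in> tangent_space \<A> p"
  using field_near_tangent field_near_xi by blast

lemma smooth_near_eta [intro]:
  assumes "p \<in> U" "field_near p A"
  shows "smooth_near \<A> p (\<lambda>q. \<eta> s q (A q))"
proof -
  obtain W where W: "p \<in> W" "open W" "smooth_field \<A> W A" using assms(2) by (rule field_nearE)
  have "smooth_field \<A> (W \<inter> U) A" using smooth_field_subset[OF W(3), of "W \<inter> U"] W(2) open_U by auto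
  moreover have "smooth_one_form \<A> U (\<eta> s)"
    using data unfolding compatible_data_def by (elim conjE) (erule allE, erule conjE)
  ultimately have "smooth_fun \<A> (W \<inter> U) (\<lambda>q. \<eta> s q (A q))"
    unfolding smooth_one_form_def by simp
  then show ?thesis using W(1) assms(1) unfolding smooth_near_def by (intro exI[of _ "W \<inter> U"]) simp
qed

text \<open>Horizontality is required on a neighbourhood, since derivatives at \<open>p\<close> of
  quantities such as \<open>\<eta> s q (X q)\<close> are taken.\<close>

definition hor :: "'m \<Rightarrow> 'm vfield \<Rightarrow> bool" where
  "hor p X \<longleftrightarrow> field_near p X \<and> eventually (\<lambda>q. X q \<in> H q) (nhds p)"

lemma hor_field [dest]: "hor p X \<Longrightarrow> field_near p X" by (simp add: hor_def)

lemma hor_H: "hor p X \<Longrightarrow> X p \<in> H p" by (auto simp: hor_def dest: eventually_nhds_x_imp_x)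

lemma hor_eventually: "hor p X \<Longrightarrow> eventually (\<lambda>q. hor q X) (nhds p)"
  using field_near_eventually[of p X] eventually_eventually[of "\<lambda>q. X q \<in> H q" p]
  by (auto simp: hor_def eventually_conj_iff)

lemma hor_horizontal_field:
  assumes "p \<in> U" "hor p X" "hor p Y"
  obtains W where "p \<in> W" "W \<subseteq> U" "open W" "horizontal_field \<A> H W X" "horizontal_field \<A> H W Y"
proof -
  have "field_near p X" "field_near p Y" using assms(2,3) by (simp_all add: hor_def)
  then obtain W where W: "p \<in> W" "open W" "smooth_field \<A> W X" "smooth_field \<A> W Y" by (rule field_near2E)
  have "eventually (\<lambda>q. X q \<in> H q \<and> Y q \<in> H q) (nhds p)"
    using assms(2,3) unfolding hor_def by (simp add: eventually_conj)
  then obtain S where S: "open S" "p \<in> S" "\<And>q. q \<in> S \<Longrightarrow> X q \<in> H q \<and> Y q \<in> H q"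
    unfolding eventually_nhds by blast
  have o: "open (W \<inter> S \<inter> U)" using W(2) S(1) open_U by (intro open_Int)
  have sub: "W \<inter> S \<inter> U \<subseteq> W" by blast
  have "horizontal_field \<A> H (W \<inter> S \<inter> U) X" "horizontal_field \<A> H (W \<inter> S \<inter> U) Y"
    unfolding horizontal_field_def
    using smooth_field_subset[OF W(3) sub o] smooth_field_subset[OF W(4) sub o] S(3) by simp_all
  then show ?thesis using that[of "W \<inter> S \<inter> U"] o W(1) S(2) assms(1) by simp
qed

lemma smooth_near_g [intro]:
  assumes "p \<in> U" "hor p X" "hor p Y"
  shows "smooth_near \<A> p (\<lambda>q. g q (X q) (Y q))"
proof -
  obtain W where W: "p \<in> W" "W \<subseteq> U" "open W" "horizontal_field \<A> H W X" "horizontal_field \<A> H W Y"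
    using assms by (rule hor_horizontal_field)
  have "smooth_fun \<A> W (\<lambda>q. g q (X q) (Y q))"
    using metric W(4,5) unfolding neutral_metric_def by simp
  then show ?thesis using W(1) unfolding smooth_near_def by (intro exI conjI)
qed

lemma hor_I [intro]:
  assumes "p \<in> U" "hor p X"
  shows "hor p (\<lambda>q. I s q (X q))"
proof -
  obtain W where W: "p \<in> W" "W \<subseteq> U" "open W" "horizontal_field \<A> H W X" "horizontal_field \<A> H W X"
    using assms(1,2,2) by (rule hor_horizontal_field)
  have "smooth_endo \<A> H U (I s)" using data unfolding compatible_data_def by (elim conjE) (erule allE, erule conjE)
  then have "smooth_field \<A> W (\<lambda>q. I s q (X q))"
    using W(2,4) unfolding smooth_endo_def by simp
  then have "field_near p (\<lambda>q. I s q (X q))" using W(1) unfolding field_near_def by (intro exI conjI)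
  moreover have "eventually (\<lambda>q. X q \<in> H q) (nhds p)" using assms(2) by (simp add: hor_def)
  then have "eventually (\<lambda>q. I s q (X q) \<in> H q) (nhds p)"
    using eventually_U[OF assms(1)] by eventually_elim (rule I_H)
  ultimately show ?thesis by (simp add: hor_def)
qed

lemma hproj_eq: "hproj \<eta> \<xi> p v = v - (\<eta> 1 p v *\<^sub>R \<xi> 1 p + \<eta> 2 p v *\<^sub>R \<xi> 2 p + \<eta> 3 p v *\<^sub>R \<xi> 3 p)"
  by (simp only: hproj_def vproj_def sum_3)

lemma vproj_tangent: "p \<in> U \<Longrightarrow> vproj \<eta> \<xi> p v \<in> tangent_space \<A> p"
  unfolding vproj_def using xi_tangent by (intro subspace_sum[OF subspace_tangent] subspace_scale[OF subspace_tangent])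

lemma eta_vproj:
  assumes "p \<in> U"
  shows "\<eta> s p (vproj \<eta> \<xi> p v) = \<eta> s p v"
proof -
  have "\<eta> s p (vproj \<eta> \<xi> p v) = (\<Sum>t\<in>UNIV. \<eta> s p (\<eta> t p v *\<^sub>R \<xi> t p))"
    unfolding vproj_def using xi_tangent[OF assms]
    by (intro linear_on_sum[OF linear_eta[OF assms] subspace_tangent] subspace_scale[OF subspace_tangent])
  also have "\<dots> = (\<Sum>t\<in>UNIV. if t = s then \<eta> t p v else 0)"
    by (intro sum.cong) (auto simp: linear_on_scale[OF linear_eta[OF assms] xi_tangent[OF assms]] eta_xi[OF assms])
  also have "\<dots> = \<eta> s p v" by simp
  finally show ?thesis .
qed

lemma hproj_H:
  assumes "p \<in> U" "v \<in> tangent_space \<A> p"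
  shows "hproj \<eta> \<xi> p v \<in> H p"
proof -
  have "\<eta> s p (v - vproj \<eta> \<xi> p v) = 0" for s
    using linear_on_diff[OF linear_eta[OF assms(1)] subspace_tangent assms(2) vproj_tangent[OF assms(1)]]
    by (simp add: eta_vproj[OF assms(1)])
  then show ?thesis
    using subspace_diff[OF subspace_tangent assms(2) vproj_tangent[OF assms(1)]]
    unfolding hproj_def H_iff[OF assms(1)] by blast
qed

lemma vproj_zero: "(\<And>s. \<eta> s p v = 0) \<Longrightarrow> vproj \<eta> \<xi> p v = 0"
  unfolding vproj_def by (rule sum.neutral) (simp only: scaleR_zero_left ball_simps simp_thms)

lemma hproj_id: "p \<in> U \<Longrightarrow> x \<in> H p \<Longrightarrow> hproj \<eta> \<xi> p x = x"
  unfolding hproj_def using vproj_zero[of p x] H_iff[of p x] by (simp only: diff_zero)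

lemma vproj_xi: "p \<in> U \<Longrightarrow> vproj \<eta> \<xi> p (\<xi> s p) = \<xi> s p"
proof -
  assume p: "p \<in> U"
  have "vproj \<eta> \<xi> p (\<xi> s p) = (\<Sum>t\<in>UNIV. if t = s then \<xi> s p else 0)"
    unfolding vproj_def by (intro sum.cong refl) (simp only: eta_xi[OF p] scaleR_one scaleR_zero_left split: if_splits, simp)
  also have "\<dots> = \<xi> s p" by (simp only: sum.delta finite if_True UNIV_I)
  finally show ?thesis .
qed

lemma hproj_xi: "p \<in> U \<Longrightarrow> hproj \<eta> \<xi> p (\<xi> s p) = 0"
  unfolding hproj_def by (simp only: vproj_xi diff_self)

lemma linear_vproj:
  assumes p: "p \<in> U"
  shows "linear_on (tangent_space \<A> p) (vproj \<eta> \<xi> p)"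
  unfolding linear_on_def vproj_def
proof (intro conjI ballI allI)
  fix x y assume "x \<in> tangent_space \<A> p" "y \<in> tangent_space \<A> p"
  then show "(\<Sum>s\<in>UNIV. \<eta> s p (x + y) *\<^sub>R \<xi> s p)
      = (\<Sum>s\<in>UNIV. \<eta> s p x *\<^sub>R \<xi> s p) + (\<Sum>s\<in>UNIV. \<eta> s p y *\<^sub>R \<xi> s p)"
    by (simp only: linear_on_add[OF linear_eta[OF p]] scaleR_add_left sum.distrib)
next
  fix x c assume "x \<in> tangent_space \<A> p"
  then show "(\<Sum>s\<in>UNIV. \<eta> s p (c *\<^sub>R x) *\<^sub>R \<xi> s p) = c *\<^sub>R (\<Sum>s\<in>UNIV. \<eta> s p x *\<^sub>R \<xi> s p)"
    by (simp only: linear_on_scale[OF linear_eta[OF p]] scaleR_sum_right real_scaleR_def scaleR_scaleR)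
qed

lemma linear_hproj:
  assumes p: "p \<in> U"
  shows "linear_on (tangent_space \<A> p) (hproj \<eta> \<xi> p)"
  unfolding linear_on_def hproj_def
proof (intro conjI ballI allI)
  fix x y assume "x \<in> tangent_space \<A> p" "y \<in> tangent_space \<A> p"
  then show "x + y - vproj \<eta> \<xi> p (x + y) = x - vproj \<eta> \<xi> p x + (y - vproj \<eta> \<xi> p y)"
    by (simp only: linear_on_add[OF linear_vproj[OF p]] add_diff_add)
next
  fix x c assume "x \<in> tangent_space \<A> p"
  then show "c *\<^sub>R x - vproj \<eta> \<xi> p (c *\<^sub>R x) = c *\<^sub>R (x - vproj \<eta> \<xi> p x)"
    by (simp only: linear_on_scale[OF linear_vproj[OF p]] scaleR_diff_right)
qed

lemma field_near_vproj: "p \<in> U \<Longrightarrow> field_near p A \<Longrightarrow> field_near p (\<lambda>q. vproj \<eta> \<xi> q (A q))"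
  unfolding vproj_def by (intro field_near_sum field_near_scale smooth_near_eta field_near_xi)

lemma hor_hproj: 
  assumes "p \<in> U" "field_near p A"
  shows "hor p (\<lambda>q. hproj \<eta> \<xi> q (A q))"
proof -
  have "field_near p (\<lambda>q. hproj \<eta> \<xi> q (A q))"
    unfolding hproj_def using assms by (intro field_near_diff field_near_vproj)
  moreover have "eventually (\<lambda>q. hproj \<eta> \<xi> q (A q) \<in> H q) (nhds p)"
    using eventually_U[OF assms(1)] field_near_eventually[OF assms(2)]
    by eventually_elim (rule hproj_H, auto intro: field_near_tangent)
  ultimately show ?thesis by (simp only: hor_def)
qed

lemma hproj_vproj: "hproj \<eta> \<xi> q v + vproj \<eta> \<xi> q v = v"
  by (simp only: hproj_def diff_add_cancel)

section \<open>Horizontal frames, extensions and the tensoriality criterion\<close>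

lemma local_frame:
  obtains E where "\<And>a. a < 4 * n \<Longrightarrow> hor p (E a)"
    "eventually (\<lambda>q. H q = span ((\<lambda>a. E a q) ` {..<4 * n})) (nhds p)"
proof -
  have ex: "\<exists>V E. p \<in> V \<and> (\<forall>a<4 * n. smooth_field \<A> V (E a)) \<and> (\<forall>q\<in>V. H q = span ((\<lambda>a. E a q) ` {..<4 * n}))" for p
    using dist unfolding distribution_def by simp
  from ex[of p] obtain V E where V: "p \<in> V" "\<forall>a<4 * n. smooth_field \<A> V (E a)"
      "\<forall>q\<in>V. H q = span ((\<lambda>a. E a q) ` {..<4 * n})"
    by (elim exE conjE) (rule that)
  show ?thesis
  \<comment> \<open>Openness of \<open>V\<close> is only available through the smooth fields
    \<open>E a\<close>. For \<open>n = 0\<close> there are none, but then every \<open>H q\<close>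
    is the zero space.\<close>
  proof (cases "n = 0")
    case True
    have "H q = span {}" for q
      using ex[of q] True by auto
    then show ?thesis using that[of "\<lambda>_ _. 0"] True by simp
  next
    case False
    then have o: "open V" using V(2)[rule_format, of 0] by (simp add: smooth_field_def)
    have "eventually (\<lambda>q. q \<in> V) (nhds p)" using o V(1) by (auto simp: eventually_nhds)
    then have ev: "eventually (\<lambda>q. H q = span ((\<lambda>a. E a q) ` {..<4 * n})) (nhds p)"
      by eventually_elim (rule V(3)[rule_format])
    have "hor p (E a)" if "a < 4 * n" for a
      unfolding hor_def
    proof
      show "field_near p (E a)" using V(1,2) that unfolding field_near_def by blast
      show "eventually (\<lambda>q. E a q \<in> H q) (nhds p)"
        using ev by eventually_elim (use that in \<open>auto intro: span_base\<close>)
    qed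
    then show ?thesis using that ev by blast
  qed
qed

lemma hor_scale_const: "hor p X \<Longrightarrow> hor p (\<lambda>q. c *\<^sub>R X q)"
  unfolding hor_def using subspace_scale[OF subspace_H]
  by (auto intro: field_near_scale elim: eventually_mono)

lemma hor_add: "hor p X \<Longrightarrow> hor p Y \<Longrightarrow> hor p (\<lambda>q. X q + Y q)"
  unfolding hor_def using subspace_add[OF subspace_H]
  by (auto intro: field_near_add elim: eventually_elim2)

lemma hor_sum: "(\<And>a. a \<in> F \<Longrightarrow> hor p (A a)) \<Longrightarrow> hor p (\<lambda>q. \<Sum>a\<in>F. A a q)"
proof (induction F rule: infinite_finite_induct)
  case (insert a F)
  have "(\<lambda>q. \<Sum>a\<in>insert a F. A a q) = (\<lambda>q. A a q + (\<Sum>a\<in>F. A a q))"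
    using insert.hyps by (intro ext sum.insert)
  then show ?case using insert hor_add[of p "A a" "\<lambda>q. \<Sum>a\<in>F. A a q"] by (metis insertI1 insertI2)
qed (simp_all add: hor_def subspace_0[OF subspace_H])

text \<open>Constant coefficients in a local frame do it. The spanning theorem indexes coefficients
  by vectors, so injectivity of the frame at \<open>p\<close> is used to index them by
  \<open>a\<close>.\<close>

lemma horizontal_extension:
  assumes "x \<in> H p"
  obtains X where "hor p X" "X p = x"
proof -
  obtain E where E: "\<And>a. a < 4 * n \<Longrightarrow> hor p (E a)"
    "eventually (\<lambda>q. H q = span ((\<lambda>a. E a q) ` {..<4 * n})) (nhds p)"
    using local_frame by blast
  have sp: "H p = span ((\<lambda>a. E a p) ` {..<4 * n})" using E(2) by (rule eventually_nhds_x_imp_x)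
  then have inj: "inj_on (\<lambda>a. E a p) {..<4 * n}"
    using dim_spanning_family(1)[of "\<lambda>a. E a p" "4 * n"] dim_H[of p] by (simp only: sp[symmetric])
  have "x \<in> span ((\<lambda>a. E a p) ` {..<4 * n})" using assms sp by simp
  then obtain u where "x = (\<Sum>v\<in>(\<lambda>a. E a p) ` {..<4 * n}. u v *\<^sub>R v)"
    using span_finite[of "(\<lambda>a. E a p) ` {..<4 * n}"] by auto
  then have x: "x = (\<Sum>a<4 * n. u (E a p) *\<^sub>R E a p)"
    using sum.reindex[OF inj, of "\<lambda>v. u v *\<^sub>R v"] by (simp only: comp_def)
  have "hor p (\<lambda>q. \<Sum>a<4 * n. u (E a p) *\<^sub>R E a q)"
    using E(1) by (intro hor_sum hor_scale_const) auto
  then show ?thesis using that x by blast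
qed

text \<open>\<open>extend\<close> is a choice and carries no information until a suitable field
  exists. One is obtained by extending the horizontal part in a frame and adding Reeb fields with
  constant coefficients.\<close>

lemma extend_near:
  assumes "p \<in> U" "v \<in> tangent_space \<A> p"
  shows "field_near p (extend \<A> p v)" and "extend \<A> p v p = v"
proof -
  obtain X where X: "hor p X" "X p = hproj \<eta> \<xi> p v"
    using horizontal_extension[OF hproj_H[OF assms]] by blast
  let ?A = "\<lambda>q. X q + (\<Sum>s\<in>UNIV. \<eta> s p v *\<^sub>R \<xi> s q)"
  have "field_near p ?A"
    using X(1) assms(1) by (intro field_near_add field_near_sum field_near_scale) auto
  moreover have "?A p = v" using hproj_vproj[of p v] by (simp only: X(2) vproj_def)
  ultimately have "?A p = v \<and> (\<exists>W. p \<in> W \<and> smooth_field \<A> W ?A)" unfolding field_near_def by blast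
  then have "extend \<A> p v p = v \<and> (\<exists>W. p \<in> W \<and> smooth_field \<A> W (extend \<A> p v))"
    unfolding extend_def by (rule someI[of "\<lambda>A. A p = v \<and> (\<exists>W. p \<in> W \<and> smooth_field \<A> W A)"])
  then show "field_near p (extend \<A> p v)" "extend \<A> p v p = v" by (auto simp: field_near_def)
qed

text \<open>\<open>d c\<close> represents the \<open>c\<close>-th coordinate functional of the frame
  with respect to \<open>g\<close>; an orthonormal basis makes the representing vector explicit and
  thereby expresses nondegeneracy.\<close>

lemma dual_frame:
  assumes "\<And>a. a < 4 * n \<Longrightarrow> E a \<in> H p" "H p = span (E ` {..<4 * n})"
  obtains d where "\<And>c. c < 4 * n \<Longrightarrow> d c \<in> H p"
    "\<And>a c. a < 4 * n \<Longrightarrow> c < 4 * n \<Longrightarrow> g p (E a) (d c) = (if a = c then 1 else 0)"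
proof -
  obtain e where e: "orthonormal_basis (H p) (g p) (4 * n) e"
    using metric unfolding neutral_metric_def by blast
  have eH: "e b \<in> H p" if "b < 4 * n" for b using e that unfolding orthonormal_basis_def by blast
  have "dim (span (E ` {..<4 * n})) = 4 * n" using dim_H[of p] by (simp only: assms(2)[symmetric])
  note ind = dim_spanning_family[OF this]
  have "\<exists>\<phi>. linear \<phi> \<and> (\<forall>a<4 * n. \<phi> (E a) = (if a = c then 1 else 0 :: real))" if "c < 4 * n" for c
  proof -
    obtain \<phi> where "linear \<phi>" "\<forall>x\<in>E ` {..<4 * n}. \<phi> x = (if x = E c then 1 else 0 :: real)"
      using linear_independent_extend[OF ind(2), of "\<lambda>x. if x = E c then 1 else 0 :: real"] by blast
    then show ?thesis using ind(1) that by (intro exI[of _ \<phi>]) (auto simp: inj_on_def)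
  qed
  then obtain \<phi> where \<phi>: "\<And>c. c < 4 * n \<Longrightarrow> linear (\<phi> c)"
    "\<And>a c. a < 4 * n \<Longrightarrow> c < 4 * n \<Longrightarrow> \<phi> c (E a) = (if a = c then 1 else 0 :: real)" by metis
  define d where "d c = (\<Sum>b<4 * n. (g p (e b) (e b) * \<phi> c (e b)) *\<^sub>R e b)" for c
  have dH: "d c \<in> H p" for c
    unfolding d_def using eH by (intro subspace_sum[OF subspace_H] subspace_scale[OF subspace_H]) auto
  have "g p x (d c) = \<phi> c x" if x: "x \<in> H p" and c: "c < 4 * n" for x c
  proof -
    have "\<phi> c x = \<phi> c (\<Sum>b<4 * n. (g p (e b) (e b) * g p x (e b)) *\<^sub>R e b)"
      using orthonormal_expansion[OF e linear_g_left x] by simp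
    also have "\<dots> = (\<Sum>b<4 * n. \<phi> c ((g p (e b) (e b) * g p x (e b)) *\<^sub>R e b))"
      using linear_sum[OF \<phi>(1)[OF c]] by blast
    also have "\<dots> = (\<Sum>b<4 * n. (g p (e b) (e b) * g p x (e b)) * \<phi> c (e b))"
      by (simp only: linear_scale[OF \<phi>(1)[OF c]] real_scaleR_def)
    finally have 1: "\<phi> c x = (\<Sum>b<4 * n. (g p (e b) (e b) * g p x (e b)) * \<phi> c (e b))" .
    have "g p x (d c) = (\<Sum>b<4 * n. g p x ((g p (e b) (e b) * \<phi> c (e b)) *\<^sub>R e b))"
      unfolding d_def using eH
      by (intro linear_on_sum[OF linear_g[OF x] subspace_H] subspace_scale[OF subspace_H]) auto
    also have "\<dots> = (\<Sum>b<4 * n. (g p (e b) (e b) * g p x (e b)) * \<phi> c (e b))"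
      using eH by (intro sum.cong) (auto simp: linear_on_scale[OF linear_g[OF x]])
    finally show ?thesis using 1 by simp
  qed
  then show ?thesis using that[of d] dH \<phi>(2) assms(1) by simp
qed

text \<open>Split \<open>W\<close> into its horizontal part and its Reeb components. The latter have
  coefficients \<open>\<eta> s q (W q)\<close> that vanish at \<open>p\<close>, so linearity over
  functions kills them; the former is the case treated by elimination in a horizontal frame.\<close>

lemma tensorial_vanish:
  fixes L :: "'m vfield \<Rightarrow> 'b::real_vector"
  assumes p: "p \<in> U"
    and loc: "\<And>B B'. field_near p B \<Longrightarrow> eventually (\<lambda>q. B q = B' q) (nhds p) \<Longrightarrow> L B = L B'"
    and add: "\<And>B B'. field_near p B \<Longrightarrow> field_near p B' \<Longrightarrow> L (\<lambda>q. B q + B' q) = L B + L B'"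
    and scale: "\<And>f B. smooth_near \<A> p f \<Longrightarrow> field_near p B \<Longrightarrow> L (\<lambda>q. f q *\<^sub>R B q) = f p *\<^sub>R L B"
    and W: "field_near p W" "W p = 0"
  shows "L W = 0"
proof -
  let ?h = "\<lambda>q. hproj \<eta> \<xi> q (W q)"
  have eta0: "\<eta> s p (W p) = 0" for s
    using linear_on_zero[OF linear_eta[OF p] subspace_tangent] W(2) by simp
  have hW: "hor p ?h" using p W(1) by (rule hor_hproj)
  obtain E where E: "\<And>a. a < 4 * n \<Longrightarrow> hor p (E a)"
    "eventually (\<lambda>q. H q = span ((\<lambda>a. E a q) ` {..<4 * n})) (nhds p)"
    using local_frame by blast
  have EH: "E a p \<in> H p" if "a < 4 * n" for a using hor_H E(1) that by blast
  obtain d where d: "\<And>c. c < 4 * n \<Longrightarrow> d c \<in> H p"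
    "\<And>a c. a < 4 * n \<Longrightarrow> c < 4 * n \<Longrightarrow> g p (E a p) (d c) = (if a = c then 1 else 0)"
    using dual_frame[OF EH eventually_nhds_x_imp_x[OF E(2)]] by blast
  have "\<exists>Z. hor p Z \<and> Z p = d c" if "c < 4 * n" for c
    using horizontal_extension[OF d(1)[OF that]] by blast
  then obtain Z where Z: "\<And>c. c < 4 * n \<Longrightarrow> hor p (Z c)" "\<And>c. c < 4 * n \<Longrightarrow> Z c p = d c" by metis
  have "L ?h = 0"
  proof (rule tensorial_vanish_aux[of p L H g "4 * n" E Z])
    show "hproj \<eta> \<xi> p (W p) = 0"
      unfolding hproj_def using vproj_zero[OF eta0] W(2) by (simp only: diff_zero)
    show "eventually (\<lambda>q. ?h q \<in> span ((\<lambda>a. E a q) ` {..<4 * n})) (nhds p)"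
      using E(2) hW[unfolded hor_def, THEN conjunct2] by eventually_elim blast
    show "smooth_near \<A> p (\<lambda>q. g q (A q) (B q))"
      if "field_near p A" "field_near p B" "eventually (\<lambda>q. A q \<in> H q) (nhds p)"
        "eventually (\<lambda>q. B q \<in> H q) (nhds p)" for A B
      using that p by (intro smooth_near_g) (auto simp: hor_def)
  qed (use loc add scale subspace_H linear_g_left E(1) Z d(2) hW in \<open>auto simp: hor_def\<close>)
  have xs: "field_near p (\<lambda>q. \<eta> s q (W q) *\<^sub>R \<xi> s q)" for s
    using p W(1) by (intro field_near_scale smooth_near_eta field_near_xi)
  have Lx: "L (\<lambda>q. \<eta> s q (W q) *\<^sub>R \<xi> s q) = 0" for s
    using scale[OF smooth_near_eta[OF p W(1)] field_near_xi[OF p]] eta0 by simp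
  have "W = (\<lambda>q. ?h q + ((\<eta> 1 q (W q) *\<^sub>R \<xi> 1 q + \<eta> 2 q (W q) *\<^sub>R \<xi> 2 q) + \<eta> 3 q (W q) *\<^sub>R \<xi> 3 q))"
    unfolding hproj_eq by (simp only: diff_add_cancel)
  then have "L W = L (\<lambda>q. ?h q + ((\<eta> 1 q (W q) *\<^sub>R \<xi> 1 q + \<eta> 2 q (W q) *\<^sub>R \<xi> 2 q) + \<eta> 3 q (W q) *\<^sub>R \<xi> 3 q))"
    by (rule arg_cong)
  also have "\<dots> = L ?h + ((L (\<lambda>q. \<eta> 1 q (W q) *\<^sub>R \<xi> 1 q) + L (\<lambda>q. \<eta> 2 q (W q) *\<^sub>R \<xi> 2 q))
      + L (\<lambda>q. \<eta> 3 q (W q) *\<^sub>R \<xi> 3 q))"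
    unfolding add[OF hor_field[OF hW] field_near_add[OF field_near_add[OF xs xs] xs]]
      add[OF field_near_add[OF xs xs] xs] add[OF xs xs] ..
  finally show ?thesis using \<open>L ?h = 0\<close> Lx by simp
qed

text \<open>\<open>linear_connection\<close> states its axioms for two fields on one open set; here
  they are transferred to germs at \<open>p\<close>. Where only one field matters, the zero field
  later fills the other place.\<close>

lemma nab_both:
  assumes "field_near p A" "field_near p B" "v \<in> tangent_space \<A> p"
  shows "nab p v B \<in> tangent_space \<A> p"
    and "nab p v (\<lambda>q. A q + B q) = nab p v A + nab p v B"
    and "smooth_near \<A> p f \<Longrightarrow> nab p v (\<lambda>q. f q *\<^sub>R B q) = v f *\<^sub>R B p + f p *\<^sub>R nab p v B"
    and "eventually (\<lambda>q. A q = B q) (nhds p) \<Longrightarrow> nab p v A = nab p v B"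
proof -
  have lc: "linear_connection \<A> nab" using conn by (simp add: canonical_pqc_connection_def)
  obtain W where W: "p \<in> W" "open W" "smooth_field \<A> W A" "smooth_field \<A> W B"
    using assms(1,2) by (rule field_near2E)
  have P: "nab p v B \<in> tangent_space \<A> p"
      "nab p v (\<lambda>q. A q + B q) = nab p v A + nab p v B"
      "smooth_fun \<A> W' f \<Longrightarrow> nab p v (\<lambda>q. f q *\<^sub>R B q) = v f *\<^sub>R B p + f p *\<^sub>R nab p v B"
      "(\<forall>q\<in>W'. A q = B q) \<Longrightarrow> nab p v A = nab p v B"
    if "W' \<subseteq> W" "p \<in> W'" "open W'" for W' f
    using lc smooth_field_subset[OF W(3) that(1,3)] smooth_field_subset[OF W(4) that(1,3)] that(2) assms(3)
    unfolding linear_connection_def by blast+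
  show "nab p v B \<in> tangent_space \<A> p" "nab p v (\<lambda>q. A q + B q) = nab p v A + nab p v B"
    using P W(1,2) by blast+
  show "nab p v (\<lambda>q. f q *\<^sub>R B q) = v f *\<^sub>R B p + f p *\<^sub>R nab p v B" if f: "smooth_near \<A> p f"
  proof -
    obtain W' where W': "p \<in> W'" "smooth_fun \<A> W' f" using f unfolding smooth_near_def by (elim exE conjE)
    have o: "open (W \<inter> W')" using W(2) smooth_fun_open[OF W'(2)] by (rule open_Int)
    show ?thesis using P(3)[OF _ _ o] smooth_fun_subset[OF W'(2) _ o] W(1) W'(1) by simp
  qed
  show "nab p v A = nab p v B" if ev: "eventually (\<lambda>q. A q = B q) (nhds p)"
  proof -
    obtain S where S: "open S" "p \<in> S" "\<And>q. q \<in> S \<Longrightarrow> A q = B q" using ev by (auto simp: eventually_nhds)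
    show ?thesis using P(4)[of "W \<inter> S"] W(1,2) S by auto
  qed
qed

lemmas nab_tangent = nab_both(1)[OF field_near_zero]
  and nab_add = nab_both(2)
  and nab_scale = nab_both(3)[OF field_near_zero]

lemma field_near_cong:
  assumes "field_near p A" "eventually (\<lambda>q. A q = B q) (nhds p)"
  shows "field_near p B"
proof -
  obtain W where W: "p \<in> W" "open W" "smooth_field \<A> W A" using assms(1) by (rule field_nearE)
  obtain S where S: "open S" "p \<in> S" "\<And>q. q \<in> S \<Longrightarrow> A q = B q" using assms(2) by (auto simp: eventually_nhds)
  have o: "open (W \<inter> S)" using W(2) S(1) by auto
  have "smooth_field \<A> (W \<inter> S) A" using smooth_field_subset[OF W(3) _ o] by simp
  moreover have "smooth_fun \<A> W' (\<lambda>q. A q f) \<longleftrightarrow> smooth_fun \<A> W' (\<lambda>q. B q f)" if "W' \<subseteq> W \<inter> S" for W' f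
    using S(3) that by (intro smooth_fun_cong) (metis IntD2 subsetD)
  ultimately have "smooth_field \<A> (W \<inter> S) B" using S(3) unfolding smooth_field_def by auto
  then show ?thesis using W(1) S(2) unfolding field_near_def by blast
qed

lemma nab_cong:
  assumes "field_near p A" "v \<in> tangent_space \<A> p" "eventually (\<lambda>q. A q = B q) (nhds p)"
  shows "nab p v A = nab p v B"
  using nab_both(4)[OF assms(1) field_near_cong[OF assms(1,3)] assms(2,3)] .

text \<open>In the variable \<open>W\<close>, the bracket with \<open>A\<close> and the covariant
  derivative along \<open>A\<close> obey the same Leibniz rule. Their difference is therefore linear
  over functions and vanishes when \<open>W p = 0\<close>.\<close>

lemma lie_bracket_eq_nab:
  assumes "p \<in> U" "field_near p A" "field_near p W" "W p = 0"
  shows "lie_bracket \<A> A W p = nab p (A p) W"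
proof -
  have Ap: "A p \<in> tangent_space \<A> p" using assms(2) by (rule field_near_tangent)
  have "nab p (A p) W - lie_bracket \<A> A W p = 0"
  proof (rule tensorial_vanish[OF assms(1), of "\<lambda>W. nab p (A p) W - lie_bracket \<A> A W p"])
    fix B B' assume B: "field_near p B" "eventually (\<lambda>q. B q = B' q) (nhds p)"
    show "nab p (A p) B - lie_bracket \<A> A B p = nab p (A p) B' - lie_bracket \<A> A B' p"
      using nab_cong[OF B(1) Ap B(2)] lie_bracket_cong[OF assms(2) B(1) _ B(2), of A] by simp
  next
    fix B B' assume B: "field_near p B" "field_near p B'"
    show "nab p (A p) (\<lambda>q. B q + B' q) - lie_bracket \<A> A (\<lambda>q. B q + B' q) p
        = nab p (A p) B - lie_bracket \<A> A B p + (nab p (A p) B' - lie_bracket \<A> A B' p)"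
      unfolding nab_add[OF B Ap] lie_bracket_add_right[OF assms(2) B] by (rule add_diff_add)
  next
    fix f B assume f: "smooth_near \<A> p f" and B: "field_near p B"
    show "nab p (A p) (\<lambda>q. f q *\<^sub>R B q) - lie_bracket \<A> A (\<lambda>q. f q *\<^sub>R B q) p
        = f p *\<^sub>R (nab p (A p) B - lie_bracket \<A> A B p)"
      unfolding nab_scale[OF B Ap f] lie_bracket_scale_right[OF assms(2) f B] scaleR_diff_right
        add.commute[of "f p *\<^sub>R lie_bracket \<A> A B p"] by (rule add_diff_cancel_left)
  qed (rule assms(3,4))+
  then show ?thesis by (metis eq_iff_diff_eq_0)
qed

text \<open>Both sides obey the same Leibniz rule in \<open>W\<close>, so their difference is linear
  over functions. It is the part of \<open>d\<eta>_s(A, W)\<close> that does not visibly depend on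
  \<open>W p\<close> alone.\<close>

lemma eta_lie_bracket_zero:
  assumes "p \<in> U" "field_near p A" "field_near p W" "W p = 0"
  shows "\<eta> s p (lie_bracket \<A> A W p) = A p (\<lambda>q. \<eta> s q (W q))"
proof -
  have Ap: "A p \<in> tangent_space \<A> p" using assms(2) by (rule field_near_tangent)
  note lin = linear_eta[OF assms(1)]
  have "A p (\<lambda>q. \<eta> s q (W q)) - \<eta> s p (lie_bracket \<A> A W p) = 0"
  proof (rule tensorial_vanish[OF assms(1), of "\<lambda>W. A p (\<lambda>q. \<eta> s q (W q)) - \<eta> s p (lie_bracket \<A> A W p)"])
    fix B B' assume B: "field_near p B" "eventually (\<lambda>q. B q = B' q) (nhds p)"
    have "lie_bracket \<A> A B p = lie_bracket \<A> A B' p"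
      using lie_bracket_cong[OF assms(2) B(1) _ B(2), of A] by simp
    moreover have "A p (\<lambda>q. \<eta> s q (B q)) = A p (\<lambda>q. \<eta> s q (B' q))"
      using B(2) by (intro tangent_cong[OF Ap]) (auto elim: eventually_mono)
    ultimately show "A p (\<lambda>q. \<eta> s q (B q)) - \<eta> s p (lie_bracket \<A> A B p)
        = A p (\<lambda>q. \<eta> s q (B' q)) - \<eta> s p (lie_bracket \<A> A B' p)" by simp
  next
    fix B B' assume B: "field_near p B" "field_near p B'"
    have "eventually (\<lambda>q. \<eta> s q (B q + B' q) = \<eta> s q (B q) + \<eta> s q (B' q)) (nhds p)"
      using eventually_U[OF assms(1)] field_near_eventually[OF B(1)] field_near_eventually[OF B(2)]
      by eventually_elim (intro linear_on_add[OF linear_eta] field_near_tangent)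
    then have "A p (\<lambda>q. \<eta> s q (B q + B' q)) = A p (\<lambda>q. \<eta> s q (B q) + \<eta> s q (B' q))"
      by (rule tangent_cong[OF Ap])
    then show "A p (\<lambda>q. \<eta> s q (B q + B' q)) - \<eta> s p (lie_bracket \<A> A (\<lambda>q. B q + B' q) p)
      = A p (\<lambda>q. \<eta> s q (B q)) - \<eta> s p (lie_bracket \<A> A B p) +
        (A p (\<lambda>q. \<eta> s q (B' q)) - \<eta> s p (lie_bracket \<A> A B' p))"
      using B assms
      by (simp add: lie_bracket_add_right linear_on_add[OF lin] tangent_lie_bracket tangent_add[OF Ap]
          smooth_near_eta)
  next
    fix f B assume fB: "smooth_near \<A> p f" "field_near p B"
    have "eventually (\<lambda>q. \<eta> s q (f q *\<^sub>R B q) = f q * \<eta> s q (B q)) (nhds p)"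
      using eventually_U[OF assms(1)] field_near_eventually[OF fB(2)]
    proof eventually_elim
      case (elim q)
      then show ?case using linear_on_scale[OF linear_eta[of q s] field_near_tangent[of q B], of "f q"] by simp
    qed
    then have 1: "A p (\<lambda>q. \<eta> s q (f q *\<^sub>R B q)) = A p (\<lambda>q. f q * \<eta> s q (B q))"
      by (rule tangent_cong[OF Ap])
    have 2: "\<eta> s p (lie_bracket \<A> A (\<lambda>q. f q *\<^sub>R B q) p)
      = f p * \<eta> s p (lie_bracket \<A> A B p) + A p f * \<eta> s p (B p)"
      using fB assms tangent_lie_bracket[of p A B] field_near_tangent[OF fB(2)]
      by (simp add: lie_bracket_scale_right linear_on_add[OF lin] linear_on_scale[OF lin]
          subspace_scale[OF subspace_tangent])
    show "A p (\<lambda>q. \<eta> s q (f q *\<^sub>R B q)) - \<eta> s p (lie_bracket \<A> A (\<lambda>q. f q *\<^sub>R B q) p)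
      = f p *\<^sub>R (A p (\<lambda>q. \<eta> s q (B q)) - \<eta> s p (lie_bracket \<A> A B p))"
      unfolding 1 2 using fB assms by (simp add: tangent_mult[OF Ap] smooth_near_eta algebra_simps)
  qed (rule assms(3,4))+
  then show ?thesis by simp
qed

end

section \<open>The canonical connection\<close>

lemma minus_diff_flip: "a - b - - c = - (b - a - c)" for a b c :: "'a::ab_group_add"
  by simp

lemma diff_swap_cong: "a - l = b - m \<Longrightarrow> a - c - l = b - c - m" for a b c :: "'a::ab_group_add"
  by (simp add: algebra_simps)

lemma eps_cases: "eps s = 1 \<or> eps s = - 1" by (simp add: eps_def)

lemma eps_mult_self [simp]: "eps s * eps s = 1" by (simp add: eps_def)

context pqc_data
begin

text \<open>Two extensions of one vector differ by a field \<open>W\<close> with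
  \<open>W p = 0\<close>, for which the covariant derivative and the bracket cancel.\<close>

lemma torsion_expression_right:
  assumes "p \<in> U" "field_near p A" "field_near p B" "field_near p B'" "B p = B' p"
  shows "nab p (A p) B - nab p (B p) A - lie_bracket \<A> A B p
    = nab p (A p) B' - nab p (B' p) A - lie_bracket \<A> A B' p"
proof -
  define W where "W q = B' q - B q" for q
  have W: "field_near p W" unfolding W_def using assms(4,3) by (rule field_near_diff)
  have W0: "W p = 0" unfolding W_def using assms(5) by (simp only: diff_self)
  have B': "B' = (\<lambda>q. B q + W q)" by (rule ext) (simp only: W_def add_diff_eq add_diff_cancel_left')
  have "nab p (A p) B' - lie_bracket \<A> A B' p
      = (nab p (A p) B + nab p (A p) W) - (lie_bracket \<A> A B p + nab p (A p) W)"
    unfolding B' nab_add[OF assms(3) W field_near_tangent[OF assms(2)]] lie_bracket_add_right[OF assms(2,3) W]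
      lie_bracket_eq_nab[OF assms(1,2) W W0] ..
  also have "\<dots> = nab p (A p) B - lie_bracket \<A> A B p" by (rule add_diff_cancel_right)
  finally have "nab p (A p) B' - lie_bracket \<A> A B' p = nab p (A p) B - lie_bracket \<A> A B p" .
  then show ?thesis unfolding assms(5) by (rule diff_swap_cong[OF sym])
qed

text \<open>The chosen extensions are exchanged one at a time: the second argument directly, the
  first one after using antisymmetry. The same scheme serves for
  \<open>d_one_fields\<close>.\<close>

lemma torsion_fields:
  assumes "p \<in> U" "field_near p A" "field_near p B"
  shows "torsion \<A> nab p (A p) (B p) = nab p (A p) B - nab p (B p) A - lie_bracket \<A> A B p"
proof -
  let ?A = "extend \<A> p (A p)" and ?B = "extend \<A> p (B p)"
  have A: "field_near p ?A" "?A p = A p" and B: "field_near p ?B" "?B p = B p"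
    using extend_near[OF assms(1) field_near_tangent[OF assms(2)]]
      extend_near[OF assms(1) field_near_tangent[OF assms(3)]] by auto
  have "torsion \<A> nab p (A p) (B p) = nab p (?A p) ?B - nab p (?B p) ?A - lie_bracket \<A> ?A ?B p"
    unfolding torsion_def A(2) B(2) ..
  also have "\<dots> = nab p (?A p) B - nab p (B p) ?A - lie_bracket \<A> ?A B p"
    by (rule torsion_expression_right[OF assms(1) A(1) B(1) assms(3) B(2)])
  also have "\<dots> = - (nab p (B p) ?A - nab p (?A p) B - lie_bracket \<A> B ?A p)"
    unfolding lie_bracket_antisym[of ?A] by (rule minus_diff_flip)
  also have "\<dots> = - (nab p (B p) A - nab p (A p) B - lie_bracket \<A> B A p)"
    by (simp only: torsion_expression_right[OF assms(1,3) A(1) assms(2) A(2)])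
  also have "\<dots> = nab p (A p) B - nab p (B p) A - lie_bracket \<A> A B p"
    unfolding lie_bracket_antisym[of A] by (rule minus_diff_flip[symmetric])
  finally show ?thesis .
qed

lemma eta_add: "p \<in> U \<Longrightarrow> v \<in> tangent_space \<A> p \<Longrightarrow> w \<in> tangent_space \<A> p \<Longrightarrow> \<eta> s p (v + w) = \<eta> s p v + \<eta> s p w"
  and eta_minus: "p \<in> U \<Longrightarrow> v \<in> tangent_space \<A> p \<Longrightarrow> \<eta> s p (- v) = - \<eta> s p v"
  and eta_scale: "p \<in> U \<Longrightarrow> v \<in> tangent_space \<A> p \<Longrightarrow> \<eta> s p (c *\<^sub>R v) = c * \<eta> s p v"
  using linear_on_add[OF linear_eta] linear_on_uminus[OF linear_eta] linear_on_scale[OF linear_eta] by auto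

lemma d_one_expression_right:
  assumes "p \<in> U" "field_near p A" "field_near p B" "field_near p B'" "B p = B' p"
  shows "A p (\<lambda>q. \<eta> s q (B q)) - B p (\<lambda>q. \<eta> s q (A q)) - \<eta> s p (lie_bracket \<A> A B p)
    = A p (\<lambda>q. \<eta> s q (B' q)) - B' p (\<lambda>q. \<eta> s q (A q)) - \<eta> s p (lie_bracket \<A> A B' p)"
proof -
  define W where "W q = B' q - B q" for q
  have W: "field_near p W" unfolding W_def using assms(4,3) by (rule field_near_diff)
  have W0: "W p = 0" unfolding W_def using assms(5) by (simp only: diff_self)
  have B': "B' = (\<lambda>q. B q + W q)" by (rule ext) (simp only: W_def add_diff_eq add_diff_cancel_left')
  note Ap = field_near_tangent[OF assms(2)]
  have "eventually (\<lambda>q. \<eta> s q (B' q) = \<eta> s q (B q) + \<eta> s q (W q)) (nhds p)"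
    using eventually_U[OF assms(1)] field_near_eventually[OF assms(3)] field_near_eventually[OF W]
    unfolding B' by eventually_elim (intro eta_add field_near_tangent)
  then have 1: "A p (\<lambda>q. \<eta> s q (B' q)) = A p (\<lambda>q. \<eta> s q (B q) + \<eta> s q (W q))"
    by (rule tangent_cong[OF Ap])
  have 2: "\<eta> s p (lie_bracket \<A> A B' p) = \<eta> s p (lie_bracket \<A> A B p) + A p (\<lambda>q. \<eta> s q (W q))"
    unfolding B' lie_bracket_add_right[OF assms(2,3) W]
    using eta_add[OF assms(1) tangent_lie_bracket[OF assms(2,3)] tangent_lie_bracket[OF assms(2) W]]
      eta_lie_bracket_zero[OF assms(1,2) W W0] by simp
  show ?thesis
    unfolding 1 2 using assms W by (simp add: tangent_add[OF Ap] smooth_near_eta)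
qed

lemma d_one_fields:
  assumes "p \<in> U" "field_near p A" "field_near p B"
  shows "d_one \<A> (\<eta> s) p (A p) (B p)
    = A p (\<lambda>q. \<eta> s q (B q)) - B p (\<lambda>q. \<eta> s q (A q)) - \<eta> s p (lie_bracket \<A> A B p)"
proof -
  let ?A = "extend \<A> p (A p)" and ?B = "extend \<A> p (B p)"
  let ?F = "\<lambda>A B. A p (\<lambda>q. \<eta> s q (B q)) - B p (\<lambda>q. \<eta> s q (A q)) - \<eta> s p (lie_bracket \<A> A B p)"
  have A: "field_near p ?A" "?A p = A p" and B: "field_near p ?B" "?B p = B p"
    using extend_near[OF assms(1) field_near_tangent[OF assms(2)]]
      extend_near[OF assms(1) field_near_tangent[OF assms(3)]] by auto
  have anti: "?F A' B' = - ?F B' A'" if "field_near p A'" "field_near p B'" for A' B'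
    using eta_minus[OF assms(1) tangent_lie_bracket[OF that(2,1)], of s] lie_bracket_antisym[of A' B' p] by simp
  have "d_one \<A> (\<eta> s) p (A p) (B p) = ?F ?A ?B"
    unfolding d_one_eq A(2) B(2) ..
  also have "\<dots> = ?F ?A B" 
    by (rule d_one_expression_right[OF assms(1) A(1) B(1) assms(3) B(2)])
  also have "\<dots> = - ?F B ?A" by (rule anti[OF A(1) assms(3)])
  also have "\<dots> = - ?F B A" using d_one_expression_right[OF assms(1,3) A(1) assms(2) A(2)] by simp
  also have "\<dots> = ?F A B" using anti[OF assms(2,3)] by simp
  finally show ?thesis .
qed

lemma eta_hor_eventually: "p \<in> U \<Longrightarrow> hor p X \<Longrightarrow> eventually (\<lambda>q. \<eta> s q (X q) = 0) (nhds p)"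
  by (rule eventually_elim2[OF eventually_U hor_eventually]) (use H_iff hor_H in blast)+

lemma eta_hor_deriv: "p \<in> U \<Longrightarrow> hor p X \<Longrightarrow> v \<in> tangent_space \<A> p \<Longrightarrow> v (\<lambda>q. \<eta> s q (X q)) = 0"
  using tangent_cong[OF _ eta_hor_eventually[of p X s], of v] tangent_const[of v p 0] by simp

lemma eta_xi_deriv:
  assumes "p \<in> U" "v \<in> tangent_space \<A> p"
  shows "v (\<lambda>q. \<eta> s q (\<xi> t q)) = 0"
proof -
  have "eventually (\<lambda>q. \<eta> s q (\<xi> t q) = (if s = t then 1 else 0)) (nhds p)"
    using eventually_U[OF assms(1)] by eventually_elim (rule eta_xi)
  from tangent_cong[OF assms(2) this] show ?thesis using tangent_const[OF assms(2)] by simp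
qed

lemma eta_lie_bracket_hor:
  assumes "p \<in> U" "hor p X" "hor p Y"
  shows "\<eta> s p (lie_bracket \<A> X Y p) = 2 * eps s * g p (I s p (X p)) (Y p)"
proof -
  have f: "field_near p X" "field_near p Y" using assms by auto
  show ?thesis
    using d_one_fields[OF assms(1) f, of s] d_eta_H[OF assms(1) hor_H[OF assms(2)] hor_H[OF assms(3)], of s]
      eta_hor_deriv[OF assms(1,2) field_near_tangent[OF f(2)]] eta_hor_deriv[OF assms(1,3) field_near_tangent[OF f(1)]]
    by simp
qed

text \<open>For horizontal \<open>X\<close> this is
  \<open>- d_one \<A> (\<eta> s) p (\<xi> i p) (X p)\<close>. It is kept as a function of the point,
  because its derivatives along horizontal fields enter the Jacobi identity.\<close>

definition bt :: "3 \<Rightarrow> 3 \<Rightarrow> 'm vfield \<Rightarrow> 'm \<Rightarrow> real" where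
  "bt s i X q = \<eta> s q (lie_bracket \<A> (\<xi> i) X q)"

lemma smooth_near_bt [intro]: "p \<in> U \<Longrightarrow> field_near p X \<Longrightarrow> smooth_near \<A> p (bt s i X)"
  unfolding bt_def by (intro smooth_near_eta field_near_lie_bracket field_near_xi)

lemma bt_d_one:
  assumes "p \<in> U" "hor p X"
  shows "bt s i X p = - d_one \<A> (\<eta> s) p (\<xi> i p) (X p)"
  using d_one_fields[OF assms(1) field_near_xi[OF assms(1)] hor_field[OF assms(2)], of s i]
    eta_hor_deriv[OF assms xi_tangent[OF assms(1)]] eta_xi_deriv[OF assms(1) field_near_tangent[OF hor_field[OF assms(2)]]]
  by (simp add: bt_def)

text \<open>The product of the three signs is \<open>- 1\<close>, so the factor \<open>eps k\<close>
  in the cyclic Reeb condition equals \<open>- eps i * eps j\<close>. This merges all Reeb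
  conditions into one law valid for every pair of indices, the diagonal included.\<close>

lemma bt_skew:
  assumes "p \<in> U" "hor p X"
  shows "eps s * bt s i X p = - (eps i * bt i s X p)"
proof -
  have 0: "bt t t X p = 0" for t using bt_d_one[OF assms] d_eta_xi_self[OF assms(1) hor_H[OF assms(2)]] by simp
  have 1: "bt i j X p = eps k * bt j i X p" if "(i, j, k) \<in> cyclic_perms" for i j k
    using bt_d_one[OF assms] d_eta_xi_cyclic[OF assms(1) hor_H[OF assms(2)] that] by simp
  show ?thesis
    using 0 1[of 1 2 3] 1[of 2 3 1] 1[of 3 1 2] exhaust_3[of s] exhaust_3[of i]
    by (auto simp: cyclic_perms_def eps_def)
qed

lemma bt_skew_eventually:
  assumes "p \<in> U" "hor p X"
  shows "eventually (\<lambda>q. eps s * bt s i X q = - (eps i * bt i s X q)) (nhds p)"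
  using eventually_U[OF assms(1)] hor_eventually[OF assms(2)] by eventually_elim (rule bt_skew)

lemma bt_skew_deriv:
  assumes "p \<in> U" "hor p X" "v \<in> tangent_space \<A> p"
  shows "eps s * v (bt s i X) = - (eps i * v (bt i s X))"
proof -
  have sm: "smooth_near \<A> p (bt s i X)" for s i using assms(1,2) by (auto intro: smooth_near_bt)
  have "v (\<lambda>q. eps s * bt s i X q) = v (\<lambda>q. - eps i * bt i s X q)"
    using bt_skew_eventually[OF assms(1,2), of s i] by (intro tangent_cong[OF assms(3)]) simp
  then have "eps s * v (bt s i X) = - eps i * v (bt i s X)" by (simp only: tangent_cmult[OF assms(3) sm])
  then show ?thesis by simp
qed

section \<open>Axioms of the canonical connection at a point\<close>

lemmas conn_data = conn[unfolded canonical_pqc_connection_def, THEN conjunct2, THEN spec, THEN spec, THEN spec,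
    THEN spec, THEN mp, OF conjI[OF data reeb]]

lemmas conn_local = conn_data[THEN conjunct1, THEN spec, THEN spec, THEN spec, THEN mp]

lemma nab_hor:
  assumes "p \<in> U" "v \<in> tangent_space \<A> p" "hor p X"
  shows "nab p v X \<in> H p"
    and "nab p v (\<lambda>q. I s q (X q)) - I s p (nab p v X) = (\<Sum>t\<in>UNIV. \<eta> t p (nab p v (\<xi> s)) *\<^sub>R I t p (X p))"
proof -
  obtain W where W: "p \<in> W" "W \<subseteq> U" "open W" "horizontal_field \<A> H W X" "horizontal_field \<A> H W X"
    using assms(1,3,3) by (rule hor_horizontal_field)
  have CW: "W \<subseteq> U \<and> p \<in> W \<and> v \<in> tangent_space \<A> p" using W(1,2) assms(2) by simp
  show "nab p v X \<in> H p" by (rule conn_local[OF CW, THEN conjunct1, THEN spec, THEN mp, OF W(4)])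
  show "nab p v (\<lambda>q. I s q (X q)) - I s p (nab p v X) = (\<Sum>t\<in>UNIV. \<eta> t p (nab p v (\<xi> s)) *\<^sub>R I t p (X p))"
    by (rule conn_local[OF CW, THEN conjunct2, THEN conjunct2, THEN conjunct2, THEN conjunct2, THEN conjunct1,
      THEN spec, THEN spec, THEN mp, OF W(4)])
qed

lemma nab_vertical:
  assumes "p \<in> U" "v \<in> tangent_space \<A> p" "field_near p Z" "eventually (\<lambda>q. Z q \<in> vertical \<xi> q) (nhds p)"
  shows "nab p v Z \<in> vertical \<xi> p"
proof -
  obtain W where W: "p \<in> W" "open W" "smooth_field \<A> W Z" using assms(3) by (rule field_nearE)
  obtain S where S: "open S" "p \<in> S" "\<And>q. q \<in> S \<Longrightarrow> Z q \<in> vertical \<xi> q"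
    using assms(4) unfolding eventually_nhds by blast
  have o: "open (W \<inter> S \<inter> U)" using W(2) S(1) open_U by (intro open_Int)
  have sub: "W \<inter> S \<inter> U \<subseteq> W" by blast
  have CW: "W \<inter> S \<inter> U \<subseteq> U \<and> p \<in> W \<inter> S \<inter> U \<and> v \<in> tangent_space \<A> p" using W(1) S(2) assms(1,2) by simp
  have Z: "smooth_field \<A> (W \<inter> S \<inter> U) Z \<and> (\<forall>q\<in>W \<inter> S \<inter> U. Z q \<in> vertical \<xi> q)"
    using smooth_field_subset[OF W(3) sub o] S(3) by simp
  show ?thesis by (rule conn_local[OF CW, THEN conjunct2, THEN conjunct1, THEN spec, THEN mp, OF Z])
qed

lemma nab_metric:
  assumes "p \<in> U" "v \<in> tangent_space \<A> p" "field_near p A" "field_near p B"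
  shows "v (\<lambda>q. ext_metric g \<eta> \<xi> q (A q) (B q)) =
    ext_metric g \<eta> \<xi> p (nab p v A) (B p) + ext_metric g \<eta> \<xi> p (A p) (nab p v B)"
proof -
  obtain W where W: "p \<in> W" "open W" "smooth_field \<A> W A" "smooth_field \<A> W B"
    using assms(3,4) by (rule field_near2E)
  have o: "open (W \<inter> U)" using W(2) open_U by (intro open_Int)
  have CW: "W \<inter> U \<subseteq> U \<and> p \<in> W \<inter> U \<and> v \<in> tangent_space \<A> p" using W(1) assms(1,2) by simp
  have AB: "smooth_field \<A> (W \<inter> U) A \<and> smooth_field \<A> (W \<inter> U) B"
    using smooth_field_subset[OF W(3) Int_lower1 o] smooth_field_subset[OF W(4) Int_lower1 o] by simp
  show ?thesis
    by (rule conn_local[OF CW, THEN conjunct2, THEN conjunct2, THEN conjunct1, THEN spec, THEN spec, THEN mp, OF AB])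
qed

lemma ext_metric_H:
  assumes "p \<in> U" "x \<in> H p" "y \<in> H p"
  shows "ext_metric g \<eta> \<xi> p x y = g p x y"
proof -
  have "\<eta> s p x = 0" for s using assms(2) H_iff[OF assms(1)] by simp
  then show ?thesis by (simp add: ext_metric_def hproj_id assms)
qed

lemma ext_metric_xi:
  assumes "p \<in> U" "v \<in> tangent_space \<A> p"
  shows "ext_metric g \<eta> \<xi> p v (\<xi> t p) = - (eps t * \<eta> t p v)"
    and "ext_metric g \<eta> \<xi> p (\<xi> t p) v = - (eps t * \<eta> t p v)"
proof -
  have z: "g p x 0 = 0" "g p 0 x = 0" if "x \<in> H p" for x
    using linear_on_zero[OF linear_g[OF that] subspace_H] linear_on_zero[OF linear_g_left[OF that] subspace_H] .
  have "(\<Sum>s\<in>UNIV. eps s * \<eta> s p v * (if s = t then 1 else 0)) = eps t * \<eta> t p v"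
    "(\<Sum>s\<in>UNIV. eps s * (if s = t then 1 else 0) * \<eta> s p v) = eps t * \<eta> t p v"
    by (simp_all add: if_distrib if_distribR cong: if_cong)
  then show "ext_metric g \<eta> \<xi> p v (\<xi> t p) = - (eps t * \<eta> t p v)"
    "ext_metric g \<eta> \<xi> p (\<xi> t p) v = - (eps t * \<eta> t p v)"
    using z[OF hproj_H[OF assms]] unfolding ext_metric_def hproj_xi[OF assms(1)] eta_xi[OF assms(1)] by simp_all
qed

lemma nab_g:
  assumes "p \<in> U" "v \<in> tangent_space \<A> p" "hor p X" "hor p Y"
  shows "v (\<lambda>q. g q (X q) (Y q)) = g p (nab p v X) (Y p) + g p (X p) (nab p v Y)"
proof -
  have "eventually (\<lambda>q. ext_metric g \<eta> \<xi> q (X q) (Y q) = g q (X q) (Y q)) (nhds p)"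
    using eventually_U[OF assms(1)] hor_eventually[OF assms(3)] hor_eventually[OF assms(4)]
    by eventually_elim (intro ext_metric_H hor_H)
  from tangent_cong[OF assms(2) this] nab_metric[OF assms(1,2) hor_field[OF assms(3)] hor_field[OF assms(4)]]
  show ?thesis
    using nab_hor(1)[OF assms(1,2)] assms by (simp add: ext_metric_H hor_H)
qed

text \<open>These are the connection forms of the vertical bundle in the Reeb frame. Since the map
  sending \<open>\<xi> s\<close> to \<open>I s\<close> is parallel, the same forms govern the
  covariant derivatives of the \<open>I s\<close>.\<close>

abbreviation alpha :: "3 \<Rightarrow> 3 \<Rightarrow> 'm \<Rightarrow> 'm tvec \<Rightarrow> real" where
  "alpha s t p v \<equiv> \<eta> t p (nab p v (\<xi> s))"

lemma alpha_skew:
  assumes "p \<in> U" "v \<in> tangent_space \<A> p"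
  shows "eps t * alpha s t p v = - (eps s * alpha t s p v)"
proof -
  have "eventually (\<lambda>q. ext_metric g \<eta> \<xi> q (\<xi> s q) (\<xi> t q) = - (eps t * (if t = s then 1 else 0))) (nhds p)"
    using eventually_U[OF assms(1)]
  proof eventually_elim
    case (elim q)
    then show ?case using ext_metric_xi(1)[OF elim xi_tangent[OF elim]] eta_xi[OF elim] by simp
  qed
  from tangent_cong[OF assms(2) this] have "v (\<lambda>q. ext_metric g \<eta> \<xi> q (\<xi> s q) (\<xi> t q)) = 0"
    using tangent_const[OF assms(2)] by simp
  then have "ext_metric g \<eta> \<xi> p (nab p v (\<xi> s)) (\<xi> t p) + ext_metric g \<eta> \<xi> p (\<xi> s p) (nab p v (\<xi> t)) = 0"
    using nab_metric[OF assms field_near_xi[OF assms(1)] field_near_xi[OF assms(1)]] by simp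
  then show ?thesis
    using ext_metric_xi[OF assms(1) nab_tangent[OF field_near_xi[OF assms(1)] assms(2)]] by simp
qed

definition om :: "3 \<Rightarrow> 'm \<Rightarrow> 'm tvec \<Rightarrow> 'm tvec \<Rightarrow> real" where
  "om s p x y = g p (I s p x) y"

lemma linear_om:
  assumes "p \<in> U"
  shows "x \<in> H p \<Longrightarrow> linear_on (H p) (om s p x)" "y \<in> H p \<Longrightarrow> linear_on (H p) (\<lambda>x. om s p x y)"
proof -
  show "linear_on (H p) (om s p x)" if "x \<in> H p"
    unfolding om_def using linear_g[OF I_H[OF assms that]] .
  show "linear_on (H p) (\<lambda>x. om s p x y)" if y: "y \<in> H p"
    unfolding om_def linear_on_def
    using linear_on_add[OF linear_I[OF assms]] linear_on_scale[OF linear_I[OF assms]]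
      linear_on_add[OF linear_g_left[OF y]] linear_on_scale[OF linear_g_left[OF y]] I_H[OF assms] by simp
qed

lemma g_I_left:
  assumes "p \<in> U" "x \<in> H p" "y \<in> H p"
  shows "g p (I s p x) y = - g p x (I s p y)"
proof -
  have "g p (I s p (I s p x)) (I s p y) = - eps s * g p (I s p x) y"
    using assms by (intro g_I_I I_H)
  moreover have "g p (eps s *\<^sub>R x) (I s p y) = eps s * g p x (I s p y)"
    using linear_on_scale[OF linear_g_left[OF I_H[OF assms(1,3)]] assms(2), of "eps s"] by simp
  ultimately have "eps s * g p x (I s p y) = - eps s * g p (I s p x) y" using I_I[OF assms(1,2)] by simp
  then show ?thesis using eps_cases[of s] by auto
qed

lemma om_skew:
  assumes "p \<in> U" "x \<in> H p" "y \<in> H p"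
  shows "om s p x y = - om s p y x"
  unfolding om_def using g_I_left[OF assms] g_sym[OF assms(2) I_H[OF assms(1,3)]] by simp

lemma smooth_near_om [intro]: "p \<in> U \<Longrightarrow> hor p X \<Longrightarrow> hor p Y \<Longrightarrow> smooth_near \<A> p (\<lambda>q. om s q (X q) (Y q))"
  unfolding om_def by (intro smooth_near_g hor_I)

text \<open>Only the bundle spanned by the \<open>I s\<close> is parallel, not each
  \<open>I s\<close>; the sum over \<open>t\<close> records this rotation.\<close>

lemma nab_om:
  assumes "p \<in> U" "v \<in> tangent_space \<A> p" "hor p X" "hor p Y"
  shows "v (\<lambda>q. om s q (X q) (Y q)) = (\<Sum>t\<in>UNIV. alpha s t p v * om t p (X p) (Y p))
    + om s p (nab p v X) (Y p) + om s p (X p) (nab p v Y)"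
proof -
  have XH: "X p \<in> H p" and YH: "Y p \<in> H p" using assms(3,4) by (auto intro: hor_H)
  have nX: "nab p v X \<in> H p" by (rule nab_hor(1)[OF assms(1-3)])
  let ?S = "\<Sum>t\<in>UNIV. alpha s t p v *\<^sub>R I t p (X p)"
  have SH: "?S \<in> H p" using I_H[OF assms(1) XH] by (intro subspace_sum[OF subspace_H] subspace_scale[OF subspace_H])
  have nI: "nab p v (\<lambda>q. I s q (X q)) = ?S + I s p (nab p v X)"
    using nab_hor(2)[OF assms(1-3), of s] by (simp only: diff_eq_eq)
  have "g p ?S (Y p) = (\<Sum>t\<in>UNIV. g p (alpha s t p v *\<^sub>R I t p (X p)) (Y p))"
    using I_H[OF assms(1) XH]
    by (intro linear_on_sum[OF linear_g_left[OF YH] subspace_H] subspace_scale[OF subspace_H])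
  also have "\<dots> = (\<Sum>t\<in>UNIV. alpha s t p v * om t p (X p) (Y p))"
    using linear_on_scale[OF linear_g_left[OF YH] I_H[OF assms(1) XH]] by (simp add: om_def)
  finally have S: "g p ?S (Y p) = (\<Sum>t\<in>UNIV. alpha s t p v * om t p (X p) (Y p))" .
  have "v (\<lambda>q. om s q (X q) (Y q)) = g p (nab p v (\<lambda>q. I s q (X q))) (Y p) + g p (I s p (X p)) (nab p v Y)"
    unfolding om_def using nab_g[OF assms(1,2) hor_I[OF assms(1,3)] assms(4)] .
  also have "g p (nab p v (\<lambda>q. I s q (X q))) (Y p) = g p ?S (Y p) + g p (I s p (nab p v X)) (Y p)"
    unfolding nI by (rule linear_on_add[OF linear_g_left[OF YH] SH I_H[OF assms(1) nX]])
  finally show ?thesis unfolding S by (simp add: om_def)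
qed

lemma hproj_vertical:
  assumes "p \<in> U" "z \<in> vertical \<xi> p"
  shows "hproj \<eta> \<xi> p z = 0"
proof -
  have "vertical \<xi> p \<subseteq> {v \<in> tangent_space \<A> p. hproj \<eta> \<xi> p v = 0}" (is "_ \<subseteq> ?S")
    unfolding vertical_def
  proof (rule span_minimal)
    show "range (\<lambda>s. \<xi> s p) \<subseteq> ?S" using xi_tangent[OF assms(1)] hproj_xi[OF assms(1)] by auto
    show "subspace ?S"
      unfolding subspace_def
      using linear_on_zero[OF linear_hproj[OF assms(1)] subspace_tangent] linear_on_add[OF linear_hproj[OF assms(1)]]
        linear_on_scale[OF linear_hproj[OF assms(1)]] subspace_0[OF subspace_tangent]
        subspace_add[OF subspace_tangent] subspace_scale[OF subspace_tangent]
      by simp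
  qed
  then show ?thesis using assms(2) by blast
qed

lemma vertical_tangent: "p \<in> U \<Longrightarrow> z \<in> vertical \<xi> p \<Longrightarrow> z \<in> tangent_space \<A> p"
  using span_minimal[OF _ subspace_tangent, of "range (\<lambda>s. \<xi> s p)" p] xi_tangent[of p] unfolding vertical_def by blast

lemma vproj_vertical: "vproj \<eta> \<xi> p v \<in> vertical \<xi> p"
  unfolding vproj_def vertical_def by (intro span_sum span_scale span_base) simp

text \<open>The connection preserves both summands of the tangent bundle, hence commutes with the
  projection.\<close>

lemma hproj_nab:
  assumes "p \<in> U" "v \<in> tangent_space \<A> p" "field_near p A"
  shows "hproj \<eta> \<xi> p (nab p v A) = nab p v (\<lambda>q. hproj \<eta> \<xi> q (A q))"
proof -
  let ?h = "\<lambda>q. hproj \<eta> \<xi> q (A q)" and ?v = "\<lambda>q. vproj \<eta> \<xi> q (A q)"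
  have h: "hor p ?h" by (rule hor_hproj[OF assms(1,3)])
  have v: "field_near p ?v" by (rule field_near_vproj[OF assms(1,3)])
  have vv: "nab p v ?v \<in> vertical \<xi> p"
    using assms(1,2) v by (rule nab_vertical) (simp add: vproj_vertical)
  have "nab p v A = nab p v (\<lambda>q. ?h q + ?v q)" unfolding hproj_vproj ..
  also have "\<dots> = nab p v ?h + nab p v ?v" by (rule nab_add[OF hor_field[OF h] v assms(2)])
  finally have "hproj \<eta> \<xi> p (nab p v A) = hproj \<eta> \<xi> p (nab p v ?h) + hproj \<eta> \<xi> p (nab p v ?v)"
    using linear_on_add[OF linear_hproj[OF assms(1)] H_tangent[OF nab_hor(1)[OF assms(1,2) h]] vertical_tangent[OF assms(1) vv]] by simp
  then show ?thesis
    using hproj_vertical[OF assms(1) vv] hproj_id[OF assms(1) nab_hor(1)[OF assms(1,2) h]] by (simp only: add_0_right)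
qed

definition Tor :: "3 \<Rightarrow> 'm \<Rightarrow> 'm tvec \<Rightarrow> 'm tvec" where
  "Tor i p x = hproj \<eta> \<xi> p (torsion \<A> nab p (\<xi> i p) x)"

text \<open>The derivative of \<open>\<xi> i\<close> along \<open>X\<close> is vertical and that of
  \<open>X\<close> along \<open>\<xi> i\<close> is horizontal, so projecting the torsion loses the
  former and keeps the latter.\<close>

lemma Tor_hor:
  assumes "p \<in> U" "hor p X"
  shows "Tor i p (X p) = nab p (\<xi> i p) X - hproj \<eta> \<xi> p (lie_bracket \<A> (\<xi> i) X p)"
proof -
  note x = field_near_xi[OF assms(1), of i] and X = hor_field[OF assms(2)]
  note xp = xi_tangent[OF assms(1), of i] and Xp = field_near_tangent[OF X]
  note lin = linear_on_diff[OF linear_hproj[OF assms(1)] subspace_tangent]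
  have v: "nab p (X p) (\<xi> i) \<in> vertical \<xi> p"
    using assms(1) Xp x by (rule nab_vertical) (simp add: vertical_def span_base)
  have t: "nab p (\<xi> i p) X \<in> tangent_space \<A> p" "nab p (X p) (\<xi> i) \<in> tangent_space \<A> p"
    "lie_bracket \<A> (\<xi> i) X p \<in> tangent_space \<A> p"
    using nab_tangent[OF X xp] nab_tangent[OF x Xp] tangent_lie_bracket[OF x X] by auto
  have "Tor i p (X p) = hproj \<eta> \<xi> p (nab p (\<xi> i p) X) - hproj \<eta> \<xi> p (nab p (X p) (\<xi> i))
      - hproj \<eta> \<xi> p (lie_bracket \<A> (\<xi> i) X p)"
    unfolding Tor_def torsion_fields[OF assms(1) x X]
    using lin[OF t(1,2)] lin[OF subspace_diff[OF subspace_tangent t(1,2)] t(3)] by simp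
  then show ?thesis
    using hproj_vertical[OF assms(1) v] hproj_id[OF assms(1) nab_hor(1)[OF assms(1) xp assms(2)]]
    by (simp only: diff_zero)
qed

end

section \<open>The Jacobi identity for the contact forms\<close>

context pqc_data
begin

text \<open>Expand \<open>B\<close> into its horizontal part and its Reeb components. The Leibniz
  rule differentiates the coefficients of the \<open>\<xi> t\<close>, and \<open>\<eta> s\<close>
  keeps only the coefficient with \<open>t = s\<close>.\<close>

lemma eta_lie_bracket_split:
  assumes "p \<in> U" "field_near p Z" "field_near p B"
  shows "\<eta> s p (lie_bracket \<A> Z B p) = \<eta> s p (lie_bracket \<A> Z (\<lambda>q. hproj \<eta> \<xi> q (B q)) p)
    + (\<Sum>t\<in>UNIV. \<eta> t p (B p) * \<eta> s p (lie_bracket \<A> Z (\<xi> t) p)) + Z p (\<lambda>q. \<eta> s q (B q))"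
proof -
  let ?h = "\<lambda>q. hproj \<eta> \<xi> q (B q)"
  have h: "field_near p ?h" using hor_field[OF hor_hproj[OF assms(1,3)]] .
  have xi: "field_near p (\<xi> t)" for t using assms(1) by (rule field_near_xi)
  have xs: "field_near p (\<lambda>q. \<eta> t q (B q) *\<^sub>R \<xi> t q)" for t
    using assms by (intro field_near_scale smooth_near_eta field_near_xi)
  have Z: "lie_bracket \<A> Z B p \<in> tangent_space \<A> p" if "field_near p B" for B
    using assms(2) that by (rule tangent_lie_bracket)
  have B: "B = (\<lambda>q. ?h q + (\<Sum>t\<in>UNIV. \<eta> t q (B q) *\<^sub>R \<xi> t q))"
    by (rule ext) (simp only: hproj_def vproj_def diff_add_cancel)
  have "lie_bracket \<A> Z B p = lie_bracket \<A> Z (\<lambda>q. ?h q + (\<Sum>t\<in>UNIV. \<eta> t q (B q) *\<^sub>R \<xi> t q)) p"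
    using B by (rule arg_cong)
  also have "\<dots> = lie_bracket \<A> Z ?h p + (\<Sum>t\<in>UNIV. lie_bracket \<A> Z (\<lambda>q. \<eta> t q (B q) *\<^sub>R \<xi> t q) p)"
    unfolding lie_bracket_add_right[OF assms(2) h field_near_sum[OF xs]] lie_bracket_sum_right[OF assms(2) xs] ..
  finally have "\<eta> s p (lie_bracket \<A> Z B p) = \<eta> s p (lie_bracket \<A> Z ?h p)
      + \<eta> s p (\<Sum>t\<in>UNIV. lie_bracket \<A> Z (\<lambda>q. \<eta> t q (B q) *\<^sub>R \<xi> t q) p)"
    using eta_add[OF assms(1) Z[OF h] subspace_sum[OF subspace_tangent Z[OF xs]]] by simp
  also have "\<eta> s p (\<Sum>t\<in>UNIV. lie_bracket \<A> Z (\<lambda>q. \<eta> t q (B q) *\<^sub>R \<xi> t q) p)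
      = (\<Sum>t\<in>UNIV. \<eta> s p (lie_bracket \<A> Z (\<lambda>q. \<eta> t q (B q) *\<^sub>R \<xi> t q) p))"
    by (rule linear_on_sum[OF linear_eta[OF assms(1)] subspace_tangent Z[OF xs]])
  also have "\<dots> = (\<Sum>t\<in>UNIV. \<eta> t p (B p) * \<eta> s p (lie_bracket \<A> Z (\<xi> t) p)
      + (if t = s then Z p (\<lambda>q. \<eta> s q (B q)) else 0))"
  proof (rule sum.cong)
    fix t
    have "lie_bracket \<A> Z (\<lambda>q. \<eta> t q (B q) *\<^sub>R \<xi> t q) p
        = \<eta> t p (B p) *\<^sub>R lie_bracket \<A> Z (\<xi> t) p + Z p (\<lambda>q. \<eta> t q (B q)) *\<^sub>R \<xi> t p"
      using assms by (intro lie_bracket_scale_right smooth_near_eta field_near_xi)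
    then have "\<eta> s p (lie_bracket \<A> Z (\<lambda>q. \<eta> t q (B q) *\<^sub>R \<xi> t q) p)
        = \<eta> t p (B p) * \<eta> s p (lie_bracket \<A> Z (\<xi> t) p) + Z p (\<lambda>q. \<eta> t q (B q)) * \<eta> s p (\<xi> t p)"
      using eta_add[OF assms(1) subspace_scale[OF subspace_tangent Z[OF xi]] subspace_scale[OF subspace_tangent xi_tangent[OF assms(1)]]]
        eta_scale[OF assms(1) Z[OF xi]] eta_scale[OF assms(1) xi_tangent[OF assms(1)]] by simp
    then show "\<eta> s p (lie_bracket \<A> Z (\<lambda>q. \<eta> t q (B q) *\<^sub>R \<xi> t q) p)
        = \<eta> t p (B p) * \<eta> s p (lie_bracket \<A> Z (\<xi> t) p) + (if t = s then Z p (\<lambda>q. \<eta> s q (B q)) else 0)"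
      using eta_xi[OF assms(1), of s t] by auto
  qed simp
  also have "\<dots> = (\<Sum>t\<in>UNIV. \<eta> t p (B p) * \<eta> s p (lie_bracket \<A> Z (\<xi> t) p)) + Z p (\<lambda>q. \<eta> s q (B q))"
    by (simp add: sum.distrib)
  finally show ?thesis by simp
qed

lemma eta_lie_bracket_field_hor:
  assumes "p \<in> U" "field_near p B" "hor p Y"
  shows "\<eta> s p (lie_bracket \<A> B Y p) = 2 * eps s * om s p (hproj \<eta> \<xi> p (B p)) (Y p)
    + (\<Sum>t\<in>UNIV. \<eta> t p (B p) * bt s t Y p) - Y p (\<lambda>q. \<eta> s q (B q))"
proof -
  note Y = hor_field[OF assms(3)]
  have flip: "\<eta> s p (lie_bracket \<A> A A' p) = - \<eta> s p (lie_bracket \<A> A' A p)"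
    if "field_near p A" "field_near p A'" for A A'
    using eta_minus[OF assms(1) tangent_lie_bracket[OF that(2,1)], of s] lie_bracket_antisym[of A A' p] by simp
  have h: "hor p (\<lambda>q. hproj \<eta> \<xi> q (B q))" using assms(1,2) by (rule hor_hproj)
  have "\<eta> s p (lie_bracket \<A> Y (\<lambda>q. hproj \<eta> \<xi> q (B q)) p)
      = - (2 * eps s * om s p (hproj \<eta> \<xi> p (B p)) (Y p))"
    using eta_lie_bracket_hor[OF assms(1,3) h, of s] om_skew[OF assms(1) hor_H[OF h] hor_H[OF assms(3)], of s]
    by (simp add: om_def)
  moreover have "\<eta> s p (lie_bracket \<A> Y (\<xi> t) p) = - bt s t Y p" for t
    unfolding bt_def by (rule flip[OF Y field_near_xi[OF assms(1)]])
  ultimately show ?thesis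
    using flip[OF assms(2) Y] eta_lie_bracket_split[OF assms(1) Y assms(2), of s] by (simp add: sum_negf)
qed

definition theta :: "3 \<Rightarrow> 3 \<Rightarrow> 'm \<Rightarrow> 'm tvec \<Rightarrow> 'm tvec \<Rightarrow> real" where
  "theta i s p x y = om s p (Tor i p x) y + om s p x (Tor i p y)"

text \<open>The Jacobi identity for \<open>\<xi>\<^sub>i\<close>, \<open>X\<close>, \<open>Y\<close>, paired with \<open>\<eta>\<^sub>s\<close>; it is \<open>d(d\<eta>\<^sub>s) = 0\<close> in disguise.\<close>

definition jacobi_defect :: "3 \<Rightarrow> 3 \<Rightarrow> 'm vfield \<Rightarrow> 'm vfield \<Rightarrow> 'm \<Rightarrow> real" where
  "jacobi_defect s i X Y p = bt s i (\<lambda>q. hproj \<eta> \<xi> q (lie_bracket \<A> X Y q)) p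
     - (\<Sum>t\<in>UNIV. bt t i X p * bt s t Y p - bt t i Y p * bt s t X p)
     + Y p (bt s i X) - X p (bt s i Y)"

text \<open>Every term inherits the property from \<open>bt_skew\<close>; for the derivative terms
  this works because that relation holds near \<open>p\<close>. In the quadratic terms each of the
  two factors is flipped once: the factor \<open>eps t\<close> from the first flip is absorbed by
  the second, and the two factors exchange their roles.\<close>

lemma jacobi_defect_skew:
  assumes "p \<in> U" "hor p X" "hor p Y"
  shows "eps s * jacobi_defect s i X Y p = - (eps i * jacobi_defect i s X Y p)"
proof -
  note X = hor_field[OF assms(2)] and Y = hor_field[OF assms(3)]
  have h: "hor p (\<lambda>q. hproj \<eta> \<xi> q (lie_bracket \<A> X Y q))"
    using assms(1) field_near_lie_bracket[OF X Y] by (rule hor_hproj)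
  have sk: "eps s * bt s t Z p = - eps t * bt t s Z p" if "hor p Z" for s t Z
    using bt_skew[OF assms(1) that, of s t] by simp
  have "eps s * (bt t i X p * bt s t Y p - bt t i Y p * bt s t X p)
      = - (eps i * (bt t s X p * bt i t Y p - bt t s Y p * bt i t X p))" for t
  proof -
    have "eps s * (bt t i X p * bt s t Y p - bt t i Y p * bt s t X p)
        = bt t i X p * (eps s * bt s t Y p) - bt t i Y p * (eps s * bt s t X p)" by algebra
    also have "\<dots> = - eps t * (bt t i X p * bt t s Y p - bt t i Y p * bt t s X p)"
      unfolding sk[OF assms(2), of s t] sk[OF assms(3), of s t] by algebra
    also have "\<dots> = - (bt t s X p * (- eps t * bt t i Y p) - bt t s Y p * (- eps t * bt t i X p))" by algebra
    also have "\<dots> = - (eps i * (bt t s X p * bt i t Y p - bt t s Y p * bt i t X p))"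
      unfolding sk[OF assms(2), of i t, symmetric] sk[OF assms(3), of i t, symmetric] by algebra
    finally show ?thesis .
  qed
  then have "eps s * (\<Sum>t\<in>UNIV. bt t i X p * bt s t Y p - bt t i Y p * bt s t X p)
      = - (eps i * (\<Sum>t\<in>UNIV. bt t s X p * bt i t Y p - bt t s Y p * bt i t X p))"
    by (simp add: sum_distrib_left sum_negf)
  then show ?thesis
    using bt_skew[OF assms(1) h, of s i] bt_skew_deriv[OF assms(1,2) field_near_tangent[OF Y], of s i]
      bt_skew_deriv[OF assms(1,3) field_near_tangent[OF X], of s i]
    unfolding jacobi_defect_def by (simp add: algebra_simps)
qed

lemma om_diff:
  assumes "p \<in> U" "x \<in> H p" "y \<in> H p" "z \<in> H p"
  shows "om s p (x - y) z = om s p x z - om s p y z" "om s p z (x - y) = om s p z x - om s p z y"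
  using linear_on_diff[OF linear_om(2)[OF assms(1,4)] subspace_H assms(2,3)]
    linear_on_diff[OF linear_om(1)[OF assms(1,4)] subspace_H assms(2,3)] by auto

text \<open>The horizontal part of \<open>[\<xi>_i, X]\<close> is the covariant derivative of
  \<open>X\<close> minus \<open>Tor i\<close>. In the Jacobi identity the covariant derivatives
  combine with \<open>\<xi>_i(\<omega>_s(X, Y))\<close> into connection forms; what remains besides
  \<open>theta\<close> and the defect is a combination of the \<open>om t\<close> with coefficients
  that do not involve \<open>X\<close> and \<open>Y\<close>.\<close>

lemma theta_jacobi:
  assumes "p \<in> U" "hor p X" "hor p Y"
  shows "2 * eps s * theta i s p (X p) (Y p) = - jacobi_defect s i X Y p
    - (\<Sum>t\<in>UNIV. (2 * eps t * \<eta> s p (lie_bracket \<A> (\<xi> i) (\<xi> t) p) + 2 * eps s * alpha s t p (\<xi> i p))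
        * om t p (X p) (Y p))"
proof -
  note X = hor_field[OF assms(2)] and Y = hor_field[OF assms(3)]
  note xi = field_near_xi[OF assms(1), of i] and xip = xi_tangent[OF assms(1), of i]
  let ?XY = "lie_bracket \<A> X Y" and ?Xi = "lie_bracket \<A> (\<xi> i) X" and ?Yi = "lie_bracket \<A> (\<xi> i) Y"
  have XY: "field_near p ?XY" and Xi: "field_near p ?Xi" and Yi: "field_near p ?Yi"
    using X Y xi by auto
  let ?w = "\<lambda>t. om t p (X p) (Y p)" and ?c = "\<lambda>t. \<eta> s p (lie_bracket \<A> (\<xi> i) (\<xi> t) p)"
  let ?D = "\<xi> i p (\<lambda>q. om s q (X q) (Y q))"
  have ev: "eventually (\<lambda>q. \<eta> s q (?XY q) = 2 * eps s * om s q (X q) (Y q)) (nhds p)"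
    using eventually_U[OF assms(1)] hor_eventually[OF assms(2)] hor_eventually[OF assms(3)]
    unfolding om_def by eventually_elim (rule eta_lie_bracket_hor)
  have D: "\<xi> i p (\<lambda>q. \<eta> s q (?XY q)) = 2 * eps s * ?D"
    using tangent_cong[OF xip ev] tangent_cmult[OF xip smooth_near_om[OF assms]] by simp
  have etaXY: "\<eta> t p (?XY p) = 2 * eps t * ?w t" for t
    using eta_lie_bracket_hor[OF assms, of t] by (simp add: om_def)
  \<comment> \<open>The same quantity is computed twice: in \<open>1\<close> by splitting
    \<open>[X, Y]\<close>, in \<open>2\<close> by the Jacobi identity, whose two terms are split in
    \<open>3\<close> and \<open>4\<close>.\<close>
  have 1: "\<eta> s p (lie_bracket \<A> (\<xi> i) ?XY p) = bt s i (\<lambda>q. hproj \<eta> \<xi> q (?XY q)) p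
      + (\<Sum>t\<in>UNIV. 2 * eps t * ?w t * ?c t) + 2 * eps s * ?D"
    using eta_lie_bracket_split[OF assms(1) xi XY, of s] by (simp only: D etaXY bt_def)
  have sw: "\<eta> s p (lie_bracket \<A> X ?Yi p) = - \<eta> s p (lie_bracket \<A> ?Yi X p)"
    using eta_minus[OF assms(1) tangent_lie_bracket[OF Yi X], of s] lie_bracket_antisym[of X ?Yi p] by simp
  have 2: "\<eta> s p (lie_bracket \<A> (\<xi> i) ?XY p)
      = \<eta> s p (lie_bracket \<A> ?Xi Y p) - \<eta> s p (lie_bracket \<A> ?Yi X p)"
    unfolding jacobi[OF xi X Y] eta_add[OF assms(1) tangent_lie_bracket[OF Xi Y] tangent_lie_bracket[OF X Yi]] sw
    by simp
  let ?hX = "hproj \<eta> \<xi> p (?Xi p)" and ?hY = "hproj \<eta> \<xi> p (?Yi p)"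
  have hX: "?hX \<in> H p" and hY: "?hY \<in> H p"
    using hproj_H[OF assms(1)] field_near_tangent Xi Yi by blast+
  have btf: "(\<lambda>q. \<eta> s q (lie_bracket \<A> (\<xi> i) Z q)) = bt s i Z" for Z
    by (rule ext) (simp only: bt_def)
  have 3: "\<eta> s p (lie_bracket \<A> ?Xi Y p) = 2 * eps s * om s p ?hX (Y p)
      + (\<Sum>t\<in>UNIV. bt t i X p * bt s t Y p) - Y p (bt s i X)"
    using eta_lie_bracket_field_hor[OF assms(1) Xi assms(3), of s] unfolding btf by (simp add: bt_def)
  have 4: "\<eta> s p (lie_bracket \<A> ?Yi X p) = 2 * eps s * om s p ?hY (X p)
      + (\<Sum>t\<in>UNIV. bt t i Y p * bt s t X p) - X p (bt s i Y)"
    using eta_lie_bracket_field_hor[OF assms(1) Yi assms(2), of s] unfolding btf by (simp add: bt_def)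
  have Xp: "X p \<in> H p" and Yp: "Y p \<in> H p" using assms(2,3) by (auto intro: hor_H)
  have nX: "nab p (\<xi> i p) X \<in> H p" and nY: "nab p (\<xi> i p) Y \<in> H p"
    using nab_hor(1)[OF assms(1) xip] assms(2,3) by auto
  have "theta i s p (X p) (Y p) = om s p (nab p (\<xi> i p) X) (Y p) - om s p ?hX (Y p)
      + om s p (X p) (nab p (\<xi> i p) Y) - om s p (X p) ?hY"
    unfolding theta_def Tor_hor[OF assms(1,2)] Tor_hor[OF assms(1,3)]
      om_diff(1)[OF assms(1) nX hX Yp] om_diff(2)[OF assms(1) nY hY Xp] by simp
  also have "\<dots> = ?D - (\<Sum>t\<in>UNIV. alpha s t p (\<xi> i p) * ?w t) - om s p ?hX (Y p) + om s p ?hY (X p)"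
    using nab_om[OF assms(1) xip assms(2,3), of s] om_skew[OF assms(1) hY Xp, of s] by simp
  finally have "2 * eps s * theta i s p (X p) (Y p) = 2 * eps s * ?D
      - 2 * eps s * (\<Sum>t\<in>UNIV. alpha s t p (\<xi> i p) * ?w t) - 2 * eps s * om s p ?hX (Y p)
      + 2 * eps s * om s p ?hY (X p)" by (simp only: right_diff_distrib distrib_left)
  also have "\<dots> = - jacobi_defect s i X Y p - (\<Sum>t\<in>UNIV. 2 * eps t * ?w t * ?c t)
      - 2 * eps s * (\<Sum>t\<in>UNIV. alpha s t p (\<xi> i p) * ?w t)"
    using 1 2 3 4 unfolding jacobi_defect_def by (simp add: sum_subtractf)
  also have "\<dots> = - jacobi_defect s i X Y p
    - (\<Sum>t\<in>UNIV. (2 * eps t * ?c t + 2 * eps s * alpha s t p (\<xi> i p)) * ?w t)"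
    by (simp add: sum_distrib_left sum.distrib algebra_simps)
  finally show ?thesis .
qed

text \<open>After multiplication by the signs, the two defects cancel by
  \<open>jacobi_defect_skew\<close>, and \<open>c\<close> collects the remaining coefficients. For
  \<open>s = i\<close> the coefficient \<open>c i\<close> vanishes because \<open>\<xi> i\<close>
  commutes with itself and \<open>alpha i i\<close> is zero by \<open>alpha_skew\<close>. This one
  coefficient is recorded because orthogonality to \<open>sp(1)\<close> cannot supply it.\<close>

lemma theta_skew_mod_omega:
  assumes "p \<in> U"
  obtains c where "s = i \<Longrightarrow> c i = (0::real)"
    "\<And>x y. x \<in> H p \<Longrightarrow> y \<in> H p \<Longrightarrow> theta i s p x y + theta s i p x y = (\<Sum>t\<in>UNIV. c t * om t p x y)"
proof -
  define K where "K s i t = eps s * eps t * \<eta> s p (lie_bracket \<A> (\<xi> i) (\<xi> t) p) + alpha s t p (\<xi> i p)" for s i t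
  define c where "c t = - (K s i t + K i s t)" for t
  have eta0: "\<eta> s p 0 = 0" for s by (rule linear_on_zero[OF linear_eta[OF assms] subspace_tangent])
  have "alpha i i p (\<xi> i p) = 0"
    using alpha_skew[OF assms xi_tangent[OF assms], of i i i] eps_cases[of i] by auto
  then have "K i i i = 0" by (simp add: K_def eta0)
  then have ci: "s = i \<Longrightarrow> c i = 0" by (simp add: c_def)
  have "theta i s p x y + theta s i p x y = (\<Sum>t\<in>UNIV. c t * om t p x y)" if x: "x \<in> H p" and y: "y \<in> H p" for x y
  proof -
    obtain X where X: "hor p X" "X p = x" using horizontal_extension[OF x] by blast
    obtain Y where Y: "hor p Y" "Y p = y" using horizontal_extension[OF y] by blast
    have th: "2 * theta i s p x y = - (eps s * jacobi_defect s i X Y p) - 2 * (\<Sum>t\<in>UNIV. K s i t * om t p x y)" for s i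
    proof -
      have "2 * theta i s p x y = eps s * (2 * eps s * theta i s p (X p) (Y p))"
        unfolding X(2) Y(2) using eps_mult_self[of s] by algebra
      also have "\<dots> = - (eps s * jacobi_defect s i X Y p) - (\<Sum>t\<in>UNIV. eps s *
          ((2 * eps t * \<eta> s p (lie_bracket \<A> (\<xi> i) (\<xi> t) p) + 2 * eps s * alpha s t p (\<xi> i p)) * om t p x y))"
        unfolding theta_jacobi[OF assms X(1) Y(1)] unfolding X(2) Y(2) by (simp add: right_diff_distrib sum_distrib_left)
      also have "(\<Sum>t\<in>UNIV. eps s *
          ((2 * eps t * \<eta> s p (lie_bracket \<A> (\<xi> i) (\<xi> t) p) + 2 * eps s * alpha s t p (\<xi> i p)) * om t p x y))
          = (\<Sum>t\<in>UNIV. 2 * (K s i t * om t p x y))"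
      proof (rule sum.cong)
        fix t
        show "eps s * ((2 * eps t * \<eta> s p (lie_bracket \<A> (\<xi> i) (\<xi> t) p) + 2 * eps s * alpha s t p (\<xi> i p)) * om t p x y)
            = 2 * (K s i t * om t p x y)"
          unfolding K_def using eps_mult_self[of s] by algebra
      qed simp
      finally show ?thesis by (simp add: sum_distrib_left)
    qed
    have "2 * (theta i s p x y + theta s i p x y)
        = - 2 * ((\<Sum>t\<in>UNIV. K s i t * om t p x y) + (\<Sum>t\<in>UNIV. K i s t * om t p x y))"
      using th[of i s] th[of s i] jacobi_defect_skew[OF assms X(1) Y(1), of s i] by simp
    also have "(\<Sum>t\<in>UNIV. K s i t * om t p x y) + (\<Sum>t\<in>UNIV. K i s t * om t p x y) = - (\<Sum>t\<in>UNIV. c t * om t p x y)"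
      unfolding c_def sum_negf[symmetric] sum.distrib[symmetric] by (intro sum.cong) (auto simp: algebra_simps)
    finally show ?thesis by simp
  qed
  then show ?thesis using that ci by blast
qed

end

section \<open>Linear algebra of the torsion endomorphisms\<close>

lemma cyclic_perms_cases:
  assumes "(i, j, k) \<in> cyclic_perms"
  obtains "i = 1" "j = 2" "k = 3" | "i = 2" "j = 3" "k = 1" | "i = 3" "j = 1" "k = 2"
  using assms unfolding cyclic_perms_def by auto

lemma eps_simps [simp]: "eps 1 = 1" "eps 2 = 1" "eps 3 = - 1"
  by (simp_all add: eps_def)

lemma sum_cyclic: "(i, j, k) \<in> cyclic_perms \<Longrightarrow> sum f UNIV = f i + f j + (f k :: real)"
  by (erule cyclic_perms_cases) (simp_all add: sum_3)

text \<open>One fibre of the horizontal bundle with its torsion endomorphisms. The properties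
  special to the canonical connection enter through the last three assumptions: orthogonality to
  \<open>sp(n)\<close>, orthogonality to \<open>sp(1)\<close>, and the consequence of the Jacobi
  identity.\<close>

locale pqc_algebra =
  fixes S :: "'a::real_vector set" and b :: "'a \<Rightarrow> 'a \<Rightarrow> real" and J T :: "3 \<Rightarrow> 'a \<Rightarrow> 'a"
    and n :: nat and e :: "nat \<Rightarrow> 'a"
  assumes S: "subspace S"
    and lin_b: "\<And>x. x \<in> S \<Longrightarrow> linear_on S (b x)"
    and b_sym: "\<And>x y. x \<in> S \<Longrightarrow> y \<in> S \<Longrightarrow> b x y = b y x"
    and lin_J: "\<And>s. linear_on S (J s)" and J_S [simp]: "\<And>s x. x \<in> S \<Longrightarrow> J s x \<in> S"
    and J_J: "\<And>s x. x \<in> S \<Longrightarrow> J s (J s x) = eps s *\<^sub>R x"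
    and J_cyclic: "\<And>i j k x. (i, j, k) \<in> cyclic_perms \<Longrightarrow> x \<in> S \<Longrightarrow>
        J i (J j x) = - (eps k *\<^sub>R J k x) \<and> J j (J i x) = eps k *\<^sub>R J k x"
    and b_J_left: "\<And>s x y. x \<in> S \<Longrightarrow> y \<in> S \<Longrightarrow> b (J s x) y = - b x (J s y)"
    and basis: "orthonormal_basis S b (4 * n) e" and n: "n \<noteq> 0"
    and lin_T: "\<And>i. linear_on S (T i)" and T_S [simp]: "\<And>i x. x \<in> S \<Longrightarrow> T i x \<in> S"
    and perp_spn: "\<And>i B. linear_on S B \<Longrightarrow> (\<And>x. x \<in> S \<Longrightarrow> B x \<in> S) \<Longrightarrow>
        (\<And>x y. x \<in> S \<Longrightarrow> y \<in> S \<Longrightarrow> b (B x) y = - b x (B y)) \<Longrightarrow>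
        (\<And>s x. x \<in> S \<Longrightarrow> B (J s x) = J s (B x)) \<Longrightarrow>
        g_trace b (4 * n) e (\<lambda>x y. b (T i x) (B y)) = 0"
    and perp_sp1: "\<And>i s. g_trace b (4 * n) e (\<lambda>x y. b (T i x) (J s y)) = 0"
    and T_mod_omega: "\<And>i s. \<exists>c. (s = i \<longrightarrow> c i = 0) \<and> (\<forall>x\<in>S. \<forall>y\<in>S.
        (b (J s (T i x)) y + b (J s x) (T i y)) + (b (J i (T s x)) y + b (J i x) (T s y))
          = (\<Sum>t\<in>UNIV. c t * b (J t x) y))"
begin

abbreviation tr :: "('a \<Rightarrow> 'a \<Rightarrow> real) \<Rightarrow> real" where "tr \<equiv> g_trace b (4 * n) e"

lemma lin_b_left: "y \<in> S \<Longrightarrow> linear_on S (\<lambda>x. b x y)"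
  using lin_b b_sym subspace_add[OF S] subspace_scale[OF S] unfolding linear_on_def by simp

lemma closed [simp]:
  "x \<in> S \<Longrightarrow> y \<in> S \<Longrightarrow> x + y \<in> S" "x \<in> S \<Longrightarrow> y \<in> S \<Longrightarrow> x - y \<in> S"
  "x \<in> S \<Longrightarrow> - x \<in> S" "x \<in> S \<Longrightarrow> c *\<^sub>R x \<in> S"
  using subspace_add[OF S] subspace_diff[OF S] subspace_neg[OF S] subspace_scale[OF S] by auto

lemma b_left [simp]:
  "x \<in> S \<Longrightarrow> y \<in> S \<Longrightarrow> z \<in> S \<Longrightarrow> b (x + y) z = b x z + b y z"
  "x \<in> S \<Longrightarrow> y \<in> S \<Longrightarrow> z \<in> S \<Longrightarrow> b (x - y) z = b x z - b y z"
  "x \<in> S \<Longrightarrow> z \<in> S \<Longrightarrow> b (- x) z = - b x z"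
  "x \<in> S \<Longrightarrow> z \<in> S \<Longrightarrow> b (c *\<^sub>R x) z = c * b x z"
  using linear_on_add[OF lin_b_left] linear_on_diff[OF lin_b_left S] linear_on_uminus[OF lin_b_left]
    linear_on_scale[OF lin_b_left] by auto

lemma b_right [simp]:
  "x \<in> S \<Longrightarrow> y \<in> S \<Longrightarrow> z \<in> S \<Longrightarrow> b z (x + y) = b z x + b z y"
  "x \<in> S \<Longrightarrow> y \<in> S \<Longrightarrow> z \<in> S \<Longrightarrow> b z (x - y) = b z x - b z y"
  "x \<in> S \<Longrightarrow> z \<in> S \<Longrightarrow> b z (- x) = - b z x"
  "x \<in> S \<Longrightarrow> z \<in> S \<Longrightarrow> b z (c *\<^sub>R x) = c * b z x"
  using linear_on_add[OF lin_b] linear_on_diff[OF lin_b S] linear_on_uminus[OF lin_b]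
    linear_on_scale[OF lin_b] by auto

lemma J_lin [simp]:
  "x \<in> S \<Longrightarrow> y \<in> S \<Longrightarrow> J s (x + y) = J s x + J s y"
  "x \<in> S \<Longrightarrow> y \<in> S \<Longrightarrow> J s (x - y) = J s x - J s y"
  "x \<in> S \<Longrightarrow> J s (- x) = - J s x" "x \<in> S \<Longrightarrow> J s (c *\<^sub>R x) = c *\<^sub>R J s x"
  using linear_on_add[OF lin_J] linear_on_diff[OF lin_J S] linear_on_uminus[OF lin_J] linear_on_scale[OF lin_J] by auto

lemma T_lin [simp]:
  "x \<in> S \<Longrightarrow> y \<in> S \<Longrightarrow> T s (x + y) = T s x + T s y"
  "x \<in> S \<Longrightarrow> T s (- x) = - T s x" "x \<in> S \<Longrightarrow> T s (c *\<^sub>R x) = c *\<^sub>R T s x"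
  using linear_on_add[OF lin_T] linear_on_uminus[OF lin_T] linear_on_scale[OF lin_T] by auto

lemma e_S [simp]: "a < 4 * n \<Longrightarrow> e a \<in> S"
  using basis by (simp add: orthonormal_basis_def)

lemma J_table [simp]:
  assumes "x \<in> S"
  shows "J 1 (J 1 x) = x" "J 2 (J 2 x) = x" "J 3 (J 3 x) = - x"
    "J 1 (J 2 x) = J 3 x" "J 2 (J 1 x) = - J 3 x" "J 2 (J 3 x) = - J 1 x"
    "J 3 (J 2 x) = J 1 x" "J 3 (J 1 x) = - J 2 x" "J 1 (J 3 x) = J 2 x"
  using J_J[OF assms, of 1] J_J[OF assms, of 2] J_J[OF assms, of 3]
    J_cyclic[of 1 2 3 x] J_cyclic[of 2 3 1 x] J_cyclic[of 3 1 2 x] assms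
  by (simp_all add: cyclic_perms_def)

lemma J_prod:
  assumes "s \<noteq> t"
  obtains c u where "\<And>x. x \<in> S \<Longrightarrow> J s (J t x) = c *\<^sub>R J u x"
proof -
  have "\<exists>c u. \<forall>x\<in>S. J s (J t x) = c *\<^sub>R J u x"
  proof (cases "\<exists>k. (s, t, k) \<in> cyclic_perms")
    case True
    then obtain k where "(s, t, k) \<in> cyclic_perms" by blast
    then have "\<forall>x\<in>S. J s (J t x) = (- eps k) *\<^sub>R J k x" using J_cyclic by simp
    then show ?thesis by blast
  next
    case False
    then have "\<exists>k. (t, s, k) \<in> cyclic_perms"
      using assms exhaust_3[of s] exhaust_3[of t] unfolding cyclic_perms_def by auto
    then obtain k where "(t, s, k) \<in> cyclic_perms" by blast
    then have "\<forall>x\<in>S. J s (J t x) = eps k *\<^sub>R J k x" using J_cyclic by blast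
    then show ?thesis by blast
  qed
  then show ?thesis using that by blast
qed

lemma tr_cong: "(\<And>u. u \<in> S \<Longrightarrow> P u u = Q u u) \<Longrightarrow> tr P = tr Q"
  unfolding g_trace_def by (intro sum.cong) auto

lemma tr_add: "tr (\<lambda>u v. P u v + Q u v) = tr P + tr Q"
  and tr_diff: "tr (\<lambda>u v. P u v - Q u v) = tr P - tr Q"
  and tr_minus: "tr (\<lambda>u v. - P u v) = - tr P"
  and tr_cmult: "tr (\<lambda>u v. c * P u v) = c * tr P"
  unfolding g_trace_def by (simp_all add: distrib_left right_diff_distrib sum.distrib sum_subtractf sum_negf
    sum_distrib_left mult.left_commute)

lemma tr_sum: "tr (\<lambda>u v. \<Sum>s\<in>F. P s u v) = (\<Sum>s\<in>F. tr (P s))"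
  unfolding g_trace_def sum_distrib_left by (rule sum.swap)

text \<open>This is the orthonormal expansion of \<open>x\<close> with \<open>l\<close> applied to
  it; the signs of the basis vectors are those in the trace.\<close>

lemma tr_contract:
  assumes "linear_on S l" "x \<in> S"
  shows "tr (\<lambda>u v. b x u * l v) = l x"
proof -
  have "l x = l (\<Sum>a<4 * n. (b (e a) (e a) * b x (e a)) *\<^sub>R e a)"
    using orthonormal_expansion[OF basis lin_b_left assms(2)] by (rule arg_cong)
  also have "\<dots> = (\<Sum>a<4 * n. l ((b (e a) (e a) * b x (e a)) *\<^sub>R e a))"
    by (rule linear_on_sum[OF assms(1) S]) simp
  also have "\<dots> = (\<Sum>a<4 * n. b (e a) (e a) * (b x (e a) * l (e a)))"
    by (intro sum.cong) (simp_all add: linear_on_scale[OF assms(1)] mult.assoc)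
  finally show ?thesis by (simp add: g_trace_def)
qed

lemma linear_on_comp: "linear_on S l \<Longrightarrow> linear_on S (\<lambda>x. l (J s x))"
  unfolding linear_on_def using J_S by simp

text \<open>The adjoint of \<open>J s\<close> is \<open>- J s\<close>. To use this inside the trace
  of a bilinear form, \<open>J s u\<close> is expanded by a second trace and the two sums are
  exchanged.\<close>

lemma tr_J_swap:
  assumes P: "\<And>y. y \<in> S \<Longrightarrow> linear_on S (\<lambda>x. P x y)" "\<And>x. x \<in> S \<Longrightarrow> linear_on S (P x)"
  shows "tr (\<lambda>u v. P (J s u) v) = - tr (\<lambda>u v. P u (J s v))"
proof -
  have "tr (\<lambda>u v. P (J s u) v) = tr (\<lambda>u v. tr (\<lambda>w z. b (J s u) w * P z v))"
    using tr_contract[OF P(1)] by (intro tr_cong) simp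
  also have "\<dots> = tr (\<lambda>w z. tr (\<lambda>u v. b (J s u) w * P z v))"
    unfolding g_trace_def sum_distrib_left
    by (subst sum.swap) (simp add: mult.left_commute)
  also have "\<dots> = tr (\<lambda>w z. - P z (J s w))"
  proof (rule tr_cong)
    fix w assume w: "w \<in> S"
    have "tr (\<lambda>u v. b (J s u) w * P w v) = tr (\<lambda>u v. - (b (J s w) u * P w v))"
      using w by (intro tr_cong) (simp add: b_J_left b_sym[of _ "J s w"])
    also have "\<dots> = - P w (J s w)"
      unfolding tr_minus using tr_contract[OF P(2)[OF w], of "J s w"] w by simp
    finally show "tr (\<lambda>u v. b (J s u) w * P w v) = - P w (J s w)" .
  qed
  also have "\<dots> = - tr (\<lambda>u v. P u (J s v))" unfolding tr_minus by (simp add: g_trace_def)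
  finally show ?thesis .
qed

section \<open>Traces and antisymmetry of the forms \<open>th\<close>\<close>

definition w :: "3 \<Rightarrow> 'a \<Rightarrow> 'a \<Rightarrow> real" where "w s x y = b (J s x) y"

definition t :: "3 \<Rightarrow> 'a \<Rightarrow> 'a \<Rightarrow> real" where "t i x y = b (T i x) y"

definition th :: "3 \<Rightarrow> 3 \<Rightarrow> 'a \<Rightarrow> 'a \<Rightarrow> real" where
  "th i s x y = w s (T i x) y + w s x (T i y)"

lemma w_skew: "x \<in> S \<Longrightarrow> y \<in> S \<Longrightarrow> w s x y = - w s y x"
  unfolding w_def using b_J_left[of x y s] b_sym[of x "J s y"] by simp

lemma th_t: "x \<in> S \<Longrightarrow> y \<in> S \<Longrightarrow> th i s x y = t i y (J s x) - t i x (J s y)"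
  unfolding th_def t_def w_def using b_J_left[of "T i x" y s] b_sym[of "J s x" "T i y"] by simp

lemma th_skew: "x \<in> S \<Longrightarrow> y \<in> S \<Longrightarrow> th i s x y = - th i s y x"
  by (simp add: th_t)

lemma lin_t: "x \<in> S \<Longrightarrow> linear_on S (t s x)" "y \<in> S \<Longrightarrow> linear_on S (\<lambda>x. t s x y)"
  unfolding linear_on_def t_def by simp_all

lemma lin_th: "x \<in> S \<Longrightarrow> linear_on S (th i s x)"
  unfolding linear_on_def th_def w_def by (simp add: algebra_simps)

text \<open>For \<open>s = j\<close> each of the \<open>4 * n\<close> basis vectors contributes
  \<open>- eps j\<close>, whatever its sign. For \<open>s \<noteq> j\<close> the product of the two
  structures is a multiple of a single \<open>J u\<close>, which is skew and so vanishes on the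
  diagonal.\<close>

lemma tr_w: "tr (\<lambda>u v. w s u (J j v)) = (if s = j then - (4 * real n * eps j) else 0)"
proof (cases "s = j")
  case True
  have "b (e a) (e a) * w s (e a) (J j (e a)) = - eps j" if "a < 4 * n" for a
  proof -
    have "b (e a) (e a) = 1 \<or> b (e a) (e a) = - 1"
      using basis that unfolding orthonormal_basis_def by blast
    moreover have "w s (e a) (J j (e a)) = - eps j * b (e a) (e a)"
      using that True by (simp add: w_def b_J_left J_J)
    ultimately show ?thesis by auto
  qed
  then show ?thesis using True by (simp add: g_trace_def)
next
  case False
  obtain c u where c: "\<And>x. x \<in> S \<Longrightarrow> J s (J j x) = c *\<^sub>R J u x" using J_prod[OF False] by blast
  have "tr (\<lambda>u v. w s u (J j v)) = tr (\<lambda>u v. 0)"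
  proof (rule tr_cong)
    fix x assume x: "x \<in> S"
    have "b x (J u x) = 0" using b_J_left[OF x x, of u] b_sym[OF x, of "J u x"] x by simp
    then show "w s x (J j x) = 0" using x c by (simp add: w_def b_J_left)
  qed
  then show ?thesis using False by (simp add: g_trace_def)
qed

lemma tr_th: "tr (\<lambda>u v. th i s u (J j v)) = - 2 * tr (\<lambda>u v. t i u (J s (J j v)))"
proof -
  have "tr (\<lambda>u v. th i s u (J j v)) = tr (\<lambda>u v. t i (J j u) (J s v) - t i u (J s (J j v)))"
    by (intro tr_cong) (simp add: th_t)
  also have "\<dots> = tr (\<lambda>u v. t i (J j u) (J s v)) - tr (\<lambda>u v. t i u (J s (J j v)))" by (rule tr_diff)
  also have "tr (\<lambda>u v. t i (J j u) (J s v)) = - tr (\<lambda>u v. t i u (J s (J j v)))"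
    by (rule tr_J_swap[of "\<lambda>u v. t i u (J s v)"]) (simp_all add: lin_t linear_on_comp)
  finally show ?thesis by simp
qed

text \<open>The trace of \<open>th i s\<close> against \<open>J j\<close> pairs \<open>T i\<close>
  with \<open>J s\<close> composed with \<open>J j\<close>; for \<open>s \<noteq> j\<close> this
  composition lies in \<open>sp(1)\<close>.\<close>

lemma tr_th_neq:
  assumes "s \<noteq> j"
  shows "tr (\<lambda>u v. th i s u (J j v)) = 0"
proof -
  obtain c r where c: "\<And>x. x \<in> S \<Longrightarrow> J s (J j x) = c *\<^sub>R J r x" using J_prod[OF assms] by blast
  have "tr (\<lambda>u v. t i u (J s (J j v))) = tr (\<lambda>u v. c * b (T i u) (J r v))"
    by (intro tr_cong) (simp add: c t_def)
  then show ?thesis using perp_sp1[of i r] unfolding tr_th tr_cmult by simp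
qed

lemma tr_th_eq: "tr (\<lambda>u v. th i s u (J s v)) = - 2 * eps s * tr (t i)"
proof -
  have "tr (\<lambda>u v. t i u (J s (J s v))) = tr (\<lambda>u v. eps s * t i u v)"
    by (intro tr_cong) (simp add: J_J t_def)
  then show ?thesis unfolding tr_th tr_cmult by simp
qed

lemma th_sum_omega: "\<exists>c. (s = i \<longrightarrow> c i = 0) \<and>
    (\<forall>x\<in>S. \<forall>y\<in>S. th i s x y + th s i x y = (\<Sum>t\<in>UNIV. c t * w t x y))"
  using T_mod_omega[of s i] unfolding th_def w_def .

text \<open>By \<open>tr_w\<close> the forms \<open>w t\<close> are orthogonal for the trace
  pairing, so tracing against \<open>J j\<close> isolates the coefficient
  \<open>c j\<close>.\<close>

lemma th_sum_coeff:
  assumes "\<And>x y. x \<in> S \<Longrightarrow> y \<in> S \<Longrightarrow> th i s x y + th s i x y = (\<Sum>t\<in>UNIV. c t * w t x y)"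
  shows "tr (\<lambda>u v. th i s u (J j v)) + tr (\<lambda>u v. th s i u (J j v)) = - (4 * real n * eps j) * c j"
proof -
  have "tr (\<lambda>u v. th i s u (J j v)) + tr (\<lambda>u v. th s i u (J j v)) = tr (\<lambda>u v. \<Sum>t\<in>UNIV. c t * w t u (J j v))"
    unfolding tr_add[symmetric] using assms by (intro tr_cong) simp
  also have "\<dots> = (\<Sum>t\<in>UNIV. if t = j then - (4 * real n * eps j) * c j else 0)"
    unfolding tr_sum tr_cmult tr_w by (intro sum.cong) auto
  finally show ?thesis by simp
qed

text \<open>The coefficients away from \<open>i\<close> vanish by orthogonality to
  \<open>sp(1)\<close>. The one at \<open>i\<close> would require the trace of \<open>T i\<close>;
  it is zero by the clause of \<open>T_mod_omega\<close> for \<open>s = i\<close>.\<close>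

lemma th_self: "x \<in> S \<Longrightarrow> y \<in> S \<Longrightarrow> th i i x y = 0"
proof -
  assume x: "x \<in> S" and y: "y \<in> S"
  obtain c where "i = i \<longrightarrow> c i = 0" "\<forall>x\<in>S. \<forall>y\<in>S. th i i x y + th i i x y = (\<Sum>t\<in>UNIV. c t * w t x y)"
    using th_sum_omega[of i i] by (elim exE conjE) (rule that)
  note c = this(1) this(2)[rule_format]
  have "c j = 0" for j
  proof (cases "j = i")
    case False
    then show ?thesis using th_sum_coeff[OF c(2), of j] tr_th_neq[of i j i] n eps_cases[of j] by auto
  qed (use c(1) in simp)
  then show ?thesis using c(2)[OF x y] by simp
qed

text \<open>The trace of \<open>T i\<close> is recovered from \<open>th i i\<close>, which has just
  been shown to vanish; \<open>perp_sp1\<close> alone does not see it.\<close>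

lemma tr_t: "tr (t i) = 0"
proof -
  have "tr (\<lambda>u v. th i i u (J i v)) = tr (\<lambda>u v. 0)" by (intro tr_cong) (simp add: th_self)
  then have "eps i * tr (t i) = 0" using tr_th_eq[of i i] by (simp add: g_trace_def)
  then show ?thesis using eps_cases[of i] by auto
qed

lemma tr_th_zero: "tr (\<lambda>u v. th i s u (J j v)) = 0"
  using tr_th_neq[of s j i] tr_th_eq[of i j] tr_t[of i] by (cases "s = j") auto

text \<open>With \<open>tr_t\<close> available all traces of \<open>th\<close> against the
  \<open>J j\<close> vanish, so no coefficient of \<open>w j\<close> is left.\<close>

lemma th_antisym:
  assumes "x \<in> S" "y \<in> S"
  shows "th i s x y + th s i x y = 0"
proof -
  obtain c where "s = i \<longrightarrow> c i = 0" "\<forall>x\<in>S. \<forall>y\<in>S. th i s x y + th s i x y = (\<Sum>t\<in>UNIV. c t * w t x y)"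
    using th_sum_omega[of s i] by (elim exE conjE) (rule that)
  note c = this(2)[rule_format]
  have "c j = 0" for j
    using th_sum_coeff[OF c, of j] tr_th_zero n eps_cases[of j] by auto
  then show ?thesis using c[OF assms] by simp
qed

text \<open>Testing against \<open>D + \<Sum>\<^sub>s \<epsilon>\<^sub>s J\<^sub>s D J\<^sub>s\<close>, the projection to \<open>sp(n)\<close> of the elementary skew
  endomorphism \<open>D = x \<and> y\<close>, shows that the skew part of \<open>T\<^sub>i\<close> has no \<open>sp(n)\<close> component.\<close>

lemma skew_part:
  assumes x: "x \<in> S" and y: "y \<in> S"
  shows "t i x y - t i y x = (\<Sum>s\<in>UNIV. eps s * (t i (J s x) (J s y) - t i (J s y) (J s x)))"
proof -
  define D where "D z = b x z *\<^sub>R y - b y z *\<^sub>R x" for z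
  define B where "B z = D z + (J 1 (D (J 1 z)) + J 2 (D (J 2 z)) - J 3 (D (J 3 z)))" for z
  have D [simp]: "D z \<in> S" "D (z + z') = D z + D z'" "D (- z) = - D z" "D (c *\<^sub>R z) = c *\<^sub>R D z"
    if "z \<in> S" "z' \<in> S" for z z' c
    using that x y unfolding D_def by (simp_all add: algebra_simps)
  have D_skew: "b (D z) z' = - b z (D z')" if "z \<in> S" "z' \<in> S" for z z'
    using that x y b_sym[of z x] b_sym[of z y] unfolding D_def by simp
  have D_J_skew: "b (J s (D (J s z))) z' = - b z (J s (D (J s z')))" if "z \<in> S" "z' \<in> S" for s z z'
    using that by (simp add: b_J_left D_skew)
  have lin: "linear_on S B"
    unfolding linear_on_def B_def by (simp add: algebra_simps)
  have BS: "B z \<in> S" if "z \<in> S" for z using that unfolding B_def by simp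
  have skew: "b (B z) z' = - b z (B z')" if "z \<in> S" "z' \<in> S" for z z'
    using that unfolding B_def by (simp add: D_skew D_J_skew)
  have comm: "B (J s z) = J s (B z)" if z: "z \<in> S" for s z
    using exhaust_3[of s] z unfolding B_def by (auto simp: algebra_simps)
  have trD: "tr (\<lambda>u v. l u * b x v) = l x" "tr (\<lambda>u v. l u * b y v) = l y"
      "tr (\<lambda>u v. l u * b (J s x) v) = l (J s x)" "tr (\<lambda>u v. l u * b (J s y) v) = l (J s y)"
    if "linear_on S l" for l s
    using tr_contract[OF that] x y by (simp_all add: g_trace_def mult.commute)
  have tD: "tr (\<lambda>u v. t i u (D v)) = t i x y - t i y x"
  proof -
    have "tr (\<lambda>u v. t i u (D v)) = tr (\<lambda>u v. t i u y * b x v - t i u x * b y v)"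
      using x y by (intro tr_cong) (simp add: D_def t_def)
    then show ?thesis unfolding tr_diff using trD(1)[OF lin_t(2)[OF y]] trD(2)[OF lin_t(2)[OF x]] by simp
  qed
  \<comment> \<open>The minus sign comes from moving the inner \<open>J s\<close> off
    \<open>v\<close> and onto the vectors \<open>x\<close> and \<open>y\<close> that define
    \<open>D\<close>.\<close>
  have tJ: "tr (\<lambda>u v. t i u (J s (D (J s v)))) = - (t i (J s x) (J s y) - t i (J s y) (J s x))" for s
  proof -
    have "tr (\<lambda>u v. t i u (J s (D (J s v)))) = tr (\<lambda>u v. - (t i u (J s y) * b (J s x) v - t i u (J s x) * b (J s y) v))"
      using x y b_J_left[of x _ s] b_J_left[of y _ s] by (intro tr_cong) (simp add: D_def t_def)
    then show ?thesis unfolding tr_minus tr_diff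
      using trD(3)[OF lin_t(2)[of "J s y" i], of s] trD(4)[OF lin_t(2)[of "J s x" i], of s] x y by simp
  qed
  have "0 = tr (\<lambda>u v. b (T i u) (B v))"
    using perp_spn[OF lin BS skew comm] by simp
  also have "\<dots> = tr (\<lambda>u v. t i u (D v) + (t i u (J 1 (D (J 1 v))) + t i u (J 2 (D (J 2 v))) - t i u (J 3 (D (J 3 v)))))"
    by (intro tr_cong) (simp add: B_def t_def)
  finally show ?thesis unfolding tr_add tr_diff tD tJ by (simp add: sum_3)
qed

section \<open>The tensors \<open>mu\<close> and \<open>tau\<close> expressed through
  \<open>th\<close>\<close>

definition mu :: "3 \<Rightarrow> 'a \<Rightarrow> 'a \<Rightarrow> real" where
  "mu s x y = eps s * (t s (J s x) y - t s y (J s x)) / 2"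

definition tau :: "'a \<Rightarrow> 'a \<Rightarrow> real" where
  "tau x y = - (\<Sum>s\<in>UNIV. eps s * ((t s (J s x) y + t s y (J s x)) / 2))"

lemma mu_t: "2 * mu s x y = eps s * (t s (J s x) y - t s y (J s x))"
  by (simp add: mu_def)

lemma tau_t: "2 * tau x y = - (t 1 (J 1 x) y + t 1 y (J 1 x)) - (t 2 (J 2 x) y + t 2 y (J 2 x))
    + (t 3 (J 3 x) y + t 3 y (J 3 x))"
  unfolding tau_def sum_3 by (simp add: field_simps)

lemma t_minus [simp]: "x \<in> S \<Longrightarrow> y \<in> S \<Longrightarrow> t i (- x) y = - t i x y" "x \<in> S \<Longrightarrow> y \<in> S \<Longrightarrow> t i x (- y) = - t i x y"
  by (simp_all add: t_def)

text \<open>The remaining identities are consequences of instances of \<open>th_antisym\<close> and \<open>skew_part\<close>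
  at \<open>(J\<^sub>a x, J\<^sub>b y)\<close>; the instances were found by Gaussian elimination.\<close>

lemma t_self: "x \<in> S \<Longrightarrow> y \<in> S \<Longrightarrow> t i y (J i x) = t i x (J i y)"
  using th_self[of x y i] by (simp add: th_t)

lemma t_antisym:
  "x \<in> S \<Longrightarrow> y \<in> S \<Longrightarrow> t i y (J s x) - t i x (J s y) + (t s y (J i x) - t s x (J i y)) = 0"
  using th_antisym[of x y i s] by (simp add: th_t)

text \<open>Both sides involve \<open>T i\<close> only, so the vanishing of \<open>th i i\<close>
  (as \<open>t_self\<close>) and one instance of \<open>skew_part\<close>, both for this index,
  suffice.\<close>

lemma th_mu:
  assumes "(i, j, k) \<in> cyclic_perms" and [simp]: "x \<in> S" "y \<in> S"
  shows "th i j x (J k y) - eps k * th i j (J i x) (J j y) = - 4 * mu i x y"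
proof -
  note [simp] = sum_3
  note M = mu_t[of 1 x y, simplified] mu_t[of 2 x y, simplified] mu_t[of 3 x y, simplified]
  note R = t_self[of x y] t_self[of "J 1 x" "J 1 y"] t_self[of "J 2 x" "J 2 y"] t_self[of "J 3 x" "J 3 y"]
  from assms(1) show ?thesis
  proof (cases rule: cyclic_perms_cases)
    case 1
    have "th 1 2 x (J 3 y) + th 1 2 (J 1 x) (J 2 y) = - 4 * mu 1 x y"
      using R[of 1, simplified] skew_part[of "J 3 x" "J 2 y" 1, simplified]
        th_t[of x "J 3 y" 1 2, simplified] th_t[of "J 1 x" "J 2 y" 1 2, simplified]
      using M by linarith
    then show ?thesis using 1 by simp
  next
    case 2
    have "th 2 3 x (J 1 y) - th 2 3 (J 2 x) (J 3 y) = - 4 * mu 2 x y"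
      using R[of 2, simplified] skew_part[of "J 2 x" y 2, simplified]
        th_t[of x "J 1 y" 2 3, simplified] th_t[of "J 2 x" "J 3 y" 2 3, simplified]
      using M by linarith
    then show ?thesis using 2 by simp
  next
    case 3
    have "th 3 1 x (J 2 y) - th 3 1 (J 3 x) (J 1 y) = - 4 * mu 3 x y"
      using R[of 3, simplified] skew_part[of x "J 3 y" 3, simplified]
        th_t[of x "J 2 y" 3 1, simplified] th_t[of "J 3 x" "J 1 y" 3 1, simplified]
      using M by linarith
    then show ?thesis using 3 by simp
  qed
qed

text \<open>The failure of \<open>J i\<close> to be skew for \<open>th i k\<close>; it appears when
  \<open>T i\<close> applied to the four-form is traced against \<open>J j\<close>, because the
  product of \<open>J j\<close> and \<open>J k\<close> is a multiple of \<open>J i\<close>.\<close>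

definition phi :: "3 \<Rightarrow> 3 \<Rightarrow> 'a \<Rightarrow> 'a \<Rightarrow> real" where
  "phi i k x y = th i k (J i x) y + th i k x (J i y)"

lemma phi_t:
  "x \<in> S \<Longrightarrow> y \<in> S \<Longrightarrow> phi i k x y =
    t i y (J k (J i x)) - t i (J i x) (J k y) + (t i (J i y) (J k x) - t i x (J k (J i y)))"
  by (simp add: phi_def th_t)

text \<open>The two signs behave differently. The sum cancels identically by the multiplication
  table of the \<open>J s\<close>, while the difference is a multiple of \<open>mu\<close> thanks to
  \<open>t_self\<close> and \<open>skew_part\<close>.\<close>

lemma phi_mu:
  assumes "(i, j, k) \<in> cyclic_perms" and [simp]: "x \<in> S" "y \<in> S"
  shows "phi i k x (J k y) - eps k * phi i k (J i x) (J j y) = 8 * eps j * mu i x y"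
    and "phi i k x (J k y) + eps k * phi i k (J i x) (J j y) = 0"
proof -
  note [simp] = sum_3
  note M = mu_t[of 1 x y, simplified] mu_t[of 2 x y, simplified] mu_t[of 3 x y, simplified]
  note R = t_self[of x y] t_self[of "J 1 x" "J 1 y"] t_self[of "J 2 x" "J 2 y"] t_self[of "J 3 x" "J 3 y"]
  note ph = phi_t[of x "J 3 y" 1 3, simplified] phi_t[of "J 1 x" "J 2 y" 1 3, simplified]
    phi_t[of x "J 1 y" 2 1, simplified] phi_t[of "J 2 x" "J 3 y" 2 1, simplified]
    phi_t[of x "J 2 y" 3 2, simplified] phi_t[of "J 3 x" "J 1 y" 3 2, simplified]
  from assms(1) show "phi i k x (J k y) - eps k * phi i k (J i x) (J j y) = 8 * eps j * mu i x y"
  proof (cases rule: cyclic_perms_cases)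
    case 1
    have "phi 1 3 x (J 3 y) + phi 1 3 (J 1 x) (J 2 y) = 8 * mu 1 x y"
      using R[of 1, simplified] skew_part[of x "J 1 y" 1, simplified] ph(1,2) using M by linarith
    then show ?thesis using 1 by simp
  next
    case 2
    have "phi 2 1 x (J 1 y) - phi 2 1 (J 2 x) (J 3 y) = - 8 * mu 2 x y"
      using R[of 2, simplified] skew_part[of "J 1 x" "J 3 y" 2, simplified] ph(3,4) using M by linarith
    then show ?thesis using 2 by simp
  next
    case 3
    have "phi 3 2 x (J 2 y) - phi 3 2 (J 3 x) (J 1 y) = 8 * mu 3 x y"
      using R[of 3, simplified] skew_part[of "J 1 x" "J 2 y" 3, simplified] ph(5,6) using M by linarith
    then show ?thesis using 3 by simp
  qed
  from assms(1) show "phi i k x (J k y) + eps k * phi i k (J i x) (J j y) = 0"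
    by (cases rule: cyclic_perms_cases) (simp_all add: phi_t)
qed

text \<open>Here two different torsion endomorphisms are compared, and only \<open>t_antisym\<close>
  links them; this is what makes \<open>mu\<close> independent of its index.\<close>

lemma mu_cyclic:
  assumes [simp]: "x \<in> S" "y \<in> S"
  shows "mu 1 x y = mu 2 x y" "mu 2 x y = mu 3 x y"
proof -
  note [simp] = sum_3
  note M = mu_t[of 1 x y, simplified] mu_t[of 2 x y, simplified] mu_t[of 3 x y, simplified]
  note R = t_self[of x y] t_self[of "J 1 x" "J 1 y"] t_self[of "J 2 x" "J 2 y"] t_self[of "J 3 x" "J 3 y"]
  show "mu 1 x y = mu 2 x y"
    using R(1)[of 1, simplified] R(1)[of 2, simplified] R(3)[of 2, simplified] R(2)[of 1, simplified] skew_part[of x "J 2 y" 2, simplified]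
      skew_part[of "J 2 x" "J 3 y" 1, simplified] t_antisym[of "J 2 x" "J 1 y" 1 2, simplified]
      t_antisym[of x "J 3 y" 1 2, simplified] t_antisym[of "J 3 x" y 1 2, simplified]
      t_antisym[of "J 1 x" "J 2 y" 1 2, simplified]
    using M by linarith
  show "mu 2 x y = mu 3 x y"
    using R(3)[of 2, simplified] R(2)[of 2, simplified] R(2)[of 3, simplified] R(4)[of 3, simplified] skew_part[of x "J 2 y" 2, simplified]
      skew_part[of "J 3 x" y 3, simplified] t_antisym[of "J 1 x" y 2 3, simplified]
      t_antisym[of "J 3 x" "J 2 y" 2 3, simplified] t_antisym[of x "J 1 y" 2 3, simplified]
      t_antisym[of "J 2 x" "J 3 y" 2 3, simplified]
    using M by linarith
qed

lemma mu_indep: "x \<in> S \<Longrightarrow> y \<in> S \<Longrightarrow> mu s x y = mu i x y"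
  using mu_cyclic[of x y] exhaust_3[of s] exhaust_3[of i] by auto

lemma sum_cyclic_perms: "(\<Sum>(i, j, k)\<in>cyclic_perms. f i j k) = f 1 2 3 + f 2 3 1 + (f 3 1 2 :: real)"
  unfolding cyclic_perms_def by simp

text \<open>Each cyclic term yields the symmetric part of \<open>t i (J i x) y\<close>, with the
  sign \<open>eps i\<close>, and two mixed terms. The six mixed terms pair up under
  \<open>t_antisym\<close>, and the results cancel in the cyclic sum.\<close>

lemma th_tau:
  assumes [simp]: "x \<in> S" "y \<in> S"
  shows "(\<Sum>(i, j, k)\<in>cyclic_perms. th i j x (J k y) + eps k * th i j (J i x) (J j y)) = - 2 * tau x y"
proof -
  note [simp] = sum_3
  show ?thesis
    using t_self[of x y 1, simplified] t_self[of x y 2, simplified] t_self[of x y 3, simplified]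
      t_antisym[of x "J 2 y" 1 3, simplified] t_antisym[of x "J 3 y" 1 2, simplified]
      t_antisym[of x "J 1 y" 2 3, simplified]
      th_t[of x "J 3 y" 1 2, simplified] th_t[of "J 1 x" "J 2 y" 1 2, simplified]
      th_t[of x "J 1 y" 2 3, simplified] th_t[of "J 2 x" "J 3 y" 2 3, simplified]
      th_t[of x "J 2 y" 3 1, simplified] th_t[of "J 3 x" "J 1 y" 3 1, simplified]
    tau_t[of x y]
    unfolding sum_cyclic_perms eps_simps by linarith
qed

section \<open>The four-form on a fibre and the trace of its torsion derivative\<close>

definition W4 :: "'a \<Rightarrow> 'a \<Rightarrow> 'a \<Rightarrow> 'a \<Rightarrow> real" where
  "W4 x y u v = - 2 * (\<Sum>s\<in>UNIV. eps s * (w s x y * w s u v - w s x u * w s y v + w s x v * w s y u))"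

text \<open>The derivation action of \<open>T i\<close> on the four-form. The slot on which
  \<open>T i\<close> acts is moved to the front, hence the alternating signs.\<close>

definition dW :: "3 \<Rightarrow> 'a \<Rightarrow> 'a \<Rightarrow> 'a \<Rightarrow> 'a \<Rightarrow> real" where
  "dW i x y u v = W4 (T i x) y u v - W4 (T i y) x u v + W4 (T i u) x y v - W4 (T i v) x y u"

text \<open>A derivation acts on each square of \<open>w s\<close> by the product rule, so the
  result is \<open>- 2\<close> times the sum of \<open>eps s\<close> times the wedge product of
  \<open>th i s\<close> and \<open>w s\<close>; the six terms are the shuffles of that
  product.\<close>

lemma dW_th:
  assumes [simp]: "x \<in> S" "y \<in> S" "u \<in> S" "v \<in> S"
  shows "dW i x y u v = - 2 * (\<Sum>s\<in>UNIV. eps s * (th i s x y * w s u v - th i s x u * w s y v + th i s x v * w s y u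
    + th i s u v * w s x y - th i s y v * w s x u + th i s y u * w s x v))"
proof -
  have th: "th i s z z' = w s (T i z) z' - w s (T i z') z" if "z \<in> S" "z' \<in> S" for s z z'
    unfolding th_def w_skew[OF that(1) T_S[OF that(2)]] by (rule add_uminus_conv_diff)
  have sum4: "- 2 * sum f UNIV - - 2 * sum f' UNIV + - 2 * sum g UNIV - - 2 * sum g' UNIV
      = - 2 * (\<Sum>s\<in>UNIV. f s - f' s + g s - g' s)" for f f' g g' :: "3 \<Rightarrow> real"
    by (simp add: sum_3)
  have "eps s * (w s (T i x) y * w s u v - w s (T i x) u * w s y v + w s (T i x) v * w s y u)
      - eps s * (w s (T i y) x * w s u v - w s (T i y) u * w s x v + w s (T i y) v * w s x u)
      + eps s * (w s (T i u) x * w s y v - w s (T i u) y * w s x v + w s (T i u) v * w s x y)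
      - eps s * (w s (T i v) x * w s y u - w s (T i v) y * w s x u + w s (T i v) u * w s x y)
      = eps s * (th i s x y * w s u v - th i s x u * w s y v + th i s x v * w s y u
        + th i s u v * w s x y - th i s y v * w s x u + th i s y u * w s x v)" for s
    unfolding th[OF assms(1,2)] th[OF assms(1,3)] th[OF assms(1,4)] th[OF assms(3,4)] th[OF assms(2,4)]
      th[OF assms(2,3)] by algebra
  then show ?thesis unfolding dW_def W4_def sum4 by (simp only:)
qed

lemma tr_th_w:
  assumes [simp]: "x \<in> S" "y \<in> S"
  shows "tr (\<lambda>u v. th i s x u * w s y (J j v)) = - th i s x (J j (J s y))"
    and "tr (\<lambda>u v. th i s x (J j v) * w s y u) = th i s x (J j (J s y))"
proof -
  have "tr (\<lambda>u v. th i s x u * w s y (J j v)) = tr (\<lambda>u v. - (b (J j (J s y)) u * th i s x v))"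
    using b_J_left[of "J s y" _ j] by (intro tr_cong) (simp add: w_def)
  then show "tr (\<lambda>u v. th i s x u * w s y (J j v)) = - th i s x (J j (J s y))"
    unfolding tr_minus using tr_contract[OF lin_th[of x i s], of "J j (J s y)"] by simp
  have "tr (\<lambda>u v. th i s x (J j v) * w s y u) = tr (\<lambda>u v. b (J s y) u * th i s x (J j v))"
    by (intro tr_cong) (simp add: w_def)
  then show "tr (\<lambda>u v. th i s x (J j v) * w s y u) = th i s x (J j (J s y))"
    using tr_contract[OF linear_on_comp[OF lin_th[of x i s], of j], of "J s y"] by simp
qed

text \<open>The trace of \<open>w s\<close> contributes only for \<open>s = j\<close> and gives
  \<open>8 * real n\<close>. The four terms with one traced vector in each factor give
  \<open>- 8\<close> for \<open>s = j\<close> and the \<open>phi\<close> term for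
  \<open>s = k\<close>; for \<open>s = i\<close> they vanish by \<open>th_self\<close>. The terms
  with both traced vectors in \<open>th\<close> vanish by \<open>tr_th_zero\<close>.\<close>

lemma tr_dW:
  assumes c: "(i, j, k) \<in> cyclic_perms" and [simp]: "x \<in> S" "y \<in> S"
  shows "tr (\<lambda>u v. dW i x y u (J j v)) = 8 * (real n - 1) * th i j x y - 4 * eps j * phi i k x y"
proof -
  have "tr (\<lambda>u v. dW i x y u (J j v)) = tr (\<lambda>u v. - 2 * (\<Sum>s\<in>UNIV. eps s *
      (th i s x y * w s u (J j v) - th i s x u * w s y (J j v) + th i s x (J j v) * w s y u
      + w s x y * th i s u (J j v) - th i s y (J j v) * w s x u + th i s y u * w s x (J j v))))"
    by (intro tr_cong) (simp add: dW_th mult.commute[of "w _ x y"])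
  also have "\<dots> = - 2 * (\<Sum>s\<in>UNIV. eps s * (th i s x y * (if s = j then - (4 * real n * eps j) else 0)
      + 2 * th i s x (J j (J s y)) - 2 * th i s y (J j (J s x))))"
    unfolding tr_cmult tr_sum tr_add tr_diff tr_w tr_th_zero tr_th_w[OF assms(2,3)] tr_th_w[OF assms(3,2)]
    by (simp add: algebra_simps)
  also have "\<dots> = 8 * (real n - 1) * th i j x y - 4 * eps j * phi i k x y"
    unfolding sum_cyclic[OF c]
    using c th_self[of x _ i] th_self[of y _ i] th_skew[of y x i j] th_skew[of y "J i x" i k]
    by (cases rule: cyclic_perms_cases) (auto simp: phi_def linear_on_uminus[OF lin_th] algebra_simps)
  finally show ?thesis .
qed

text \<open>The \<open>th\<close> part contributes \<open>- 32 * (real n - 1)\<close> times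
  \<open>mu\<close> and the \<open>phi\<close> part another \<open>- 32\<close>, which together
  replace \<open>real n - 1\<close> by \<open>real n\<close>.\<close>

theorem mu_formula:
  assumes c: "(i, j, k) \<in> cyclic_perms" and [simp]: "x \<in> S" "y \<in> S"
  shows "mu s x y = - (1 / (32 * real n)) * (tr (\<lambda>u v. dW i x (J k y) u (J j v))
    - eps k * tr (\<lambda>u v. dW i (J i x) (J j y) u (J j v)))"
proof -
  have "tr (\<lambda>u v. dW i x (J k y) u (J j v)) - eps k * tr (\<lambda>u v. dW i (J i x) (J j y) u (J j v))
      = 8 * (real n - 1) * (th i j x (J k y) - eps k * th i j (J i x) (J j y))
        - 4 * eps j * (phi i k x (J k y) - eps k * phi i k (J i x) (J j y))"
    unfolding tr_dW[OF c assms(2) J_S[OF assms(3)]] tr_dW[OF c J_S[OF assms(2)] J_S[OF assms(3)]] by algebra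
  also have "\<dots> = - 32 * real n * mu i x y"
    unfolding th_mu[OF assms] phi_mu(1)[OF assms] using eps_mult_self[of j] by algebra
  finally show ?thesis using n mu_indep[of x y s i] by simp
qed

text \<open>In the sum of the two traces the \<open>phi\<close> parts cancel, so the factor
  \<open>real n - 1\<close> of the \<open>th\<close> part survives; dividing by it excludes
  dimension seven.\<close>

theorem tau_formula:
  assumes "n \<noteq> 1" and [simp]: "x \<in> S" "y \<in> S"
  shows "tau x y = 1 / (16 * (1 - real n)) * (\<Sum>(i, j, k)\<in>cyclic_perms.
    tr (\<lambda>u v. dW i x (J k y) u (J j v)) + eps k * tr (\<lambda>u v. dW i (J i x) (J j y) u (J j v)))"
proof -
  have "(\<Sum>(i, j, k)\<in>cyclic_perms.
      tr (\<lambda>u v. dW i x (J k y) u (J j v)) + eps k * tr (\<lambda>u v. dW i (J i x) (J j y) u (J j v)))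
    = (\<Sum>(i, j, k)\<in>cyclic_perms. 8 * (real n - 1) * (th i j x (J k y) + eps k * th i j (J i x) (J j y)))"
  proof (rule sum.cong, simp, clarify)
    fix i j k assume c: "(i, j, k) \<in> cyclic_perms"
    have "tr (\<lambda>u v. dW i x (J k y) u (J j v)) + eps k * tr (\<lambda>u v. dW i (J i x) (J j y) u (J j v))
        = 8 * (real n - 1) * (th i j x (J k y) + eps k * th i j (J i x) (J j y))
          - 4 * eps j * (phi i k x (J k y) + eps k * phi i k (J i x) (J j y))"
      unfolding tr_dW[OF c assms(2) J_S[OF assms(3)]] tr_dW[OF c J_S[OF assms(2)] J_S[OF assms(3)]] by algebra
    then show "tr (\<lambda>u v. dW i x (J k y) u (J j v)) + eps k * tr (\<lambda>u v. dW i (J i x) (J j y) u (J j v))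
        = 8 * (real n - 1) * (th i j x (J k y) + eps k * th i j (J i x) (J j y))"
      unfolding phi_mu(2)[OF c assms(2,3)] by simp
  qed
  also have "\<dots> = 8 * (real n - 1) * (\<Sum>(i, j, k)\<in>cyclic_perms. th i j x (J k y) + eps k * th i j (J i x) (J j y))"
    unfolding sum_cyclic_perms by (simp only: distrib_left)
  also have "\<dots> = 16 * (1 - real n) * tau x y"
    unfolding th_tau[OF assms(2,3)] by algebra
  finally show ?thesis using assms(1) by simp
qed

end

section \<open>The exterior derivative of the fundamental form\<close>

lemma eq_diff_swap: "t = d - h \<Longrightarrow> h = d - t" for d h t :: "'a::ab_group_add"
  by simp

text \<open>A permutation is factored by the image of \<open>0\<close>, then of \<open>1\<close>,
  then of \<open>2\<close>, which writes the 24 terms out as products of transpositions with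
  computable sign.\<close>

lemma sum_permutes_4:
  fixes f :: "(nat \<Rightarrow> nat) \<Rightarrow> real"
  shows "sum f {\<sigma>. \<sigma> permutes {..<4}} =
    (\<Sum>a\<in>{0,1,2,3}. \<Sum>b\<in>{1,2,3}. \<Sum>c\<in>{2,3}. f (Transposition.transpose 0 a \<circ> (Transposition.transpose 1 b \<circ> Transposition.transpose 2 c)))"
proof -
  have 4: "{..<4} = {0, 1, 2, 3::nat}" by auto
  have 1: "{\<sigma>. \<sigma> permutes {3::nat}} = {id}" by auto
  have 2: "sum f {\<sigma>. \<sigma> permutes {2, 3::nat}} = (\<Sum>c\<in>{2, 3}. f (Transposition.transpose 2 c))"
    for f :: "(nat \<Rightarrow> nat) \<Rightarrow> real"
    by (subst sum_over_permutations_insert) (simp_all only: 1, simp_all)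
  have 3: "sum f {\<sigma>. \<sigma> permutes {1, 2, 3::nat}}
      = (\<Sum>b\<in>{1, 2, 3}. \<Sum>c\<in>{2, 3}. f (Transposition.transpose 1 b \<circ> Transposition.transpose 2 c))"
    for f :: "(nat \<Rightarrow> nat) \<Rightarrow> real"
    by (subst sum_over_permutations_insert) (simp_all only: 2, simp_all)
  have "sum f {\<sigma>. \<sigma> permutes {0, 1, 2, 3::nat}} = (\<Sum>a\<in>{0, 1, 2, 3}. \<Sum>q\<in>{q. q permutes {1, 2, 3}}.
      f (Transposition.transpose 0 a \<circ> q))"
    by (rule sum_over_permutations_insert) simp_all
  then show ?thesis unfolding 4 3 .
qed

text \<open>The 24 permutations fall into the three splittings of the arguments into pairs, each
  occurring 8 times with consistent sign. Division by \<open>fact 2 * fact 2\<close> leaves the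
  factor 2.\<close>

lemma wedge_two_forms:
  assumes "\<And>a b. a \<in> set [x, y, u, v] \<Longrightarrow> b \<in> set [x, y, u, v] \<Longrightarrow> \<alpha> p [a, b] = - \<alpha> p [b, a]"
  shows "wedge 2 2 \<alpha> \<alpha> p [x, y, u, v]
    = 2 * (\<alpha> p [x, y] * \<alpha> p [u, v] - \<alpha> p [x, u] * \<alpha> p [y, v] + \<alpha> p [x, v] * \<alpha> p [y, u])"
proof -
  have sk: "\<alpha> p [y, x] = - \<alpha> p [x, y]" "\<alpha> p [u, x] = - \<alpha> p [x, u]" "\<alpha> p [v, x] = - \<alpha> p [x, v]"
    "\<alpha> p [u, y] = - \<alpha> p [y, u]" "\<alpha> p [v, y] = - \<alpha> p [y, v]" "\<alpha> p [v, u] = - \<alpha> p [u, v]"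
    by (rule assms; simp)+
  have l: "[0..<2] = [0, 1]" "[2..<4] = [2, 3]" by (simp_all add: upt_rec)
  have p: "permutation (Transposition.transpose a b)" for a b :: nat by (rule permutation_swap_id)
  have s: "sign (Transposition.transpose a b \<circ> (Transposition.transpose c d \<circ> Transposition.transpose e f)) =
      sign (Transposition.transpose a b) * (sign (Transposition.transpose c d) * sign (Transposition.transpose e f))" for a b c d e f :: nat
    by (simp only: sign_compose p permutation_compose)
  show ?thesis
    unfolding wedge_def
    by (simp add: l sum_permutes_4 s sign_swap_id Transposition.transpose_def sk fact_numeral)
qed

lemma drop_nth_simps:
  "drop_nth 0 (x # xs) = xs" "drop_nth (Suc i) (x # xs) = x # drop_nth i xs"
  by (simp_all add: drop_nth_def)

lemma ext_deriv_5:
  fixes \<A> :: "('m::topological_space, 'e::euclidean_space) chart set" and p :: 'm and v :: "nat \<Rightarrow> 'm tvec"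
  defines "A i \<equiv> extend \<A> p (v i)"
  shows "ext_deriv \<A> \<omega> p [v 0, v 1, v 2, v 3, v 4] =
      v 0 (\<lambda>q. \<omega> q [A 1 q, A 2 q, A 3 q, A 4 q]) - v 1 (\<lambda>q. \<omega> q [A 0 q, A 2 q, A 3 q, A 4 q])
    + v 2 (\<lambda>q. \<omega> q [A 0 q, A 1 q, A 3 q, A 4 q]) - v 3 (\<lambda>q. \<omega> q [A 0 q, A 1 q, A 2 q, A 4 q])
    + v 4 (\<lambda>q. \<omega> q [A 0 q, A 1 q, A 2 q, A 3 q])
    - \<omega> p [lie_bracket \<A> (A 0) (A 1) p, v 2, v 3, v 4] + \<omega> p [lie_bracket \<A> (A 0) (A 2) p, v 1, v 3, v 4]
    - \<omega> p [lie_bracket \<A> (A 0) (A 3) p, v 1, v 2, v 4] + \<omega> p [lie_bracket \<A> (A 0) (A 4) p, v 1, v 2, v 3]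
    - \<omega> p [lie_bracket \<A> (A 1) (A 2) p, v 0, v 3, v 4] + \<omega> p [lie_bracket \<A> (A 1) (A 3) p, v 0, v 2, v 4]
    - \<omega> p [lie_bracket \<A> (A 1) (A 4) p, v 0, v 2, v 3] - \<omega> p [lie_bracket \<A> (A 2) (A 3) p, v 0, v 1, v 4]
    + \<omega> p [lie_bracket \<A> (A 2) (A 4) p, v 0, v 1, v 3] - \<omega> p [lie_bracket \<A> (A 3) (A 4) p, v 0, v 1, v 2]"
  unfolding ext_deriv_def Let_def A_def
  by (simp add: eval_nat_numeral drop_nth_simps)

text \<open>The hypothesis says that \<open>a\<close> is an infinitesimal isometry of the form with
  diagonal entries \<open>eps s\<close>, so the \<open>eps\<close>-weighted contraction is invariant
  under it. This invariance is the reason for \<open>\<nabla>\<Omega> = 0\<close>.\<close>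

lemma eps_contract_skew:
  assumes "\<And>s t. eps t * a s t = - (eps s * a t s)"
  shows "(\<Sum>s\<in>UNIV. eps s * (((\<Sum>t\<in>UNIV. a s t * F t) + F' s) * G s + F s * ((\<Sum>t\<in>UNIV. a s t * G t) + G' s)))
    = (\<Sum>s\<in>UNIV. eps s * (F' s * G s + F s * G' s))"
proof -
  have "a 1 1 = 0" "a 2 2 = 0" "a 3 3 = 0" "a 2 1 = - a 1 2" "a 3 1 = a 1 3" "a 3 2 = a 2 3"
    using assms[of 1 1] assms[of 2 2] assms[of 3 3] assms[of 1 2] assms[of 1 3] assms[of 2 3] by simp_all
  then show ?thesis by (simp add: sum_3 algebra_simps)
qed

context pqc_data
begin

section \<open>Covariant constancy of the four-form and its exterior derivative\<close>

definition om4 :: "'m \<Rightarrow> 'm tvec \<Rightarrow> 'm tvec \<Rightarrow> 'm tvec \<Rightarrow> 'm tvec \<Rightarrow> real" where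
  "om4 p x y u v = - 2 * (\<Sum>s\<in>UNIV. eps s *
     (om s p x y * om s p u v - om s p x u * om s p y v + om s p x v * om s p y u))"

lemma fundamental_form_om4:
  assumes "p \<in> U" "x \<in> tangent_space \<A> p" "y \<in> tangent_space \<A> p" "u \<in> tangent_space \<A> p" "v \<in> tangent_space \<A> p"
  shows "fundamental_form g \<eta> I \<xi> p [x, y, u, v] =
    om4 p (hproj \<eta> \<xi> p x) (hproj \<eta> \<xi> p y) (hproj \<eta> \<xi> p u) (hproj \<eta> \<xi> p v)"
proof -
  have o: "omega g \<eta> I \<xi> s p [a, b] = om s p (hproj \<eta> \<xi> p a) (hproj \<eta> \<xi> p b)" for s a b
    by (simp add: omega_def om_def)
  have "omega g \<eta> I \<xi> s p [a, b] = - omega g \<eta> I \<xi> s p [b, a]"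
    if "a \<in> set [x, y, u, v]" "b \<in> set [x, y, u, v]" for s a b
    unfolding o using that assms by (intro om_skew hproj_H) auto
  then have w: "wedge 2 2 (omega g \<eta> I \<xi> s) (omega g \<eta> I \<xi> s) p [x, y, u, v] = 2 *
    (omega g \<eta> I \<xi> s p [x, y] * omega g \<eta> I \<xi> s p [u, v] - omega g \<eta> I \<xi> s p [x, u] * omega g \<eta> I \<xi> s p [y, v]
      + omega g \<eta> I \<xi> s p [x, v] * omega g \<eta> I \<xi> s p [y, u])" for s
    by (rule wedge_two_forms)
  show ?thesis unfolding fundamental_form_def w o om4_def by (simp add: sum_3)
qed

text \<open>The connection forms that appear when single \<open>om s\<close> are differentiated are
  skew by \<open>alpha_skew\<close> and cancel in the sum weighted by \<open>eps s\<close>;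
  \<open>F'\<close> denotes what is left of each derivative.\<close>

lemma nab_om4:
  assumes "p \<in> U" "v \<in> tangent_space \<A> p" "hor p X" "hor p Y" "hor p Z" "hor p W"
  shows "v (\<lambda>q. om4 q (X q) (Y q) (Z q) (W q)) = om4 p (nab p v X) (Y p) (Z p) (W p)
    + om4 p (X p) (nab p v Y) (Z p) (W p) + om4 p (X p) (Y p) (nab p v Z) (W p) + om4 p (X p) (Y p) (Z p) (nab p v W)"
proof -
  define F where "F A B s = om s p (A p) (B p)" for A B s
  define F' where "F' A B s = om s p (nab p v A) (B p) + om s p (A p) (nab p v B)" for A B s
  have sm: "smooth_near \<A> p (\<lambda>q. om s q (A q) (B q))" if "hor p A" "hor p B" for A B s
    using assms(1) that by (rule smooth_near_om)
  have dF: "v (\<lambda>q. om s q (A q) (B q)) = (\<Sum>t\<in>UNIV. alpha s t p v * F A B t) + F' A B s"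
    if "hor p A" "hor p B" for A B s
    unfolding F_def F'_def using nab_om[OF assms(1,2) that] by simp
  have Q: "v (\<lambda>q. \<Sum>s\<in>UNIV. eps s * (om s q (A q) (B q) * om s q (A' q) (B' q)))
      = (\<Sum>s\<in>UNIV. eps s * (F' A B s * F A' B' s + F A B s * F' A' B' s))"
    and smQ: "smooth_near \<A> p (\<lambda>q. \<Sum>s\<in>UNIV. eps s * (om s q (A q) (B q) * om s q (A' q) (B' q)))"
    if h: "hor p A" "hor p B" "hor p A'" "hor p B'" for A B A' B'
  proof -
    have sp: "smooth_near \<A> p (\<lambda>q. om s q (A q) (B q) * om s q (A' q) (B' q))" for s
      using sm h by (intro smooth_near_mult)
    have se: "smooth_near \<A> p (\<lambda>q. eps s * (om s q (A q) (B q) * om s q (A' q) (B' q)))" for s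
      by (intro smooth_near_mult[OF smooth_near_const] sp)
    then show "smooth_near \<A> p (\<lambda>q. \<Sum>s\<in>UNIV. eps s * (om s q (A q) (B q) * om s q (A' q) (B' q)))"
      by (intro smooth_near_sum)
    have "v (\<lambda>q. \<Sum>s\<in>UNIV. eps s * (om s q (A q) (B q) * om s q (A' q) (B' q)))
        = (\<Sum>s\<in>UNIV. eps s * (((\<Sum>t\<in>UNIV. alpha s t p v * F A B t) + F' A B s) * F A' B' s
          + F A B s * ((\<Sum>t\<in>UNIV. alpha s t p v * F A' B' t) + F' A' B' s)))"
      unfolding tangent_sum[OF assms(2) finite se] tangent_cmult[OF assms(2) sp]
        tangent_mult[OF assms(2) sm[OF h(1,2)] sm[OF h(3,4)]] dF[OF h(1,2)] dF[OF h(3,4)]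
      by (simp add: F_def mult.commute add.commute)
    also have "\<dots> = (\<Sum>s\<in>UNIV. eps s * (F' A B s * F A' B' s + F A B s * F' A' B' s))"
      by (rule eps_contract_skew) (rule alpha_skew[OF assms(1,2)])
    finally show "v (\<lambda>q. \<Sum>s\<in>UNIV. eps s * (om s q (A q) (B q) * om s q (A' q) (B' q)))
      = (\<Sum>s\<in>UNIV. eps s * (F' A B s * F A' B' s + F A B s * F' A' B' s))" .
  qed
  let ?q = "\<lambda>A B A' B' q. \<Sum>s\<in>UNIV. eps s * (om s q (A q) (B q) * om s q (A' q) (B' q))"
  have "(\<lambda>q. om4 q (X q) (Y q) (Z q) (W q)) = (\<lambda>q. - 2 * ((?q X Y Z W q - ?q X Z Y W q) + ?q X W Y Z q))"
    by (rule ext) (simp add: om4_def sum_3 algebra_simps)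
  then have "v (\<lambda>q. om4 q (X q) (Y q) (Z q) (W q)) = v (\<lambda>q. - 2 * ((?q X Y Z W q - ?q X Z Y W q) + ?q X W Y Z q))"
    by (rule arg_cong)
  also have "\<dots> = - 2 * ((v (?q X Y Z W) - v (?q X Z Y W)) + v (?q X W Y Z))"
    using smQ assms(3-6) by (simp only: tangent_cmult[OF assms(2)] tangent_add[OF assms(2)] tangent_diff[OF assms(2)]
      smooth_near_add smooth_near_diff)
  also have "\<dots> = om4 p (nab p v X) (Y p) (Z p) (W p)
    + om4 p (X p) (nab p v Y) (Z p) (W p) + om4 p (X p) (Y p) (nab p v Z) (W p) + om4 p (X p) (Y p) (Z p) (nab p v W)"
    unfolding Q[OF assms(3,4,5,6)] Q[OF assms(3,5,4,6)] Q[OF assms(3,6,4,5)]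
    unfolding F_def F'_def om4_def sum_3 by algebra
  finally show ?thesis .
qed

lemma om4_alternating:
  assumes "p \<in> U" "x \<in> H p" "y \<in> H p" "u \<in> H p" "v \<in> H p"
  shows "om4 p y x u v = - om4 p x y u v" "om4 p y u x v = om4 p x y u v" "om4 p y u v x = - om4 p x y u v"
proof -
  have sk: "om s p y x = - om s p x y" "om s p u x = - om s p x u" "om s p v x = - om s p x v"
    "om s p u y = - om s p y u" "om s p v y = - om s p y v" "om s p v u = - om s p u v" for s
    using assms by (auto intro: om_skew)
  show "om4 p y x u v = - om4 p x y u v" "om4 p y u x v = om4 p x y u v" "om4 p y u v x = - om4 p x y u v"
    unfolding om4_def sk sum_3 by algebra+
qed

lemma om4_diff:
  assumes "p \<in> U" "x \<in> H p" "x' \<in> H p" "y \<in> H p" "u \<in> H p" "v \<in> H p"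
  shows "om4 p (x - x') y u v = om4 p x y u v - om4 p x' y u v"
  unfolding om4_def om_diff(1)[OF assms(1-4)] om_diff(1)[OF assms(1-3,5)] om_diff(1)[OF assms(1-3,6)] sum_3 by algebra

lemma om4_zero:
  assumes "p \<in> U" "y \<in> H p" "u \<in> H p" "v \<in> H p"
  shows "om4 p 0 y u v = 0" "om4 p y 0 u v = 0"
proof -
  have "om4 p (0 - 0) y u v = om4 p 0 y u v - om4 p 0 y u v"
    by (rule om4_diff[OF assms(1) subspace_0[OF subspace_H] subspace_0[OF subspace_H] assms(2-4)])
  then show "om4 p 0 y u v = 0" by (simp only: diff_self)
  then show "om4 p y 0 u v = 0"
    using om4_alternating(1)[OF assms(1) subspace_0[OF subspace_H] assms(2-4)] by simp
qed

lemma deriv_fundamental_form: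
  assumes p: "p \<in> U" and v: "v \<in> tangent_space \<A> p"
    and f: "field_near p A" "field_near p B" "field_near p C" "field_near p D"
  defines "h \<equiv> \<lambda>A q. hproj \<eta> \<xi> q (A q)"
  shows "v (\<lambda>q. fundamental_form g \<eta> I \<xi> q [A q, B q, C q, D q]) = om4 p (nab p v (h A)) (h B p) (h C p) (h D p)
    + om4 p (h A p) (nab p v (h B)) (h C p) (h D p) + om4 p (h A p) (h B p) (nab p v (h C)) (h D p)
    + om4 p (h A p) (h B p) (h C p) (nab p v (h D))"
proof -
  have "eventually (\<lambda>q. fundamental_form g \<eta> I \<xi> q [A q, B q, C q, D q] = om4 q (h A q) (h B q) (h C q) (h D q)) (nhds p)"
    using eventually_U[OF p] field_near_eventually[OF f(1)] field_near_eventually[OF f(2)]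
      field_near_eventually[OF f(3)] field_near_eventually[OF f(4)]
    unfolding h_def by eventually_elim (intro fundamental_form_om4 field_near_tangent)
  from tangent_cong[OF v this]
  have "v (\<lambda>q. fundamental_form g \<eta> I \<xi> q [A q, B q, C q, D q]) = v (\<lambda>q. om4 q (h A q) (h B q) (h C q) (h D q))" .
  also have "\<dots> = om4 p (nab p v (h A)) (h B p) (h C p) (h D p)
    + om4 p (h A p) (nab p v (h B)) (h C p) (h D p) + om4 p (h A p) (h B p) (nab p v (h C)) (h D p)
    + om4 p (h A p) (h B p) (h C p) (nab p v (h D))"
    using f unfolding h_def by (intro nab_om4[OF p v] hor_hproj[OF p])
  finally show ?thesis .
qed

text \<open>As \<open>\<nabla>\<Omega> = 0\<close> and \<open>\<Omega>\<close> annihilates vertical vectors, only the torsion terms that contain \<open>\<xi>\<^sub>i\<close> survive.\<close>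

lemma d_fundamental_form:
  assumes p: "p \<in> U" and x: "x1 \<in> H p" "x2 \<in> H p" "x3 \<in> H p" "x4 \<in> H p"
  shows "ext_deriv \<A> (fundamental_form g \<eta> I \<xi>) p [\<xi> i p, x1, x2, x3, x4] =
    om4 p (Tor i p x1) x2 x3 x4 - om4 p (Tor i p x2) x1 x3 x4
    + om4 p (Tor i p x3) x1 x2 x4 - om4 p (Tor i p x4) x1 x2 x3"
proof -
  define v where "v k = (if k = 0 then \<xi> i p else if k = 1 then x1 else if k = 2 then x2 else if k = 3 then x3 else x4)"
    for k :: nat
  define A where "A k = extend \<A> p (v k)" for k
  \<comment> \<open>The extension of \<open>\<xi> i p\<close> need not be vertical away from
    \<open>p\<close>. Its horizontal part \<open>hA 0\<close> vanishes at \<open>p\<close>, but the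
    derivatives \<open>D k 0\<close> may not; they cancel against the same terms in the brackets
    with \<open>A 0\<close>.\<close>
  define hA where "hA k = (\<lambda>q. hproj \<eta> \<xi> q (A k q))" for k
  define D where "D k l = nab p (v k) (hA l)" for k l
  have v: "v 0 = \<xi> i p" "v 1 = x1" "v 2 = x2" "v 3 = x3" "v 4 = x4" by (simp_all add: v_def)
  have vt: "v k \<in> tangent_space \<A> p" for k
    unfolding v_def using xi_tangent[OF p] H_tangent x by simp
  have A: "field_near p (A k)" "A k p = v k" for k
    unfolding A_def using extend_near[OF p vt] by auto
  have h: "hor p (hA k)" for k unfolding hA_def using p A(1) by (rule hor_hproj)
  have hp: "hA 0 p = 0" "hA 1 p = x1" "hA 2 p = x2" "hA 3 p = x3" "hA 4 p = x4"
    unfolding hA_def A(2) v using hproj_xi[OF p] hproj_id[OF p] x by auto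
  have D: "D k l \<in> H p" for k l unfolding D_def by (rule nab_hor(1)[OF p vt h])
  have T: "Tor i p x \<in> H p" if x: "x \<in> H p" for x
  proof -
    obtain X where X: "hor p X" "X p = x" using horizontal_extension[OF x] by blast
    have "Tor i p (X p) \<in> H p"
      unfolding Tor_hor[OF p X(1)]
      by (intro subspace_diff[OF subspace_H] nab_hor(1)[OF p xi_tangent[OF p] X(1)]
        hproj_H[OF p tangent_lie_bracket[OF field_near_xi[OF p] hor_field[OF X(1)]]])
    then show ?thesis unfolding X(2) .
  qed
  \<comment> \<open>The torsion at \<open>p\<close> is defined through the same extensions
    \<open>A 0\<close> and \<open>A k\<close> as the exterior derivative, so unfolding it and
    solving for the bracket suffices.\<close>
  have br: "hproj \<eta> \<xi> p (lie_bracket \<A> (A 0) (A k) p) = (D 0 k - D k 0) - Tor i p (v k)" for k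
  proof -
    note lin = linear_on_diff[OF linear_hproj[OF p] subspace_tangent]
    have t: "nab p (v 0) (A k) \<in> tangent_space \<A> p" "nab p (v k) (A 0) \<in> tangent_space \<A> p"
      "lie_bracket \<A> (A 0) (A k) p \<in> tangent_space \<A> p"
      using nab_tangent[OF A(1) vt] tangent_lie_bracket[OF A(1) A(1)] by auto
    have "Tor i p (v k) = hproj \<eta> \<xi> p (nab p (v 0) (A k) - nab p (v k) (A 0) - lie_bracket \<A> (A 0) (A k) p)"
      unfolding Tor_def torsion_def v(1)[symmetric] A_def ..
    also have "\<dots> = (D 0 k - D k 0) - hproj \<eta> \<xi> p (lie_bracket \<A> (A 0) (A k) p)"
      unfolding lin[OF subspace_diff[OF subspace_tangent t(1,2)] t(3)] lin[OF t(1,2)] D_def hA_def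
        hproj_nab[OF p vt A(1)] ..
    finally show ?thesis by (rule eq_diff_swap)
  qed
  have om_br: "fundamental_form g \<eta> I \<xi> p [lie_bracket \<A> (A k) (A l) p, y, z, u]
      = om4 p (hproj \<eta> \<xi> p (lie_bracket \<A> (A k) (A l) p)) (hproj \<eta> \<xi> p y) (hproj \<eta> \<xi> p z) (hproj \<eta> \<xi> p u)"
    if "y \<in> tangent_space \<A> p" "z \<in> tangent_space \<A> p" "u \<in> tangent_space \<A> p" for k l y z u
    using that by (intro fundamental_form_om4 p tangent_lie_bracket A(1))
  have br0: "fundamental_form g \<eta> I \<xi> p [lie_bracket \<A> (A 0) (A k) p, y, z, u]
      = om4 p (D 0 k) y z u - om4 p (D k 0) y z u - om4 p (Tor i p (v k)) y z u"
    if "y \<in> H p" "z \<in> H p" "u \<in> H p" "v k \<in> H p" for k y z u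
    unfolding om_br[OF H_tangent[OF that(1)] H_tangent[OF that(2)] H_tangent[OF that(3)]] br
      hproj_id[OF p that(1)] hproj_id[OF p that(2)] hproj_id[OF p that(3)]
    using om4_diff[OF p subspace_diff[OF subspace_H D D] T[OF that(4)] that(1-3)] om4_diff[OF p D D that(1-3)] by simp
  have brh: "fundamental_form g \<eta> I \<xi> p [lie_bracket \<A> (A k) (A l) p, \<xi> i p, z, u] = 0"
    if "z \<in> H p" "u \<in> H p" for k l z u
    unfolding om_br[OF xi_tangent[OF p] H_tangent[OF that(1)] H_tangent[OF that(2)]] hproj_xi[OF p]
    using hproj_id[OF p] that om4_zero(2)[OF p hproj_H[OF p tangent_lie_bracket[OF A(1) A(1)]]] by simp
  have dv: "v k (\<lambda>q. fundamental_form g \<eta> I \<xi> q [A a q, A b q, A c q, A d q]) =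
      om4 p (D k a) (hA b p) (hA c p) (hA d p) + om4 p (hA a p) (D k b) (hA c p) (hA d p)
      + om4 p (hA a p) (hA b p) (D k c) (hA d p) + om4 p (hA a p) (hA b p) (hA c p) (D k d)" for k a b c d
    unfolding D_def hA_def by (rule deriv_fundamental_form[OF p vt A(1) A(1) A(1) A(1)])
  note z = om4_zero(1)[OF p]
  have "ext_deriv \<A> (fundamental_form g \<eta> I \<xi>) p [v 0, v 1, v 2, v 3, v 4] =
    om4 p (Tor i p x1) x2 x3 x4 - om4 p (Tor i p x2) x1 x3 x4
    + om4 p (Tor i p x3) x1 x2 x4 - om4 p (Tor i p x4) x1 x2 x3"
    unfolding ext_deriv_5 A_def[symmetric]
    unfolding dv
    unfolding hp v
    unfolding brh[OF x(3,4)] brh[OF x(2,4)] brh[OF x(2,3)] brh[OF x(1,4)]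
      brh[OF x(1,3)] brh[OF x(1,2)]
      br0[where k = 1, unfolded v, OF x(2,3,4) x(1)] br0[where k = 2, unfolded v, OF x(1,3,4) x(2)]
      br0[where k = 3, unfolded v, OF x(1,2,4) x(3)] br0[where k = 4, unfolded v, OF x(1,2,3) x(4)]
      z[OF D x(3,4)] z[OF x(2) D x(4)] z[OF x(2,3) D] z[OF x(1) D x(4)] z[OF x(1) D x(3)] z[OF x(1,3) D] z[OF x(1,2) D]
      z[OF D x(2,4)] z[OF D x(2,3)]
      om4_alternating(1)[OF p D x(1,3,4)] om4_alternating(2)[OF p D x(1,2,4)] om4_alternating(3)[OF p D x(1,2,3)]
    by simp
  then show ?thesis by (simp only: v)
qed

lemma Tor_in_sp_perp: "p \<in> U \<Longrightarrow> in_sp_perp n H g I p (Tor i p)"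
  using conn_data[THEN conjunct2] unfolding Tor_def[abs_def] vertical_def by (simp add: span_base)

lemma pqc_algebra:
  assumes p: "p \<in> U" and e: "orthonormal_basis (H p) (g p) (4 * n) e" and n: "n \<noteq> 0"
  shows "pqc_algebra (H p) (g p) (\<lambda>s. I s p) (\<lambda>i. Tor i p) n e"
proof
  note perp = Tor_in_sp_perp[OF p, unfolded in_sp_perp_def]
  show "linear_on (H p) (Tor i p)" for i using perp[of i] by blast
  show "Tor i p x \<in> H p" if "x \<in> H p" for i x using perp[of i] that by blast
  \<comment> \<open>\<open>in_sp_perp\<close> tests against sums of an element of
    \<open>sp(n)\<close> and one of \<open>sp(1)\<close>; taking the zero map for either summand
    separates the two orthogonality conditions.\<close>
  have zero: "(\<lambda>x. 0) \<in> sp_n H g I p"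
    unfolding sp_n_def using linear_on_zero[OF linear_g subspace_H] linear_on_zero[OF linear_g_left subspace_H]
      linear_on_zero[OF linear_I[OF p] subspace_H] subspace_0[OF subspace_H] by (auto simp: linear_on_def)
  have zero1: "(\<lambda>x. 0) \<in> sp_1 I p"
    unfolding sp_1_def using span_zero[of "range (\<lambda>s. I s p)"] by (simp add: zero_fun_def)
  show "g_trace (g p) (4 * n) e (\<lambda>x y. g p (Tor i p x) (B y)) = 0"
    if "linear_on (H p) B" "\<And>x. x \<in> H p \<Longrightarrow> B x \<in> H p"
      "\<And>x y. x \<in> H p \<Longrightarrow> y \<in> H p \<Longrightarrow> g p (B x) y = - g p x (B y)"
      "\<And>s x. x \<in> H p \<Longrightarrow> B (I s p x) = I s p (B x)" for i B
  proof -
    have "B \<in> sp_n H g I p"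
      unfolding sp_n_def by (intro CollectI conjI ballI allI image_subsetI that)
    then have "g_trace (g p) (4 * n) e (\<lambda>x y. g p (Tor i p x) (B y + 0)) = 0"
      using perp[of i, THEN conjunct2, THEN conjunct2, rule_format, OF _ zero1 e] by blast
    then show ?thesis by (simp only: add_0_right)
  qed
  show "g_trace (g p) (4 * n) e (\<lambda>x y. g p (Tor i p x) (I s p y)) = 0" for i s
  proof -
    have "I s p \<in> sp_1 I p" unfolding sp_1_def by (intro span_base) simp
    then have "g_trace (g p) (4 * n) e (\<lambda>x y. g p (Tor i p x) (0 + I s p y)) = 0"
      using perp[of i, THEN conjunct2, THEN conjunct2, rule_format, OF zero _ e] by blast
    then show ?thesis by (simp only: add_0_left)
  qed
  show "\<exists>c. (s = i \<longrightarrow> c i = 0) \<and> (\<forall>x\<in>H p. \<forall>y\<in>H p.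
      g p (I s p (Tor i p x)) y + g p (I s p x) (Tor i p y) + (g p (I i p (Tor s p x)) y + g p (I i p x) (Tor s p y))
      = (\<Sum>t\<in>UNIV. c t * g p (I t p x) y))" for i s
  proof (rule theta_skew_mod_omega[OF p, of s i])
    fix c :: "3 \<Rightarrow> real"
    assume c: "s = i \<Longrightarrow> c i = 0"
      "\<And>x y. x \<in> H p \<Longrightarrow> y \<in> H p \<Longrightarrow> theta i s p x y + theta s i p x y = (\<Sum>t\<in>UNIV. c t * om t p x y)"
    show ?thesis
      by (intro exI[of _ c] conjI impI ballI c(1) c(2)[unfolded theta_def om_def])
  qed
qed (rule subspace_H linear_g g_sym linear_I[OF p] I_H[OF p] I_I[OF p] I_cyclic[OF p] g_I_left[OF p] e n; assumption)+

lemma tors3_Tor: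
  assumes "p \<in> U" "y \<in> H p"
  shows "tors3 \<A> g nab \<eta> \<xi> p (\<xi> i p) x y = g p (Tor i p x) y"
proof -
  have "\<eta> s p y = 0" for s using assms H_iff by simp
  then show ?thesis unfolding tors3_def ext_metric_def Tor_def hproj_id[OF assms] by simp
qed

end

theorem theorem6p5:
  fixes \<A> :: "('m::{t2_space, second_countable_topology}, 'e::euclidean_space) chart set"
    and n :: nat
    and H :: "'m dist" and C :: "'m hmetric set" and g :: "'m hmetric"
    and PQ :: "'m \<Rightarrow> ('m tvec \<Rightarrow> 'm tvec) set"
    and nab :: "'m connection"
    and U :: "'m set" and \<eta> :: "3 \<Rightarrow> 'm \<Rightarrow> 'm tvec \<Rightarrow> real"
    and I :: "3 \<Rightarrow> 'm endo" and \<xi> :: "3 \<Rightarrow> 'm vfield"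
    and p :: 'm and X Y :: "'m tvec" and e :: "nat \<Rightarrow> 'm tvec"
  defines "d\<Omega> \<equiv> ext_deriv \<A> (fundamental_form g \<eta> I \<xi>)"
    and "tr \<equiv> g_trace (g p) (4 * n) e"
  assumes "pqc_manifold \<A> n H C PQ" and "4 * n + 3 > 7" and "g \<in> C"
    and "canonical_pqc_connection \<A> n H g PQ nab"
    and "compatible_data \<A> H g PQ U \<eta> I" and "reeb_fields \<A> H U \<eta> \<xi>"
    and "p \<in> U" and "X \<in> H p" and "Y \<in> H p"
    and "orthonormal_basis (H p) (g p) (4 * n) e"
  shows "(\<forall>(i, j, k)\<in>cyclic_perms. \<forall>s.
            mu_tensor \<A> g nab \<eta> I \<xi> s p X Y =
              - (1 / (32 * real n)) *
                (tr (\<lambda>a b. d\<Omega> p [\<xi> i p, X, I k p Y, a, I j p b])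
                 - eps k * tr (\<lambda>a b. d\<Omega> p [\<xi> i p, I i p X, I j p Y, a, I j p b])))
       \<and> tau_tensor \<A> g nab \<eta> I \<xi> p X Y =
           1 / (16 * (1 - real n)) *
             (\<Sum>(i, j, k)\<in>cyclic_perms.
                tr (\<lambda>a b. d\<Omega> p [\<xi> i p, X, I k p Y, a, I j p b])
                + eps k * tr (\<lambda>a b. d\<Omega> p [\<xi> i p, I i p X, I j p Y, a, I j p b]))"
proof -
  have M: "smooth_manifold \<A>" "distribution \<A> (4 * n) H" "conformal_class \<A> n H C"
    using assms(3) unfolding pqc_manifold_def by simp_all
  have metric: "neutral_metric \<A> n H g"
    using M(3) assms(5) unfolding conformal_class_def by auto
  interpret pqc_data \<A> n H g PQ nab U \<eta> I \<xi>
    using M(1,2) metric assms(6-8) by unfold_locales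
  note p = assms(9) and X = assms(10) and Y = assms(11) and e = assms(12)
  interpret L: pqc_algebra "H p" "g p" "\<lambda>s. I s p" "\<lambda>i. Tor i p" n e
    using assms(4) by (intro pqc_algebra p e) simp
  have W4: "om4 p x y u v = L.W4 x y u v" for x y u v
    unfolding om4_def L.W4_def L.w_def om_def ..
  have tr: "tr (\<lambda>a b. d\<Omega> p [\<xi> i p, x, y, a, I j p b]) = L.tr (\<lambda>u v. L.dW i x y u (I j p v))"
    if "x \<in> H p" "y \<in> H p" for i j x y
    unfolding tr_def d\<Omega>_def
    by (rule L.tr_cong) (simp add: d_fundamental_form[OF p that] I_H[OF p] L.dW_def W4)
  have mu: "mu_tensor \<A> g nab \<eta> I \<xi> s p X Y = L.mu s X Y" for s
    unfolding mu_tensor_def tors_skew_def L.mu_def L.t_def tors3_Tor[OF p Y] tors3_Tor[OF p I_H[OF p X]] by simp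
  have tau: "tau_tensor \<A> g nab \<eta> I \<xi> p X Y = L.tau X Y"
    unfolding tau_tensor_def tors_sym_def L.tau_def L.t_def tors3_Tor[OF p Y] tors3_Tor[OF p I_H[OF p X]] ..
  show ?thesis
  proof (intro conjI ballI)
    fix c :: "3 \<times> 3 \<times> 3" assume "c \<in> cyclic_perms"
    then show "case c of (i, j, k) \<Rightarrow> \<forall>s. mu_tensor \<A> g nab \<eta> I \<xi> s p X Y = - (1 / (32 * real n)) *
        (tr (\<lambda>a b. d\<Omega> p [\<xi> i p, X, I k p Y, a, I j p b])
         - eps k * tr (\<lambda>a b. d\<Omega> p [\<xi> i p, I i p X, I j p Y, a, I j p b]))"
      unfolding mu tr[OF X I_H[OF p Y]] tr[OF I_H[OF p X] I_H[OF p Y]]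
      using L.mu_formula[OF _ X Y] by (cases c) simp
  next
    show "tau_tensor \<A> g nab \<eta> I \<xi> p X Y = 1 / (16 * (1 - real n)) * (\<Sum>(i, j, k)\<in>cyclic_perms.
        tr (\<lambda>a b. d\<Omega> p [\<xi> i p, X, I k p Y, a, I j p b])
        + eps k * tr (\<lambda>a b. d\<Omega> p [\<xi> i p, I i p X, I j p Y, a, I j p b]))"
      unfolding tau tr[OF X I_H[OF p Y]] tr[OF I_H[OF p X] I_H[OF p Y]]
      using assms(4) by (intro L.tau_formula X Y) simp
  qed
qed

end
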